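(* Let $k$ be a field of characteristic $\neq 2$, $A$ a Hopf algebra over $k$ and $\{e_i \}_{i\in I}$ a $k$-basis of $A$. Then a Hopf algebra $E$ is isomorphic to a crossed product of Hopf algebras $A \# H_4$ if and only if $E \cong A_{(a)}$, for some $a \in \mathcal{Z}\mathcal{P}(A)$, where $A_{(a)}$ is the Hopf algebra having $\{e_i, \, e_i g, \, e_i x, \, e_i gx \mid i\in I \}$ as a $k$-basis and the multiplication is subject to the following relations for any $i\in I$: $$g^2 = 1, \quad x^2 = a, \quad x g = - g x, \quad g \, e_i = e_i \, g, \quad x \, e_i = e_i \, x,$$ while the multiplication in $A_{(a)}$ of two elements $e_i$ and $e_j$ is the same as the one in $A$. The coalgebra structure and the antipode of $A_{(a)}$ are given by $$\Delta (e_i) = \Delta_A (e_i), \quad \Delta (g) = g\otimes g, \quad \Delta (x) = x \otimes 1 + g \otimes x,$$ $$\varepsilon (e_i) = \varepsilon_A (e_i), \quad \varepsilon (g) = 1, \quad \varepsilon (x) = 0,$$ $$S (e_i) = S_A (e_i), \quad S (g) = g, \quad S (x) = - g x$$ for all $i\in I$.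
   Context: $H_4$ is Sweedler's 4-dimensional Hopf algebra over $k$, with basis $\{1,g,x,gx\}$, relations $g^2=1$, $x^2=0$, $xg=-gx$, and $\Delta(g)=g\otimes g$, $\Delta(x)=x\otimes 1+g\otimes x$, $\varepsilon(g)=1$, $\varepsilon(x)=0$. $\mathcal{Z}\mathcal{P}(A)=P(A)\cap Z(A)$, where $P(A)=\{z\in A\mid \Delta(z)=z\otimes 1+1\otimes z\}$ and $Z(A)$ is the center of $A$. Sweedler notation is used. For Hopf algebras $A$, $H$, a weak action of $H$ on $A$ is a $k$-linear map $\triangleright: H\otimes A\to A$ with $h\triangleright 1_A=\varepsilon_H(h)1_A$, $1_H\triangleright a=a$, and $h\triangleright(ab)=(h_{(1)}\triangleright a)(h_{(2)}\triangleright b)$. Given a weak action $\triangleright$ and a $k$-linear map $f:H\otimes H\to A$ (write $f(g,h)=f(g\otimes h)$), $A\#_f^{\triangleright}H$ denotes the vector space $A\otimes H$ (write $a\#h$ for $a\otimes h$) with multiplication $(a\#h)\cdot(c\#g):=a(h_{(1)}\triangleright c)f(h_{(2)},g_{(1)})\#h_{(3)}g_{(2)}$. $A\#_f^{\triangleright}H$ (also written $A\#H$) is a crossed product of Hopf algebras if it is a Hopf algebra with this multiplication, unit $1_A\#1_H$ and the tensor product coalgebra structure. *)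

theory Defs
  imports
    "HOL-Library.Function_Algebras"
    "HOL-Computational_Algebra.Computational_Algebra"
begin

section \<open>Vector spaces and tensor products\<close>

text \<open>
  A vector space over the field \<open>'k\<close> is a subspace \<open>car V\<close> of an ambient space in the sense of
  HOL's \<open>vector_space\<close> (take \<open>car V = UNIV\<close> when the whole type is meant).  Carriers are needed
  because a tensor product of two vector spaces is not itself a type.  Structure maps are only
  constrained on carriers.
\<close>

record ('k, 'v) vec =
  car :: "'v set"
  smul :: "'k \<Rightarrow> 'v \<Rightarrow> 'v"

definition is_vec :: "('k::field, 'v::ab_group_add, 'm) vec_scheme \<Rightarrow> bool" where
  "is_vec V \<longleftrightarrow> vector_space (smul V) \<and> module.subspace (smul V) (car V)"

definition is_basis :: "('k::field, 'v::ab_group_add, 'm) vec_scheme \<Rightarrow> 'i set \<Rightarrow> ('i \<Rightarrow> 'v) \<Rightarrow> bool" where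
  "is_basis V I e \<longleftrightarrow> inj_on e I \<and> \<not> module.dependent (smul V) (e ` I) \<and>
     module.span (smul V) (e ` I) = car V"

definition lin :: "('k::field, 'v::ab_group_add, 'm) vec_scheme \<Rightarrow>
    ('k, 'w::ab_group_add, 'n) vec_scheme \<Rightarrow> ('v \<Rightarrow> 'w) \<Rightarrow> bool" where
  "lin V W f \<longleftrightarrow>
     (\<forall>x\<in>car V. f x \<in> car W) \<and>
     (\<forall>x\<in>car V. \<forall>y\<in>car V. f (x + y) = f x + f y) \<and>
     (\<forall>c. \<forall>x\<in>car V. f (smul V c x) = smul W c (f x))"

definition bilin :: "('k::field, 'u::ab_group_add, 'l) vec_scheme \<Rightarrow>
    ('k, 'v::ab_group_add, 'm) vec_scheme \<Rightarrow> ('k, 'w::ab_group_add, 'n) vec_scheme \<Rightarrow>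
    ('u \<Rightarrow> 'v \<Rightarrow> 'w) \<Rightarrow> bool" where
  "bilin U V W B \<longleftrightarrow> (\<forall>u\<in>car U. lin V W (B u)) \<and> (\<forall>v\<in>car V. lin U W (\<lambda>u. B u v))"

definition ground :: "('k::field, 'k) vec" where
  "ground = \<lparr>car = UNIV, smul = (*)\<rparr>"

text \<open>
  \<open>U \<otimes> V\<close> is realised inside the dual of the space of bilinear forms on \<open>U \<times> V\<close>: the pure tensor
  \<open>u \<otimes> v\<close> is evaluation at \<open>(u, v)\<close>, and \<open>U \<otimes> V\<close> is the span of the pure tensors.  Addition on
  this function type is the pointwise one.  The universal property over a field is
  \<open>ext_pure\<close>, \<open>lin_ext\<close> and \<open>ext_unique\<close> below.
\<close>

type_synonym ('u, 'v, 'k) tens = "('u \<Rightarrow> 'v \<Rightarrow> 'k) \<Rightarrow> 'k"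

definition pure :: "('k::field, 'u::ab_group_add, 'l) vec_scheme \<Rightarrow>
    ('k, 'v::ab_group_add, 'm) vec_scheme \<Rightarrow> 'u \<Rightarrow> 'v \<Rightarrow> ('u, 'v, 'k) tens" where
  "pure U V u v = (\<lambda>\<beta>. if bilin U V ground \<beta> then \<beta> u v else 0)"

definition tsmul :: "'k::field \<Rightarrow> ('u, 'v, 'k) tens \<Rightarrow> ('u, 'v, 'k) tens" where
  "tsmul c t = (\<lambda>\<beta>. c * t \<beta>)"

definition tensor :: "('k::field, 'u::ab_group_add, 'l) vec_scheme \<Rightarrow>
    ('k, 'v::ab_group_add, 'm) vec_scheme \<Rightarrow> ('k, ('u, 'v, 'k) tens) vec" where
  "tensor U V = \<lparr>car = module.span tsmul {pure U V u v |u v. u \<in> car U \<and> v \<in> car V},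
                 smul = tsmul\<rparr>"

text \<open>
  \<open>ext U V B\<close> is the linear map on \<open>U \<otimes> V\<close> induced by a bilinear map \<open>B\<close>.  It expresses Sweedler
  notation: \<open>ext A A (\<lambda>p q. B p q) (comult A a)\<close> is what is written \<open>B(a\<^sub>(\<^sub>1\<^sub>), a\<^sub>(\<^sub>2\<^sub>))\<close>.
\<close>

definition ext :: "('k::field, 'u::ab_group_add, 'l) vec_scheme \<Rightarrow>
    ('k, 'v::ab_group_add, 'm) vec_scheme \<Rightarrow> ('u \<Rightarrow> 'v \<Rightarrow> 'w::ab_group_add) \<Rightarrow>
    ('u, 'v, 'k) tens \<Rightarrow> 'w" where
  "ext U V B t = (THE w. \<exists>ps. set ps \<subseteq> car U \<times> car V \<and>
      t = (\<Sum>(u, v)\<leftarrow>ps. pure U V u v) \<and> w = (\<Sum>(u, v)\<leftarrow>ps. B u v))"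

lemma vector_space_tsmul: "vector_space tsmul"
  by unfold_locales (auto simp: tsmul_def fun_eq_iff algebra_simps)

lemma is_vec_tensor: "is_vec (tensor U V)"
proof -
  interpret vector_space tsmul by (rule vector_space_tsmul)
  show ?thesis
    unfolding is_vec_def tensor_def by (simp add: vector_space_tsmul subspace_span)
qed

lemma linI:
  assumes "\<And>x. x \<in> car V \<Longrightarrow> f x \<in> car W"
    and "\<And>x y. x \<in> car V \<Longrightarrow> y \<in> car V \<Longrightarrow> f (x + y) = f x + f y"
    and "\<And>c x. x \<in> car V \<Longrightarrow> f (smul V c x) = smul W c (f x)"
  shows "lin V W f"
  using assms unfolding lin_def by blast

lemma linD:
  assumes "lin V W f"
  shows "x \<in> car V \<Longrightarrow> f x \<in> car W"
    and "x \<in> car V \<Longrightarrow> y \<in> car V \<Longrightarrow> f (x + y) = f x + f y"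
    and "x \<in> car V \<Longrightarrow> f (smul V c x) = smul W c (f x)"
  using assms unfolding lin_def by blast+

lemma bilinD:
  assumes "bilin U V W B"
  shows "u \<in> car U \<Longrightarrow> v \<in> car V \<Longrightarrow> B u v \<in> car W"
    and "u \<in> car U \<Longrightarrow> u' \<in> car U \<Longrightarrow> v \<in> car V \<Longrightarrow> B (u + u') v = B u v + B u' v"
    and "u \<in> car U \<Longrightarrow> v \<in> car V \<Longrightarrow> v' \<in> car V \<Longrightarrow> B u (v + v') = B u v + B u v'"
    and "u \<in> car U \<Longrightarrow> v \<in> car V \<Longrightarrow> B (smul U c u) v = smul W c (B u v)"
    and "u \<in> car U \<Longrightarrow> v \<in> car V \<Longrightarrow> B u (smul V c v) = smul W c (B u v)"
  using assms unfolding bilin_def lin_def by blast+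

lemma bilinI:
  assumes "\<And>u v. u \<in> car U \<Longrightarrow> v \<in> car V \<Longrightarrow> B u v \<in> car W"
    and "\<And>u u' v. u \<in> car U \<Longrightarrow> u' \<in> car U \<Longrightarrow> v \<in> car V \<Longrightarrow> B (u + u') v = B u v + B u' v"
    and "\<And>u v v'. u \<in> car U \<Longrightarrow> v \<in> car V \<Longrightarrow> v' \<in> car V \<Longrightarrow> B u (v + v') = B u v + B u v'"
    and "\<And>c u v. u \<in> car U \<Longrightarrow> v \<in> car V \<Longrightarrow> B (smul U c u) v = smul W c (B u v)"
    and "\<And>c u v. u \<in> car U \<Longrightarrow> v \<in> car V \<Longrightarrow> B u (smul V c v) = smul W c (B u v)"
  shows "bilin U V W B"
  using assms unfolding bilin_def lin_def by blast

lemma bilin_pure: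
  assumes "is_vec U" "is_vec V"
  shows "bilin U V (tensor U V) (pure U V)"
proof -
  interpret T: vector_space tsmul by (rule vector_space_tsmul)
  show ?thesis
  proof (rule bilinI)
    show "pure U V u v \<in> car (tensor U V)" if "u \<in> car U" "v \<in> car V" for u v
      using that by (auto simp: tensor_def intro!: T.span_base)
  qed (auto simp: tensor_def pure_def tsmul_def fun_eq_iff ground_def dest: bilinD)
qed

lemma tensor_rep:
  assumes "is_vec U" "is_vec V" "t \<in> car (tensor U V)"
  obtains ps where "set ps \<subseteq> car U \<times> car V" "t = (\<Sum>(u, v)\<leftarrow>ps. pure U V u v)"
proof -
  interpret T: vector_space tsmul by (rule vector_space_tsmul)
  interpret U: vector_space "smul U" using assms(1) by (simp add: is_vec_def)
  have Us: "U.subspace (car U)" using assms(1) by (simp add: is_vec_def)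
  have "\<exists>ps. set ps \<subseteq> car U \<times> car V \<and> t = (\<Sum>(u, v)\<leftarrow>ps. pure U V u v)"
    using assms(3) unfolding tensor_def vec.simps
  proof (induction rule: T.span_induct_alt)
    case base
    show ?case by (rule exI[of _ "[]"]) simp
  next
    case (step c x y)
    then obtain u v ps where uv: "x = pure U V u v" "u \<in> car U" "v \<in> car V"
      and ps: "set ps \<subseteq> car U \<times> car V" "y = (\<Sum>(u, v)\<leftarrow>ps. pure U V u v)" by auto
    have cu: "smul U c u \<in> car U" using Us uv by (simp add: U.subspace_scale)
    have "pure U V (smul U c u) v = tsmul c x"
      using bilinD(4)[OF bilin_pure[OF assms(1,2)] uv(2,3)] uv(1) by (simp add: tensor_def)
    then show ?case using cu ps uv by (intro exI[of _ "(smul U c u, v) # ps"]) auto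
  qed
  then show thesis using that by blast
qed

lemma bilin_sum_unique:
  assumes W: "is_vec W" and B: "bilin U V W B"
    and ps: "set ps \<subseteq> car U \<times> car V" and qs: "set qs \<subseteq> car U \<times> car V"
    and eq: "(\<Sum>(u, v)\<leftarrow>ps. pure U V u v) = (\<Sum>(u, v)\<leftarrow>qs. pure U V u v)"
  shows "(\<Sum>(u, v)\<leftarrow>ps. B u v) = (\<Sum>(u, v)\<leftarrow>qs. B u v)"
proof (rule ccontr)
  assume ne: "(\<Sum>(u, v)\<leftarrow>ps. B u v) \<noteq> (\<Sum>(u, v)\<leftarrow>qs. B u v)" (is "?P \<noteq> ?Q")
  interpret W: vector_space "smul W" using W by (simp add: is_vec_def)
  interpret k: vector_space "(*) :: 'a \<Rightarrow> 'a \<Rightarrow> 'a"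
    by unfold_locales (auto simp: algebra_simps)
  interpret WK: vector_space_pair "smul W" "(*) :: 'a \<Rightarrow> 'a \<Rightarrow> 'a" ..
  have "W.independent {?P - ?Q}" using ne by simp
  from WK.linear_independent_extend[OF this, of "\<lambda>_. 1"]
  obtain \<xi> where \<xi>: "Vector_Spaces.linear (smul W) (*) \<xi>" "\<xi> (?P - ?Q) = 1" by auto
  interpret \<xi>: Vector_Spaces.linear "smul W" "(*)" \<xi> by (rule \<xi>(1))
  have bf: "bilin U V ground (\<lambda>u v. \<xi> (B u v))"
    by (rule bilinI) (auto simp: bilinD[OF B] ground_def \<xi>.add \<xi>.scale)
  have ev: "(\<Sum>(u, v)\<leftarrow>rs. pure U V u v) (\<lambda>u v. \<xi> (B u v)) = \<xi> (\<Sum>(u, v)\<leftarrow>rs. B u v)" for rs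
    by (induction rs) (auto simp: pure_def bf \<xi>.add)
  have "\<xi> ?P = \<xi> ?Q" using ev[of ps] ev[of qs] eq by simp
  then show False using \<xi>(2) by (simp add: \<xi>.diff)
qed

lemma ext_sum:
  assumes "is_vec W" "bilin U V W B" "set ps \<subseteq> car U \<times> car V"
  shows "ext U V B (\<Sum>(u, v)\<leftarrow>ps. pure U V u v) = (\<Sum>(u, v)\<leftarrow>ps. B u v)"
  unfolding ext_def
proof (rule the_equality)
  fix w
  assume "\<exists>qs. set qs \<subseteq> car U \<times> car V \<and>
    (\<Sum>(u, v)\<leftarrow>ps. pure U V u v) = (\<Sum>(u, v)\<leftarrow>qs. pure U V u v) \<and> w = (\<Sum>(u, v)\<leftarrow>qs. B u v)"
  then show "w = (\<Sum>(u, v)\<leftarrow>ps. B u v)" using bilin_sum_unique[OF assms] by metis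
qed (rule exI[of _ ps], simp add: assms(3))

lemma ext_pure:
  assumes "is_vec W" "bilin U V W B" "u \<in> car U" "v \<in> car V"
  shows "ext U V B (pure U V u v) = B u v"
  using ext_sum[OF assms(1,2), of "[(u, v)]"] assms(3,4) by simp

lemma lin_ext:
  assumes U: "is_vec U" and V: "is_vec V" and W: "is_vec W" and B: "bilin U V W B"
  shows "lin (tensor U V) W (ext U V B)"
proof (rule linI)
  interpret T: vector_space tsmul by (rule vector_space_tsmul)
  interpret U: vector_space "smul U" using U by (simp add: is_vec_def)
  interpret W: vector_space "smul W" using W by (simp add: is_vec_def)
  have Us: "U.subspace (car U)" using U by (simp add: is_vec_def)
  have Ws: "W.subspace (car W)" using W by (simp add: is_vec_def)
  have in_W: "(\<Sum>(u, v)\<leftarrow>ps. B u v) \<in> car W" if "set ps \<subseteq> car U \<times> car V" for ps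
    using that by (induction ps)
      (auto simp: W.subspace_0[OF Ws] bilinD[OF B] intro!: W.subspace_add[OF Ws])
  fix s assume s: "s \<in> car (tensor U V)"
  obtain ps where ps: "set ps \<subseteq> car U \<times> car V" "s = (\<Sum>(u, v)\<leftarrow>ps. pure U V u v)"
    using tensor_rep[OF U V s] .
  show "ext U V B s \<in> car W" using ext_sum[OF W B ps(1)] ps(2) in_W[OF ps(1)] by simp
  show "ext U V B (s + t) = ext U V B s + ext U V B t" if t: "t \<in> car (tensor U V)" for t
  proof -
    obtain qs where qs: "set qs \<subseteq> car U \<times> car V" "t = (\<Sum>(u, v)\<leftarrow>qs. pure U V u v)"
      using tensor_rep[OF U V t] .
    show ?thesis
      using ext_sum[OF W B, of "ps @ qs"] ext_sum[OF W B ps(1)] ext_sum[OF W B qs(1)] ps qs by simp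
  qed
  show "ext U V B (smul (tensor U V) c s) = smul W c (ext U V B s)" for c
  proof -
    let ?c = "map (\<lambda>(u, v). (smul U c u, v))"
    have sub: "set (?c ps) \<subseteq> car U \<times> car V" using ps(1) Us by (auto simp: U.subspace_scale)
    have "pure U V (smul U c u) v = tsmul c (pure U V u v)" if "u \<in> car U" "v \<in> car V" for u v
      using bilinD(4)[OF bilin_pure[OF U V] that] by (simp add: tensor_def)
    then have 1: "(\<Sum>(u, v)\<leftarrow>?c rs. pure U V u v) = tsmul c (\<Sum>(u, v)\<leftarrow>rs. pure U V u v)"
      if "set rs \<subseteq> car U \<times> car V" for rs
      using that by (induction rs) (auto simp: T.scale_right_distrib)
    have 2: "(\<Sum>(u, v)\<leftarrow>?c rs. B u v) = smul W c (\<Sum>(u, v)\<leftarrow>rs. B u v)"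
      if "set rs \<subseteq> car U \<times> car V" for rs
      using that by (induction rs) (auto simp: W.scale_right_distrib bilinD[OF B])
    show ?thesis
      using ext_sum[OF W B sub] 1[OF ps(1)] 2[OF ps(1)] ext_sum[OF W B ps(1)] ps(2)
      by (simp add: tensor_def)
  qed
qed

lemma ext_unique:
  assumes U: "is_vec U" and V: "is_vec V" and W: "is_vec W" and B: "bilin U V W B"
    and F: "lin (tensor U V) W F"
    and eq: "\<And>u v. u \<in> car U \<Longrightarrow> v \<in> car V \<Longrightarrow> F (pure U V u v) = B u v"
    and t: "t \<in> car (tensor U V)"
  shows "F t = ext U V B t"
proof -
  interpret T: vector_space tsmul by (rule vector_space_tsmul)
  have Ts: "T.subspace (car (tensor U V))" using is_vec_tensor[of U V] by (simp add: is_vec_def tensor_def)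
  obtain ps where ps: "set ps \<subseteq> car U \<times> car V" "t = (\<Sum>(u, v)\<leftarrow>ps. pure U V u v)"
    using tensor_rep[OF U V t] .
  have p: "pure U V u v \<in> car (tensor U V)" if "u \<in> car U" "v \<in> car V" for u v
    using that by (auto simp: tensor_def intro!: T.span_base)
  have F0: "F 0 = 0"
    using linD(2)[OF F T.subspace_0[OF Ts] T.subspace_0[OF Ts]] by simp
  have "(\<Sum>(u, v)\<leftarrow>rs. pure U V u v) \<in> car (tensor U V) \<and>
        F (\<Sum>(u, v)\<leftarrow>rs. pure U V u v) = (\<Sum>(u, v)\<leftarrow>rs. B u v)" if "set rs \<subseteq> car U \<times> car V" for rs
    using that by (induction rs)
      (auto simp: linD[OF F] p eq F0 T.subspace_0[OF Ts] intro!: T.subspace_add[OF Ts])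
  then show ?thesis using ps ext_sum[OF W B ps(1)] by simp
qed

section \<open>Hopf algebras\<close>

record ('k, 'a) bialg = "('k, 'a) vec" +
  mult :: "'a \<Rightarrow> 'a \<Rightarrow> 'a"
  unity :: 'a
  comult :: "'a \<Rightarrow> ('a, 'a, 'k) tens"
  counit :: "'a \<Rightarrow> 'k"

definition is_algebra :: "('k::field, 'a::ab_group_add) bialg \<Rightarrow> bool" where
  "is_algebra A \<longleftrightarrow> is_vec A \<and> bilin A A A (mult A) \<and> unity A \<in> car A \<and>
     (\<forall>a\<in>car A. \<forall>b\<in>car A. \<forall>c\<in>car A. mult A (mult A a b) c = mult A a (mult A b c)) \<and>
     (\<forall>a\<in>car A. mult A (unity A) a = a \<and> mult A a (unity A) = a)"

text \<open>Coassociativity is stated in \<open>A \<otimes> (A \<otimes> A)\<close>.\<close>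

definition is_coalgebra :: "('k::field, 'a::ab_group_add) bialg \<Rightarrow> bool" where
  "is_coalgebra A \<longleftrightarrow> is_vec A \<and> lin A (tensor A A) (comult A) \<and> lin A ground (counit A) \<and>
     (\<forall>a\<in>car A.
        ext A A (\<lambda>p q. ext A A (\<lambda>r s. pure A (tensor A A) r (pure A A s q)) (comult A p)) (comult A a) =
        ext A A (\<lambda>p q. ext A A (\<lambda>r s. pure A (tensor A A) p (pure A A r s)) (comult A q)) (comult A a)) \<and>
     (\<forall>a\<in>car A. ext A A (\<lambda>p q. smul A (counit A p) q) (comult A a) = a \<and>
                ext A A (\<lambda>p q. smul A (counit A q) p) (comult A a) = a)"

definition tensor_mult :: "('k::field, 'a::ab_group_add) bialg \<Rightarrow>
    ('a, 'a, 'k) tens \<Rightarrow> ('a, 'a, 'k) tens \<Rightarrow> ('a, 'a, 'k) tens" where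
  "tensor_mult A s t =
     ext A A (\<lambda>p q. ext A A (\<lambda>p' q'. pure A A (mult A p p') (mult A q q')) t) s"

definition is_bialgebra :: "('k::field, 'a::ab_group_add) bialg \<Rightarrow> bool" where
  "is_bialgebra A \<longleftrightarrow> is_algebra A \<and> is_coalgebra A \<and>
     (\<forall>a\<in>car A. \<forall>b\<in>car A. comult A (mult A a b) = tensor_mult A (comult A a) (comult A b)) \<and>
     comult A (unity A) = pure A A (unity A) (unity A) \<and>
     (\<forall>a\<in>car A. \<forall>b\<in>car A. counit A (mult A a b) = counit A a * counit A b) \<and>
     counit A (unity A) = 1"

definition is_antipode :: "('k::field, 'a::ab_group_add) bialg \<Rightarrow> ('a \<Rightarrow> 'a) \<Rightarrow> bool" where
  "is_antipode A S \<longleftrightarrow> lin A A S \<and>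
     (\<forall>a\<in>car A. ext A A (\<lambda>p q. mult A (S p) q) (comult A a) = smul A (counit A a) (unity A) \<and>
                ext A A (\<lambda>p q. mult A p (S q)) (comult A a) = smul A (counit A a) (unity A))"

definition is_hopf :: "('k::field, 'a::ab_group_add) bialg \<Rightarrow> bool" where
  "is_hopf A \<longleftrightarrow> is_bialgebra A \<and> (\<exists>S. is_antipode A S)"

definition is_hopf_iso :: "('k::field, 'a::ab_group_add) bialg \<Rightarrow> ('k, 'b::ab_group_add) bialg \<Rightarrow>
    ('a \<Rightarrow> 'b) \<Rightarrow> bool" where
  "is_hopf_iso A B \<phi> \<longleftrightarrow> bij_betw \<phi> (car A) (car B) \<and> lin A B \<phi> \<and>
     (\<forall>a\<in>car A. \<forall>b\<in>car A. \<phi> (mult A a b) = mult B (\<phi> a) (\<phi> b)) \<and>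
     \<phi> (unity A) = unity B \<and>
     (\<forall>a\<in>car A. comult B (\<phi> a) = ext A A (\<lambda>p q. pure B B (\<phi> p) (\<phi> q)) (comult A a)) \<and>
     (\<forall>a\<in>car A. counit B (\<phi> a) = counit A a)"

definition hopf_isomorphic :: "('k::field, 'a::ab_group_add) bialg \<Rightarrow>
    ('k, 'b::ab_group_add) bialg \<Rightarrow> bool" where
  "hopf_isomorphic A B \<longleftrightarrow> (\<exists>\<phi>. is_hopf_iso A B \<phi>)"

definition primitives :: "('k::field, 'a::ab_group_add) bialg \<Rightarrow> 'a set" where
  "primitives A = {z \<in> car A. comult A z = pure A A z (unity A) + pure A A (unity A) z}"

definition center :: "('k::field, 'a::ab_group_add) bialg \<Rightarrow> 'a set" where
  "center A = {z \<in> car A. \<forall>a\<in>car A. mult A z a = mult A a z}"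

definition ZP :: "('k::field, 'a::ab_group_add) bialg \<Rightarrow> 'a set" where
  "ZP A = primitives A \<inter> center A"

section \<open>Crossed products\<close>

text \<open>Linear maps out of \<open>H \<otimes> A\<close> and \<open>H \<otimes> H\<close> are given as bilinear maps.\<close>

definition is_weak_action :: "('k::field, 'h::ab_group_add) bialg \<Rightarrow>
    ('k, 'a::ab_group_add) bialg \<Rightarrow> ('h \<Rightarrow> 'a \<Rightarrow> 'a) \<Rightarrow> bool" where
  "is_weak_action H A act \<longleftrightarrow> bilin H A A act \<and>
     (\<forall>h\<in>car H. act h (unity A) = smul A (counit H h) (unity A)) \<and>
     (\<forall>a\<in>car A. act (unity H) a = a) \<and>
     (\<forall>h\<in>car H. \<forall>a\<in>car A. \<forall>b\<in>car A.
        act h (mult A a b) = ext H H (\<lambda>h1 h2. mult A (act h1 a) (act h2 b)) (comult H h))"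

definition crossed_mult :: "('k::field, 'a::ab_group_add) bialg \<Rightarrow> ('k, 'h::ab_group_add) bialg \<Rightarrow>
    ('h \<Rightarrow> 'a \<Rightarrow> 'a) \<Rightarrow> ('h \<Rightarrow> 'h \<Rightarrow> 'a) \<Rightarrow> 'a \<Rightarrow> 'h \<Rightarrow> 'a \<Rightarrow> 'h \<Rightarrow> ('a, 'h, 'k) tens" where
  "crossed_mult A H act f a h c g =
     ext H H (\<lambda>h1 h'. ext H H (\<lambda>h2 h3. ext H H (\<lambda>g1 g2.
         pure A H (mult A (mult A a (act h1 c)) (f h2 g1)) (mult H h3 g2))
       (comult H g)) (comult H h')) (comult H h)"

definition crossed :: "('k::field, 'a::ab_group_add) bialg \<Rightarrow> ('k, 'h::ab_group_add) bialg \<Rightarrow>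
    ('h \<Rightarrow> 'a \<Rightarrow> 'a) \<Rightarrow> ('h \<Rightarrow> 'h \<Rightarrow> 'a) \<Rightarrow> ('k, ('a, 'h, 'k) tens) bialg" where
  "crossed A H act f =
     \<lparr>car = car (tensor A H), smul = smul (tensor A H),
      mult = (\<lambda>s t. ext A H (\<lambda>a h. ext A H (\<lambda>c g. crossed_mult A H act f a h c g) t) s),
      unity = pure A H (unity A) (unity H),
      comult = ext A H (\<lambda>a h. ext A A (\<lambda>a1 a2. ext H H (\<lambda>h1 h2.
          pure (tensor A H) (tensor A H) (pure A H a1 h1) (pure A H a2 h2))
        (comult H h)) (comult A a)),
      counit = ext A H (\<lambda>a h. counit A a * counit H h)\<rparr>"

definition is_crossed_product_of_hopf_algebras :: "('k::field, 'a::ab_group_add) bialg \<Rightarrow>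
    ('k, 'h::ab_group_add) bialg \<Rightarrow> ('h \<Rightarrow> 'a \<Rightarrow> 'a) \<Rightarrow> ('h \<Rightarrow> 'h \<Rightarrow> 'a) \<Rightarrow> bool" where
  "is_crossed_product_of_hopf_algebras A H act f \<longleftrightarrow>
     is_weak_action H A act \<and> bilin H H A f \<and> is_hopf (crossed A H act f)"

section \<open>Sweedler's Hopf algebra and the Hopf algebras \<open>A\<^sub>(\<^sub>a\<^sub>)\<close>\<close>

datatype h4b = B1 | Bg | Bx | Bgx

text \<open>The element \<open>p \<cdot> b\<close> for a basis vector \<open>b\<close> of \<open>H\<^sub>4\<close> and a coefficient \<open>p\<close>.\<close>

definition put :: "'a \<Rightarrow> h4b \<Rightarrow> h4b \<Rightarrow> 'a::zero" where
  "put p b = (\<lambda>c. if c = b then p else 0)"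

definition H4_vec :: "('k::field, h4b \<Rightarrow> 'k) vec" where
  "H4_vec = \<lparr>car = UNIV, smul = (\<lambda>c u b. c * u b)\<rparr>"

text \<open>The coordinates of a product come from
  \<open>g\<^sup>2 = 1\<close>, \<open>x\<^sup>2 = 0\<close>, \<open>xg = -gx\<close>; and \<open>\<Delta>(gx) = \<Delta>(g)\<Delta>(x) = gx \<otimes> g + 1 \<otimes> gx\<close>.\<close>

definition H4 :: "('k::field, h4b \<Rightarrow> 'k) bialg" where
  "H4 =
     \<lparr>car = car H4_vec, smul = smul H4_vec,
      mult = (\<lambda>u v. (\<lambda>b. case b of
          B1 \<Rightarrow> u B1 * v B1 + u Bg * v Bg
        | Bg \<Rightarrow> u B1 * v Bg + u Bg * v B1
        | Bx \<Rightarrow> u B1 * v Bx + u Bg * v Bgx + u Bx * v B1 - u Bgx * v Bg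
        | Bgx \<Rightarrow> u B1 * v Bgx + u Bg * v Bx - u Bx * v Bg + u Bgx * v B1)),
      unity = put 1 B1,
      comult = (\<lambda>u. let t = (\<lambda>b c. pure H4_vec H4_vec (put 1 b) (put 1 c)) in
          tsmul (u B1) (t B1 B1) + tsmul (u Bg) (t Bg Bg) +
          tsmul (u Bx) (t Bx B1 + t Bg Bx) + tsmul (u Bgx) (t Bgx Bg + t B1 Bgx)),
      counit = (\<lambda>u. u B1 + u Bg)\<rparr>"

lemma H4_relations:
  defines "g \<equiv> put 1 Bg :: h4b \<Rightarrow> 'k::field" and "x \<equiv> put 1 Bx"
  shows "mult H4 g g = unity H4" "mult H4 x x = 0" "mult H4 x g = - mult H4 g x"
    "mult H4 g x = put 1 Bgx"
  by (auto simp: H4_def put_def g_def x_def fun_eq_iff split: h4b.split)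

text \<open>
  \<open>A\<^sub>(\<^sub>a\<^sub>)\<close> as a space is \<open>A\<^sup>4\<close>, with \<open>u\<close> standing for
  \<open>u\<^sub>1 + u\<^sub>g g + u\<^sub>x x + u\<^sub>g\<^sub>x gx\<close>.  Since \<open>g\<close> and \<open>x\<close> commute with \<open>A\<close>, its product is
  determined by \<open>g\<^sup>2 = 1\<close>, \<open>x\<^sup>2 = a\<close>, \<open>xg = -gx\<close>, and hence
  \<open>x \<cdot> gx = -ga\<close>, \<open>gx \<cdot> x = ga\<close>, \<open>gx \<cdot> gx = -a\<close>.
\<close>

definition Aa_vec :: "('k::field, 'a::ab_group_add) bialg \<Rightarrow> ('k, h4b \<Rightarrow> 'a) vec" where
  "Aa_vec A = \<lparr>car = {u. \<forall>b. u b \<in> car A}, smul = (\<lambda>c u b. smul A c (u b))\<rparr>"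

definition Aa :: "('k::field, 'a::ab_group_add) bialg \<Rightarrow> 'a \<Rightarrow> ('k, h4b \<Rightarrow> 'a) bialg" where
  "Aa A a =
     \<lparr>car = car (Aa_vec A), smul = smul (Aa_vec A),
      mult = (\<lambda>u v. let m = (\<lambda>b c. mult A (u b) (v c)) in (\<lambda>b. case b of
          B1 \<Rightarrow> m B1 B1 + m Bg Bg + mult A (m Bx Bx) a - mult A (m Bgx Bgx) a
        | Bg \<Rightarrow> m B1 Bg + m Bg B1 - mult A (m Bx Bgx) a + mult A (m Bgx Bx) a
        | Bx \<Rightarrow> m B1 Bx + m Bg Bgx + m Bx B1 - m Bgx Bg
        | Bgx \<Rightarrow> m B1 Bgx + m Bg Bx - m Bx Bg + m Bgx B1)),
      unity = put (unity A) B1,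
      comult = (\<lambda>u.
        let t = (\<lambda>b c p q. pure (Aa_vec A) (Aa_vec A) (put p b) (put q c)) in
          ext A A (t B1 B1) (comult A (u B1)) +
          ext A A (t Bg Bg) (comult A (u Bg)) +
          ext A A (\<lambda>p q. t Bx B1 p q + t Bg Bx p q) (comult A (u Bx)) +
          ext A A (\<lambda>p q. t Bgx Bg p q + t B1 Bgx p q) (comult A (u Bgx))),
      counit = (\<lambda>u. counit A (u B1) + counit A (u Bg))\<rparr>"

text \<open>
  The description of \<open>A\<^sub>(\<^sub>a\<^sub>)\<close> by basis and relations, for a Hopf algebra \<open>B\<close> with elements
  \<open>g\<close>, \<open>x\<close> and a linear map \<open>\<iota>\<close> through which \<open>e\<^sub>i \<in> A\<close> is regarded as an element of \<open>B\<close>.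
  Antipodes are unique, so the quantifiers over them only name the antipodes of \<open>A\<close> and \<open>B\<close>.
\<close>

definition is_presented :: "('k::field, 'a::ab_group_add) bialg \<Rightarrow> 'i set \<Rightarrow> ('i \<Rightarrow> 'a) \<Rightarrow> 'a \<Rightarrow>
    ('k, 'b::ab_group_add) bialg \<Rightarrow> ('a \<Rightarrow> 'b) \<Rightarrow> 'b \<Rightarrow> 'b \<Rightarrow> bool" where
  "is_presented A I e a B \<iota> g x \<longleftrightarrow>
     is_hopf B \<and> lin A B \<iota> \<and> \<iota> (unity A) = unity B \<and> g \<in> car B \<and> x \<in> car B \<and>
     is_basis B (I \<times> UNIV) (\<lambda>(i, b). case b of
         B1 \<Rightarrow> \<iota> (e i)
       | Bg \<Rightarrow> mult B (\<iota> (e i)) g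
       | Bx \<Rightarrow> mult B (\<iota> (e i)) x
       | Bgx \<Rightarrow> mult B (\<iota> (e i)) (mult B g x)) \<and>
     mult B g g = unity B \<and> mult B x x = \<iota> a \<and> mult B x g = - mult B g x \<and>
     (\<forall>i\<in>I. mult B g (\<iota> (e i)) = mult B (\<iota> (e i)) g \<and> mult B x (\<iota> (e i)) = mult B (\<iota> (e i)) x) \<and>
     (\<forall>i\<in>I. \<forall>j\<in>I. mult B (\<iota> (e i)) (\<iota> (e j)) = \<iota> (mult A (e i) (e j))) \<and>
     (\<forall>i\<in>I. comult B (\<iota> (e i)) = ext A A (\<lambda>p q. pure B B (\<iota> p) (\<iota> q)) (comult A (e i))) \<and>
     comult B g = pure B B g g \<and>
     comult B x = pure B B x (unity B) + pure B B g x \<and>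
     (\<forall>i\<in>I. counit B (\<iota> (e i)) = counit A (e i)) \<and> counit B g = 1 \<and> counit B x = 0 \<and>
     (\<forall>SA SB. is_antipode A SA \<and> is_antipode B SB \<longrightarrow>
        (\<forall>i\<in>I. SB (\<iota> (e i)) = \<iota> (SA (e i))) \<and> SB g = g \<and> SB x = - mult B g x)"

end

theory Submission
  imports Defs
begin

text \<open>
  In a crossed product \<open>A # H\<^sub>4\<close> every element is a combination of \<open>p\<close>, \<open>p g\<close>, \<open>p x\<close>, \<open>p gx\<close> with
  \<open>p \<in> A\<close>, and the coalgebra structure is that of \<open>A \<otimes> H\<^sub>4\<close>, whatever the action and the cocycle
  are.  Only the product varies, and requiring \<open>\<Delta>\<close> and \<open>\<epsilon>\<close> to be multiplicative leaves almost no
  freedom for it.  Write \<open>gq = (g \<triangleright> q) g\<close>, \<open>xq = (x \<triangleright> q) + (g \<triangleright> q) x\<close>, \<open>g\<^sup>2 = f(g,g)\<close>,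
  \<open>x\<^sup>2 = f(x,x) + (f(x,g) + f(g,x)) x\<close>, and expand both sides of \<open>\<Delta>(yz) = \<Delta>(y) \<Delta>(z)\<close> in the basis
  \<open>b \<otimes> c\<close> of \<open>H\<^sub>4 \<otimes> H\<^sub>4\<close>.  After an application of \<open>\<epsilon>\<close> to the left tensor factor, the coefficient of

  \<^item> \<open>x \<otimes> 1\<close> in \<open>\<Delta>(xq)\<close> gives \<open>g \<triangleright> q = q\<close>, and that of \<open>g \<otimes> 1\<close> gives \<open>x \<triangleright> q = 0\<close>;
  \<^item> \<open>1 \<otimes> x\<close> in \<open>\<Delta>(x\<^sup>2)\<close> gives \<open>f(x,g) + f(g,x) = 0\<close>;
  \<^item> \<open>gx \<otimes> g\<close> in \<open>\<Delta>(g \<cdot> x)\<close> gives \<open>f(g,g) = 1\<close>, and that of \<open>1 \<otimes> g\<close> gives \<open>f(g,x) = 0\<close>.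

  So \<open>g\<close> and \<open>x\<close> commute with \<open>A\<close>, \<open>g\<^sup>2 = 1\<close>, \<open>xg = -gx\<close> and \<open>x\<^sup>2 = a\<close> with \<open>a = f(x,x) \<in> A\<close>.  Since \<open>x\<close>
  commutes with \<open>A\<close>, so does \<open>a\<close>; and \<open>\<Delta>(x)\<^sup>2 = x\<^sup>2 \<otimes> 1 + (xg + gx) \<otimes> x + g\<^sup>2 \<otimes> x\<^sup>2\<close> says that \<open>a\<close> is
  primitive.  These relations determine all products, so the crossed product is \<open>A\<^sub>(\<^sub>a\<^sub>)\<close>
  (\<open>mult_C_eq\<close>, \<open>iso_Aa\<close>).

  Conversely, for \<open>a \<in> ZP A\<close> the product of two basis vectors of \<open>H\<^sub>4\<close> in \<open>A\<^sub>(\<^sub>a\<^sub>)\<close> is a basis vector times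
  \<open>1\<close>, \<open>-1\<close>, \<open>a\<close> or \<open>-a\<close>.  Centrality of \<open>a\<close> makes this product associative (\<open>mult_X_assoc\<close>),
  primitivity makes \<open>\<Delta>\<close> multiplicative (\<open>comult_mult_basis\<close>), and an antipode can be written down,
  so \<open>A\<^sub>(\<^sub>a\<^sub>)\<close> is a Hopf algebra.  It is the crossed product for the trivial action and the cocycle
  \<open>f(h,k) = (id \<otimes> \<epsilon>)(hk)\<close>, where \<open>hk\<close> is the product in \<open>A\<^sub>(\<^sub>a\<^sub>)\<close> (\<open>iso_crossed_ZP\<close>).

  Both directions compare products in coordinates: \<open>\<Phi>\<close> identifies \<open>A\<^sup>4\<close> with \<open>A \<otimes> H\<^sub>4\<close> and is an
  isomorphism of coalgebras for every action and cocycle (\<open>iso_C_K\<close>).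
\<close>

section \<open>Linear algebra on carriers\<close>

lemma is_vecD:
  assumes "is_vec V"
  shows "vector_space (smul V)" "module.subspace (smul V) (car V)"
  using assms by (simp_all add: is_vec_def)

lemma vec_closed:
  assumes "is_vec V"
  shows "0 \<in> car V" "x \<in> car V \<Longrightarrow> y \<in> car V \<Longrightarrow> x + y \<in> car V"
    "x \<in> car V \<Longrightarrow> smul V c x \<in> car V" "x \<in> car V \<Longrightarrow> - x \<in> car V"
    "x \<in> car V \<Longrightarrow> y \<in> car V \<Longrightarrow> x - y \<in> car V"
proof -
  interpret vector_space "smul V" by (rule is_vecD[OF assms])
  note S = is_vecD(2)[OF assms]
  show "0 \<in> car V" "x \<in> car V \<Longrightarrow> y \<in> car V \<Longrightarrow> x + y \<in> car V"
    "x \<in> car V \<Longrightarrow> smul V c x \<in> car V" "x \<in> car V \<Longrightarrow> - x \<in> car V"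
    "x \<in> car V \<Longrightarrow> y \<in> car V \<Longrightarrow> x - y \<in> car V"
    using S by (simp_all add: subspace_0 subspace_add subspace_scale subspace_neg subspace_diff)
qed

lemma vec_smul:
  assumes "is_vec V"
  shows "smul V c (x + y) = smul V c x + smul V c y" "smul V (c + d) x = smul V c x + smul V d x"
    "smul V c (smul V d x) = smul V (c * d) x" "smul V 1 x = x" "smul V 0 x = 0" "smul V c 0 = 0"
    "smul V c (- x) = - smul V c x" "smul V (- c) x = - smul V c x"
    "smul V c (x - y) = smul V c x - smul V c y" "smul V (c - d) x = smul V c x - smul V d x"
proof -
  interpret vector_space "smul V" by (rule is_vecD[OF assms])
  show "smul V c (x + y) = smul V c x + smul V c y" "smul V (c + d) x = smul V c x + smul V d x"
    "smul V c (smul V d x) = smul V (c * d) x" "smul V 1 x = x" "smul V 0 x = 0" "smul V c 0 = 0"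
    "smul V c (- x) = - smul V c x" "smul V (- c) x = - smul V c x"
    "smul V c (x - y) = smul V c x - smul V c y" "smul V (c - d) x = smul V c x - smul V d x"
    by (simp_all add: scale_right_distrib scale_left_distrib scale_right_diff_distrib scale_left_diff_distrib)
qed

lemma vec_sum_list:
  assumes "is_vec V" "\<And>x. x \<in> set xs \<Longrightarrow> f x \<in> car V"
  shows "(\<Sum>x\<leftarrow>xs. f x) \<in> car V"
  using assms(2) by (induction xs) (auto simp: vec_closed[OF assms(1)])

lemma is_vec_ground [simp]: "is_vec ground"
proof -
  interpret vector_space "(*) :: 'a::field \<Rightarrow> 'a \<Rightarrow> 'a"
    by unfold_locales (auto simp: algebra_simps)
  show ?thesis by (simp add: is_vec_def ground_def vector_space_axioms)
qed

lemmas is_vec_tensor [simp]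

lemma lin_0:
  assumes "is_vec V" "lin V W f" shows "f 0 = 0"
  using linD(2)[OF assms(2), of 0 0] vec_closed(1)[OF assms(1)] by simp

lemma lin_minus:
  assumes "is_vec V" "is_vec W" "lin V W f" "x \<in> car V" shows "f (- x) = - f x"
  using linD(3)[OF assms(3,4), of "-1"] by (simp add: vec_smul assms)

lemma lin_sum_list:
  assumes "is_vec V" "lin V W f" "\<And>x. x \<in> set xs \<Longrightarrow> h x \<in> car V"
  shows "f (\<Sum>x\<leftarrow>xs. h x) = (\<Sum>x\<leftarrow>xs. f (h x))"
  using assms(3)
  by (induction xs) (auto simp: lin_0[OF assms(1,2)] linD(2)[OF assms(2)] vec_sum_list[OF assms(1)])

lemma lin_compose:
  assumes "lin U V f" "lin V W g" shows "lin U W (\<lambda>x. g (f x))"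
  using assms unfolding lin_def by simp

lemma bilin_lin:
  assumes "bilin U V W B"
  shows "u \<in> car U \<Longrightarrow> lin V W (B u)" "v \<in> car V \<Longrightarrow> lin U W (\<lambda>u. B u v)"
  using assms unfolding bilin_def by simp_all

lemma bilin_minus:
  assumes "is_vec U" "is_vec V" "is_vec W" "bilin U V W B" "u \<in> car U" "v \<in> car V"
  shows "B (- u) v = - B u v" "B u (- v) = - B u v"
  using lin_minus[OF _ _ bilin_lin(2)[OF assms(4)]] lin_minus[OF _ _ bilin_lin(1)[OF assms(4)]] assms
  by simp_all

lemma bilin_0:
  assumes "is_vec U" "is_vec V" "bilin U V W B"
  shows "v \<in> car V \<Longrightarrow> B 0 v = 0" "u \<in> car U \<Longrightarrow> B u 0 = 0"
  using lin_0[OF _ bilin_lin(2)[OF assms(3)]] lin_0[OF _ bilin_lin(1)[OF assms(3)]] assms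
  by simp_all

text \<open>
  The pure tensors and the induced maps depend on the spaces only through their carriers and
  scalar multiplications, so a Hopf algebra may be replaced by its underlying space.
\<close>

lemma lin_vec_cong:
  assumes "car V = car V'" "smul V = smul V'" "car W = car W'" "smul W = smul W'"
  shows "lin V W = lin V' W'"
  unfolding lin_def[abs_def] by (simp add: assms)

lemma bilin_vec_cong:
  assumes "car U = car U'" "smul U = smul U'" "car V = car V'" "smul V = smul V'"
    "car W = car W'" "smul W = smul W'"
  shows "bilin U V W = bilin U' V' W'"
  unfolding bilin_def[abs_def]
  by (simp add: assms lin_vec_cong[OF assms(1,2,5,6)] lin_vec_cong[OF assms(3,4,5,6)])

lemma pure_vec_cong:
  assumes "car U = car U'" "smul U = smul U'" "car V = car V'" "smul V = smul V'"
  shows "pure U V = pure U' V'"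
  unfolding pure_def[abs_def]
  by (simp add: bilin_vec_cong[OF assms refl refl])

lemma tensor_vec_cong:
  assumes "car U = car U'" "smul U = smul U'" "car V = car V'" "smul V = smul V'"
  shows "tensor U V = tensor U' V'"
  unfolding tensor_def by (simp add: pure_vec_cong[OF assms] assms)

lemma ext_vec_cong:
  assumes "car U = car U'" "smul U = smul U'" "car V = car V'" "smul V = smul V'"
  shows "ext U V = ext U' V'"
  unfolding ext_def[abs_def] by (simp add: pure_vec_cong[OF assms] assms)

lemma is_vec_cong:
  assumes "car U = car U'" "smul U = smul U'" shows "is_vec U = is_vec U'"
  by (simp add: is_vec_def assms)

lemma lin_cong:
  assumes "is_vec V" "\<And>x. x \<in> car V \<Longrightarrow> f x = g x"
  shows "lin V W f = lin V W g"
  unfolding lin_def by (auto simp: assms(2) vec_closed[OF assms(1)])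

lemma lin_add:
  assumes "is_vec W" "lin V W f" "lin V W g" shows "lin V W (\<lambda>x. f x + g x)"
  using assms(2,3) by (simp add: lin_def vec_closed[OF assms(1)] vec_smul[OF assms(1)] add_ac)

lemma bilin_linI:
  assumes "\<And>u. u \<in> car U \<Longrightarrow> lin V W (B u)" "\<And>v. v \<in> car V \<Longrightarrow> lin U W (\<lambda>u. B u v)"
  shows "bilin U V W B"
  using assms by (simp add: bilin_def)

lemma bilin_add:
  assumes "is_vec W" "bilin U V W F" "bilin U V W G"
  shows "bilin U V W (\<lambda>p q. F p q + G p q)"
  using assms unfolding bilin_def by (simp add: lin_add)

lemma sum_list_map_cong:
  assumes "\<And>p q. (p, q) \<in> set ps \<Longrightarrow> f p q = g p q"
  shows "(\<Sum>(p, q)\<leftarrow>ps. f p q) = (\<Sum>(p, q)\<leftarrow>ps. g p q)"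
  using assms by (intro arg_cong[where f = sum_list] map_cong) auto

lemma sum_list_zero: "(\<Sum>(p, q)\<leftarrow>ps. (0::'a::monoid_add)) = 0"
  by (induction ps) auto

lemma sum_list_swap:
  fixes f :: "'p \<Rightarrow> 'q \<Rightarrow> 'r \<Rightarrow> 's \<Rightarrow> 'a::comm_monoid_add"
  shows "(\<Sum>(p, q)\<leftarrow>ps. \<Sum>(r, s)\<leftarrow>rs. f p q r s) = (\<Sum>(r, s)\<leftarrow>rs. \<Sum>(p, q)\<leftarrow>ps. f p q r s)"
  by (induction ps) (auto simp: case_prod_unfold sum_list_addf)

lemma sum_list_concat_pairs:
  fixes f :: "'x \<Rightarrow> 'y \<Rightarrow> 'a::comm_monoid_add"
  shows "(\<Sum>(x, y)\<leftarrow>concat (map (\<lambda>(p, q). map (h p q) (l p q)) ps). f x y) =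
   (\<Sum>(p, q)\<leftarrow>ps. \<Sum>z\<leftarrow>l p q. (case h p q z of (x, y) \<Rightarrow> f x y))"
  by (induction ps) (auto simp: comp_def)

section \<open>Maps induced on tensor products\<close>

lemma ext_cong:
  assumes "\<And>u v. u \<in> car U \<Longrightarrow> v \<in> car V \<Longrightarrow> B u v = B' u v"
  shows "ext U V B t = ext U V B' t"
proof -
  have "(\<Sum>(u, v)\<leftarrow>ps. B u v) = (\<Sum>(u, v)\<leftarrow>ps. B' u v)" if "set ps \<subseteq> car U \<times> car V" for ps
    using that assms by (intro arg_cong[where f = sum_list] map_cong) auto
  then have "(\<exists>ps. set ps \<subseteq> car U \<times> car V \<and> t = (\<Sum>(u, v)\<leftarrow>ps. pure U V u v) \<and> w = (\<Sum>(u, v)\<leftarrow>ps. B u v)) =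
    (\<exists>ps. set ps \<subseteq> car U \<times> car V \<and> t = (\<Sum>(u, v)\<leftarrow>ps. pure U V u v) \<and> w = (\<Sum>(u, v)\<leftarrow>ps. B' u v))" for w
    by (intro arg_cong[where f = Ex] HOL.ext conj_cong refl) simp
  then show ?thesis unfolding ext_def by (intro arg_cong[where f = The]) (rule HOL.ext)
qed

lemma pure_closed:
  assumes "is_vec U" "is_vec V" "u \<in> car U" "v \<in> car V"
  shows "pure U V u v \<in> car (tensor U V)"
  by (rule bilinD(1)[OF bilin_pure]) (use assms in auto)

lemma lin_eq_tensorI:
  assumes "is_vec U" "is_vec V" "is_vec W" "lin (tensor U V) W F" "lin (tensor U V) W G"
    and "\<And>u v. u \<in> car U \<Longrightarrow> v \<in> car V \<Longrightarrow> F (pure U V u v) = G (pure U V u v)"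
    and "t \<in> car (tensor U V)"
  shows "F t = G t"
proof -
  obtain ps where ps: "set ps \<subseteq> car U \<times> car V" "t = (\<Sum>(u, v)\<leftarrow>ps. pure U V u v)"
    using tensor_rep[OF assms(1,2,7)] .
  have "(case x of (u, v) \<Rightarrow> pure U V u v) \<in> car (tensor U V)" if "x \<in> set ps" for x
    using that ps(1) pure_closed[OF assms(1,2)] by auto
  then show ?thesis
    unfolding ps(2)
    apply (subst lin_sum_list[OF is_vec_tensor assms(4)], simp)
    apply (subst lin_sum_list[OF is_vec_tensor assms(5)], simp)
    apply (rule arg_cong[where f = sum_list], rule map_cong)
    using ps(1) assms(6) by auto
qed

lemma ext_compose:
  assumes "is_vec U" "is_vec V" "is_vec W" "is_vec Z" "bilin U V W B" "lin W Z L"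
    and "t \<in> car (tensor U V)"
  shows "L (ext U V B t) = ext U V (\<lambda>u v. L (B u v)) t"
proof (rule ext_unique[OF assms(1,2,4) _ _ _ assms(7)])
  show "bilin U V Z (\<lambda>u v. L (B u v))"
    using assms(5,6) unfolding bilin_def lin_def by simp
  show "lin (tensor U V) Z (\<lambda>t. L (ext U V B t))"
    by (rule lin_compose[OF lin_ext assms(6)]) (use assms in auto)
qed (simp add: ext_pure[OF assms(3,5)])

lemma ext_pure_id:
  assumes "is_vec U" "is_vec V" "t \<in> car (tensor U V)"
  shows "ext U V (pure U V) t = t"
  using ext_unique[OF assms(1,2) is_vec_tensor bilin_pure[OF assms(1,2)], of "\<lambda>t. t"] assms(3)
  by (simp add: lin_def)

text \<open>
  A tensor is a finite sum of pure tensors, so a map induced on it depends linearly on a parameter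
  as soon as its values on pure tensors do.
\<close>

lemma lin_ext_param:
  assumes "is_vec U" "is_vec V" "is_vec W"
    and "\<And>u v. u \<in> car U \<Longrightarrow> v \<in> car V \<Longrightarrow> lin P W (\<lambda>p. T p u v)"
    and B: "\<And>p. p \<in> car P \<Longrightarrow> bilin U V W (T p)"
    and "is_vec P" "t \<in> car (tensor U V)"
  shows "lin P W (\<lambda>p. ext U V (T p) t)"
proof -
  obtain ps where ps: "set ps \<subseteq> car U \<times> car V" "t = (\<Sum>(u, v)\<leftarrow>ps. pure U V u v)"
    using tensor_rep[OF assms(1,2,7)] .
  have e: "ext U V (T p) t = (\<Sum>(u, v)\<leftarrow>ps. T p u v)" if "p \<in> car P" for p
    unfolding ps(2) by (rule ext_sum[OF assms(3) B[OF that] ps(1)])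
  have "lin P W (\<lambda>p. \<Sum>(u, v)\<leftarrow>ps. T p u v)"
    using ps(1)
  proof (induction ps)
    case Nil
    then show ?case by (simp add: lin_def vec_closed[OF assms(3)] vec_smul[OF assms(3)])
  next
    case (Cons x ps)
    then show ?case using assms(4)[of "fst x" "snd x"]
      by (auto simp: lin_def vec_closed[OF assms(3)] vec_smul[OF assms(3)] algebra_simps)
  qed
  then show ?thesis
    by (auto simp: lin_def e vec_closed[OF assms(6)])
qed

lemma bilin_ext_param:
  assumes "is_vec U" "is_vec V" "is_vec W" "is_vec P" "is_vec Q"
    and "\<And>p q. p \<in> car P \<Longrightarrow> q \<in> car Q \<Longrightarrow> bilin U V W (T p q)"
    and "\<And>u v. u \<in> car U \<Longrightarrow> v \<in> car V \<Longrightarrow> bilin P Q W (\<lambda>p q. T p q u v)"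
    and "t \<in> car (tensor U V)"
  shows "bilin P Q W (\<lambda>p q. ext U V (T p q) t)"
  unfolding bilin_def[of P Q]
  by (intro conjI ballI lin_ext_param assms(1-6,8)) (simp_all add: bilin_lin[OF assms(7)])

definition trilin where
  "trilin U V W Z T \<longleftrightarrow> (\<forall>u\<in>car U. bilin V W Z (T u)) \<and>
     (\<forall>v\<in>car V. \<forall>w\<in>car W. lin U Z (\<lambda>u. T u v w))"

lemma trilinD:
  assumes "trilin U V W Z T"
  shows "u \<in> car U \<Longrightarrow> bilin V W Z (T u)" "v \<in> car V \<Longrightarrow> bilin U W Z (\<lambda>u. T u v)"
    "w \<in> car W \<Longrightarrow> bilin U V Z (\<lambda>u v. T u v w)"
  using assms unfolding trilin_def bilin_def by simp_all

lemma trilin_lin: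
  assumes "trilin U V W Z T"
  shows "u \<in> car U \<Longrightarrow> v \<in> car V \<Longrightarrow> lin W Z (T u v)"
    "u \<in> car U \<Longrightarrow> w \<in> car W \<Longrightarrow> lin V Z (\<lambda>v. T u v w)"
    "v \<in> car V \<Longrightarrow> w \<in> car W \<Longrightarrow> lin U Z (\<lambda>u. T u v w)"
  using assms unfolding trilin_def bilin_def by simp_all

text \<open>
  In an iterated Sweedler expression the contracted tensor is itself the coproduct of one leg of
  another coproduct, the left or the right one.
\<close>

lemma bilin_ext_left:
  assumes "is_vec U" "is_vec V" "is_vec W" "is_vec Q" "trilin U V Q W T" "lin P (tensor U V) \<delta>"
  shows "bilin P Q W (\<lambda>p q. ext U V (\<lambda>r s. T r s q) (\<delta> p))"
  unfolding bilin_def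
proof safe
  fix p assume "p \<in> car P"
  then show "lin Q W (\<lambda>q. ext U V (\<lambda>r s. T r s q) (\<delta> p))"
    by (intro lin_ext_param assms trilin_lin(1)[OF assms(5)] trilinD[OF assms(5)] linD(1)[OF assms(6)])
next
  fix q assume "q \<in> car Q"
  then show "lin P W (\<lambda>p. ext U V (\<lambda>r s. T r s q) (\<delta> p))"
    by (intro lin_compose[OF assms(6)] lin_ext assms trilinD(3)[OF assms(5)])
qed

lemma bilin_ext_right:
  assumes "is_vec U" "is_vec V" "is_vec W" "is_vec P" "trilin P U V W T" "lin Q (tensor U V) \<delta>"
  shows "bilin P Q W (\<lambda>p q. ext U V (T p) (\<delta> q))"
  unfolding bilin_def
proof safe
  fix q assume "q \<in> car Q"
  then show "lin P W (\<lambda>p. ext U V (T p) (\<delta> q))"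
    by (intro lin_ext_param assms trilin_lin(3)[OF assms(5)] trilinD[OF assms(5)] linD(1)[OF assms(6)])
next
  fix p assume "p \<in> car P"
  then show "lin Q W (\<lambda>q. ext U V (T p) (\<delta> q))"
    by (intro lin_compose[OF assms(6)] lin_ext assms trilinD(1)[OF assms(5)])
qed

lemma trilinI:
  assumes "\<And>u v w. u \<in> car U \<Longrightarrow> v \<in> car V \<Longrightarrow> w \<in> car W \<Longrightarrow> T u v w \<in> car Z"
    and "\<And>u u' v w. u \<in> car U \<Longrightarrow> u' \<in> car U \<Longrightarrow> v \<in> car V \<Longrightarrow> w \<in> car W \<Longrightarrow> T (u + u') v w = T u v w + T u' v w"
    and "\<And>u v v' w. u \<in> car U \<Longrightarrow> v \<in> car V \<Longrightarrow> v' \<in> car V \<Longrightarrow> w \<in> car W \<Longrightarrow> T u (v + v') w = T u v w + T u v' w"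
    and "\<And>u v w w'. u \<in> car U \<Longrightarrow> v \<in> car V \<Longrightarrow> w \<in> car W \<Longrightarrow> w' \<in> car W \<Longrightarrow> T u v (w + w') = T u v w + T u v w'"
    and "\<And>c u v w. u \<in> car U \<Longrightarrow> v \<in> car V \<Longrightarrow> w \<in> car W \<Longrightarrow> T (smul U c u) v w = smul Z c (T u v w)"
    and "\<And>c u v w. u \<in> car U \<Longrightarrow> v \<in> car V \<Longrightarrow> w \<in> car W \<Longrightarrow> T u (smul V c v) w = smul Z c (T u v w)"
    and "\<And>c u v w. u \<in> car U \<Longrightarrow> v \<in> car V \<Longrightarrow> w \<in> car W \<Longrightarrow> T u v (smul W c w) = smul Z c (T u v w)"
  shows "trilin U V W Z T"
  using assms unfolding trilin_def bilin_def lin_def by simp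

section \<open>Sweedler sums\<close>

text \<open>
  Fixing an expansion of \<open>\<Delta>(a)\<close> into pure tensors turns a Sweedler expression into a finite sum over
  a list.  Such sums are additive and can be interchanged whether or not the summand is bilinear;
  multilinearity is needed for the passage from \<open>ext\<close> to the sum, in \<open>ext_comult\<close>, and for
  coassociativity.
\<close>

definition sweedler where
  "sweedler A a = (SOME ps. set ps \<subseteq> car A \<times> car A \<and> comult A a = (\<Sum>(p, q)\<leftarrow>ps. pure A A p q))"

text \<open>
  Coassociativity is left out because these facts also serve to establish it for new coproducts.
\<close>

locale comult_space =
  fixes A :: "('k::field, 'a::ab_group_add) bialg"
  assumes is_vec [simp]: "is_vec A" and lin_comult: "lin A (tensor A A) (comult A)"
begin

lemmas closed [simp] = vec_closed[OF is_vec]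
lemmas smul_simps [simp] = vec_smul[OF is_vec]
lemmas comult_closed [simp] = linD(1)[OF lin_comult]
lemmas pure_in [simp] = pure_closed[OF is_vec is_vec]
lemmas bilin_pure' = bilin_pure[OF is_vec is_vec]

lemma sweedler:
  assumes "a \<in> car A"
  shows "set (sweedler A a) \<subseteq> car A \<times> car A"
    and "comult A a = (\<Sum>(p, q)\<leftarrow>sweedler A a. pure A A p q)"
proof -
  obtain ps where "set ps \<subseteq> car A \<times> car A" "comult A a = (\<Sum>(p, q)\<leftarrow>ps. pure A A p q)"
    using tensor_rep[OF is_vec is_vec comult_closed[OF assms]] .
  then have "\<exists>ps. set ps \<subseteq> car A \<times> car A \<and> comult A a = (\<Sum>(p, q)\<leftarrow>ps. pure A A p q)" by blast
  from someI_ex[OF this] show "set (sweedler A a) \<subseteq> car A \<times> car A"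
    and "comult A a = (\<Sum>(p, q)\<leftarrow>sweedler A a. pure A A p q)"
    unfolding sweedler_def by blast+
qed

lemma sweedler_in:
  assumes "(p, q) \<in> set (sweedler A a)" "a \<in> car A" shows "p \<in> car A" "q \<in> car A"
  using sweedler(1)[OF assms(2)] assms(1) by auto

lemma ext_comult:
  assumes "a \<in> car A" "is_vec W" "bilin A A W B"
  shows "ext A A B (comult A a) = (\<Sum>(p, q)\<leftarrow>sweedler A a. B p q)"
  unfolding sweedler(2)[OF assms(1)]
  by (rule ext_sum[OF assms(2,3) sweedler(1)[OF assms(1)]])

lemma sweedler_cong:
  assumes "a \<in> car A" "\<And>p q. p \<in> car A \<Longrightarrow> q \<in> car A \<Longrightarrow> f p q = g p q"
  shows "(\<Sum>(p, q)\<leftarrow>sweedler A a. f p q) = (\<Sum>(p, q)\<leftarrow>sweedler A a. g p q)"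
  using sweedler_in[OF _ assms(1)] assms(2) by (intro sum_list_map_cong) blast

lemma sweedler_lin:
  assumes "a \<in> car A" "is_vec V" "lin V W L" "\<And>p q. p \<in> car A \<Longrightarrow> q \<in> car A \<Longrightarrow> f p q \<in> car V"
  shows "L (\<Sum>(p, q)\<leftarrow>sweedler A a. f p q) = (\<Sum>(p, q)\<leftarrow>sweedler A a. L (f p q))"
proof -
  have "L (\<Sum>x\<leftarrow>sweedler A a. case x of (p, q) \<Rightarrow> f p q) =
    (\<Sum>x\<leftarrow>sweedler A a. L (case x of (p, q) \<Rightarrow> f p q))"
    using sweedler_in[OF _ assms(1)] assms(4) by (intro lin_sum_list[OF assms(2,3)]) auto
  then show ?thesis by (simp add: case_prod_unfold)
qed

lemma sweedler_closed:
  assumes "a \<in> car A" "is_vec V" "\<And>p q. p \<in> car A \<Longrightarrow> q \<in> car A \<Longrightarrow> f p q \<in> car V"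
  shows "(\<Sum>(p, q)\<leftarrow>sweedler A a. f p q) \<in> car V"
  using sweedler_in[OF _ assms(1)] assms(3) by (intro vec_sum_list[OF assms(2)]) auto

lemma trilin_pure_pure: "trilin A A A (tensor A (tensor A A)) (\<lambda>p q r. pure A (tensor A A) p (pure A A q r))"
  by (rule trilinI) (simp_all add: pure_closed bilinD[OF bilin_pure'] bilinD[OF bilin_pure])

lemma bilin_coassoc:
  "bilin A A (tensor A (tensor A A))
     (\<lambda>p q. ext A A (\<lambda>r s. pure A (tensor A A) r (pure A A s q)) (comult A p))"
  "bilin A A (tensor A (tensor A A))
     (\<lambda>p q. ext A A (\<lambda>r s. pure A (tensor A A) p (pure A A r s)) (comult A q))"
  using bilin_ext_left[OF _ _ _ _ trilin_pure_pure lin_comult]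
    bilin_ext_right[OF _ _ _ _ trilin_pure_pure lin_comult] by simp_all

lemma sum_left:
  assumes "a \<in> car A" "is_vec W" "trilin A A A W T"
  shows "ext A A (\<lambda>p q. ext A A (\<lambda>r s. T r s q) (comult A p)) (comult A a) =
    (\<Sum>(p, q)\<leftarrow>sweedler A a. \<Sum>(r, s)\<leftarrow>sweedler A p. T r s q)"
  by (subst ext_comult[OF assms(1,2) bilin_ext_left[OF _ _ _ _ assms(3) lin_comult]])
    (simp_all add: assms(2) ext_comult[OF _ assms(2) trilinD(3)[OF assms(3)]] cong: sweedler_cong[OF assms(1)])

lemma sum_right:
  assumes "a \<in> car A" "is_vec W" "trilin A A A W T"
  shows "ext A A (\<lambda>p q. ext A A (\<lambda>r s. T p r s) (comult A q)) (comult A a) =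
    (\<Sum>(p, q)\<leftarrow>sweedler A a. \<Sum>(r, s)\<leftarrow>sweedler A q. T p r s)"
  by (subst ext_comult[OF assms(1,2) bilin_ext_right[OF _ _ _ _ assms(3) lin_comult]])
    (simp_all add: assms(2) ext_comult[OF _ assms(2) trilinD(1)[OF assms(3)]] cong: sweedler_cong[OF assms(1)])

end

locale coalgebra = fixes A :: "('k::field, 'a::ab_group_add) bialg"
  assumes coalgebra: "is_coalgebra A"
begin

sublocale comult_space A
  using coalgebra by unfold_locales (simp_all add: is_coalgebra_def)

lemma lin_counit: "lin A ground (counit A)"
  using coalgebra by (simp add: is_coalgebra_def)

lemma counit_simps [simp]:
  "x \<in> car A \<Longrightarrow> y \<in> car A \<Longrightarrow> counit A (x + y) = counit A x + counit A y"
  "x \<in> car A \<Longrightarrow> counit A (smul A c x) = c * counit A x"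
  "counit A 0 = 0" "x \<in> car A \<Longrightarrow> counit A (- x) = - counit A x"
  using linD[OF lin_counit] lin_0[OF is_vec lin_counit] lin_minus[OF is_vec is_vec_ground lin_counit]
  by (simp_all add: ground_def)

lemma bilin_counit:
  "bilin A A A (\<lambda>p q. smul A (counit A p) q)" "bilin A A A (\<lambda>p q. smul A (counit A q) p)"
  by (rule bilinI; simp add: mult.commute)+

lemma sweedler_counit:
  assumes "a \<in> car A"
  shows "(\<Sum>(p, q)\<leftarrow>sweedler A a. smul A (counit A p) q) = a"
    "(\<Sum>(p, q)\<leftarrow>sweedler A a. smul A (counit A q) p) = a"
  using coalgebra assms by (simp_all add: is_coalgebra_def ext_comult[OF _ _ bilin_counit(1)] ext_comult[OF _ _ bilin_counit(2)])

text \<open>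
  Coassociativity is an identity in \<open>A \<otimes> (A \<otimes> A)\<close>; apply to it the linear map induced by \<open>T\<close>.
\<close>

lemma sweedler_coassoc:
  assumes a: "a \<in> car A" and W: "is_vec W" and T: "trilin A A A W T"
  shows "(\<Sum>(p, q)\<leftarrow>sweedler A a. \<Sum>(r, s)\<leftarrow>sweedler A p. T r s q) =
    (\<Sum>(p, q)\<leftarrow>sweedler A a. \<Sum>(r, s)\<leftarrow>sweedler A q. T p r s)"
proof -
  define L where "L = ext A (tensor A A) (\<lambda>p. ext A A (T p))"
  let ?P = "\<lambda>p q r. pure A (tensor A A) p (pure A A q r)"
  have b: "bilin A (tensor A A) W (\<lambda>p. ext A A (T p))"
    unfolding bilin_def
    by (auto intro!: lin_ext lin_ext_param trilinD[OF T] trilin_lin[OF T] W)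
  have L: "lin (tensor A (tensor A A)) W L"
    unfolding L_def by (rule lin_ext[OF _ _ W b]) simp_all
  have LP: "L (?P p q r) = T p q r" if "p \<in> car A" "q \<in> car A" "r \<in> car A" for p q r
    using that by (simp add: L_def ext_pure[OF W b] ext_pure[OF W trilinD(1)[OF T]])
  have P: "?P p q r \<in> car (tensor A (tensor A A))"
    if "p \<in> car A" "q \<in> car A" "r \<in> car A" for p q r using that by (simp add: pure_closed)
  have "(\<Sum>(p, q)\<leftarrow>sweedler A a. \<Sum>(r, s)\<leftarrow>sweedler A p. ?P r s q) =
    (\<Sum>(p, q)\<leftarrow>sweedler A a. \<Sum>(r, s)\<leftarrow>sweedler A q. ?P p r s)"
    using coalgebra a by (simp add: is_coalgebra_def sum_left[OF _ _ trilin_pure_pure] sum_right[OF _ _ trilin_pure_pure])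
  then have "L (\<Sum>(p, q)\<leftarrow>sweedler A a. \<Sum>(r, s)\<leftarrow>sweedler A p. ?P r s q) =
    L (\<Sum>(p, q)\<leftarrow>sweedler A a. \<Sum>(r, s)\<leftarrow>sweedler A q. ?P p r s)" by simp
  then show ?thesis
    by (simp add: sweedler_lin[OF _ _ L] sweedler_closed P LP a cong: sweedler_cong)
qed

end

section \<open>Hopf algebras\<close>

locale hopf = fixes A :: "('k::field, 'a::ab_group_add) bialg"
  assumes hopf: "is_hopf A"
begin

lemma bialgebra: "is_bialgebra A"
  using hopf by (simp add: is_hopf_def)

sublocale coalgebra A
  using bialgebra by unfold_locales (simp add: is_bialgebra_def)

lemma algebra: "is_algebra A"
  using bialgebra by (simp add: is_bialgebra_def)

lemma bilin_mult: "bilin A A A (mult A)"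
  using algebra by (simp add: is_algebra_def)

lemmas mult_simps [simp] = bilinD[OF bilin_mult] bilin_minus[OF is_vec is_vec is_vec bilin_mult]
  bilin_0[OF is_vec is_vec bilin_mult]

lemma unity_simps [simp]:
  "unity A \<in> car A" "a \<in> car A \<Longrightarrow> mult A (unity A) a = a" "a \<in> car A \<Longrightarrow> mult A a (unity A) = a"
  using algebra by (simp_all add: is_algebra_def)

lemma mult_assoc:
  "a \<in> car A \<Longrightarrow> b \<in> car A \<Longrightarrow> c \<in> car A \<Longrightarrow> mult A (mult A a b) c = mult A a (mult A b c)"
  using algebra by (simp add: is_algebra_def)

lemma counit_mult [simp]:
  "a \<in> car A \<Longrightarrow> b \<in> car A \<Longrightarrow> counit A (mult A a b) = counit A a * counit A b"
  "counit A (unity A) = 1"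
  using bialgebra by (simp_all add: is_bialgebra_def)

lemma comult_unity: "comult A (unity A) = pure A A (unity A) (unity A)"
  using bialgebra by (simp add: is_bialgebra_def)

lemma comult_mult:
  "a \<in> car A \<Longrightarrow> b \<in> car A \<Longrightarrow> comult A (mult A a b) = tensor_mult A (comult A a) (comult A b)"
  using bialgebra by (simp add: is_bialgebra_def)

end

lemma tensor_mult_sum:
  assumes A: "is_vec A" and m: "bilin A A A (mult A)"
    and ps: "set ps \<subseteq> car A \<times> car A" and qs: "set qs \<subseteq> car A \<times> car A"
  shows "tensor_mult A (\<Sum>(p, q)\<leftarrow>ps. pure A A p q) (\<Sum>(p, q)\<leftarrow>qs. pure A A p q) =
    (\<Sum>(p, q)\<leftarrow>ps. \<Sum>(p', q')\<leftarrow>qs. pure A A (mult A p p') (mult A q q'))"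
proof -
  note [simp] = A vec_closed[OF A] vec_smul[OF A] bilinD[OF m] bilinD[OF bilin_pure[OF A A]]
  let ?B = "\<lambda>p q p' q'. pure A A (mult A p p') (mult A q q')"
  have b1: "bilin A A (tensor A A) (?B p q)" if "p \<in> car A" "q \<in> car A" for p q
    by (rule bilinI) (use that in simp_all)
  have in_t: "(\<Sum>(p, q)\<leftarrow>qs. pure A A p q) \<in> car (tensor A A)"
    using qs by (intro vec_sum_list) (auto simp: pure_closed)
  have b2: "bilin A A (tensor A A) (\<lambda>p q. ext A A (?B p q) (\<Sum>(p, q)\<leftarrow>qs. pure A A p q))"
    by (rule bilin_ext_param) (auto intro!: b1 bilinI simp: in_t)
  show ?thesis
    unfolding tensor_mult_def
    apply (subst ext_sum[OF is_vec_tensor b2 ps])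
    apply (rule sum_list_map_cong)
    apply (rule ext_sum[OF is_vec_tensor b1 qs])
    using ps by auto
qed

lemma bilin_tensor_mult:
  assumes A: "is_vec A" and m: "bilin A A A (mult A)"
  shows "bilin (tensor A A) (tensor A A) (tensor A A) (tensor_mult A)"
proof -
  note [simp] = A vec_closed[OF A] vec_smul[OF A] bilinD[OF m] bilinD[OF bilin_pure[OF A A]]
  let ?B = "\<lambda>p q p' q'. pure A A (mult A p p') (mult A q q')"
  have b1: "bilin A A (tensor A A) (?B p q)" if "p \<in> car A" "q \<in> car A" for p q
    by (rule bilinI) (use that in simp_all)
  have b2: "bilin A A (tensor A A) (\<lambda>p q. ext A A (?B p q) t)" if "t \<in> car (tensor A A)" for t
    by (rule bilin_ext_param) (auto intro!: b1 bilinI simp: that)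
  show ?thesis
    unfolding bilin_def tensor_mult_def
    by (auto intro!: lin_ext lin_ext_param b1 b2)
qed

context hopf
begin

lemma comult_mult_sum:
  assumes "a \<in> car A" "b \<in> car A"
  shows "comult A (mult A a b) =
    (\<Sum>(p, q)\<leftarrow>sweedler A a. \<Sum>(p', q')\<leftarrow>sweedler A b. pure A A (mult A p p') (mult A q q'))"
  by (simp only: comult_mult[OF assms] sweedler(2)[OF assms(1)] sweedler(2)[OF assms(2)]
      tensor_mult_sum[OF is_vec bilin_mult sweedler(1)[OF assms(1)] sweedler(1)[OF assms(2)]])

lemma comult_mult_mult:
  assumes p: "p \<in> car A" and q: "q \<in> car A" and k: "k \<in> car A"
    and ks: "set ks \<subseteq> car A \<times> car A" "comult A k = (\<Sum>(k1, k2)\<leftarrow>ks. pure A A k1 k2)"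
  shows "comult A (mult A (mult A p q) k) =
    (\<Sum>(p1, p2)\<leftarrow>sweedler A p. \<Sum>(q1, q2)\<leftarrow>sweedler A q. \<Sum>(k1, k2)\<leftarrow>ks.
       pure A A (mult A (mult A p1 q1) k1) (mult A (mult A p2 q2) k2))"
proof -
  let ?l = "concat (map (\<lambda>(p1, p2). map (\<lambda>(q1, q2). (mult A p1 q1, mult A p2 q2)) (sweedler A q)) (sweedler A p))"
  have l: "set ?l \<subseteq> car A \<times> car A"
    using sweedler_in[OF _ p] sweedler_in[OF _ q] by auto
  have c: "comult A (mult A p q) = (\<Sum>(u, v)\<leftarrow>?l. pure A A u v)"
    unfolding comult_mult_sum[OF p q] sum_list_concat_pairs by (simp add: case_prod_unfold)
  have "comult A (mult A (mult A p q) k) = (\<Sum>(u, v)\<leftarrow>?l. \<Sum>(k1, k2)\<leftarrow>ks. pure A A (mult A u k1) (mult A v k2))"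
    using p q k by (simp only: comult_mult mult_simps c ks(2) tensor_mult_sum[OF is_vec bilin_mult l ks(1)])
  also have "\<dots> = (\<Sum>(p1, p2)\<leftarrow>sweedler A p. \<Sum>(q1, q2)\<leftarrow>sweedler A q. \<Sum>(k1, k2)\<leftarrow>ks.
       pure A A (mult A (mult A p1 q1) k1) (mult A (mult A p2 q2) k2))"
    unfolding sum_list_concat_pairs by (simp add: case_prod_unfold)
  finally show ?thesis .
qed

lemma ext_comult_mult:
  assumes W: "is_vec W" and B: "bilin A A W B" and u: "u \<in> car A" and v: "v \<in> car A"
    and ps: "set ps \<subseteq> car A \<times> car A" "comult A u = (\<Sum>(p, q)\<leftarrow>ps. pure A A p q)"
    and qs: "set qs \<subseteq> car A \<times> car A" "comult A v = (\<Sum>(p, q)\<leftarrow>qs. pure A A p q)"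
  shows "ext A A B (comult A (mult A u v)) = (\<Sum>(p, q)\<leftarrow>ps. \<Sum>(p', q')\<leftarrow>qs. B (mult A p p') (mult A q q'))"
proof -
  let ?l = "concat (map (\<lambda>(p, q). map (\<lambda>(p', q'). (mult A p p', mult A q q')) qs) ps)"
  have l: "set ?l \<subseteq> car A \<times> car A" using ps(1) qs(1) by (fastforce dest: subsetD[OF ps(1)] subsetD[OF qs(1)])
  have c: "comult A (mult A u v) = (\<Sum>(p, q)\<leftarrow>?l. pure A A p q)"
    unfolding comult_mult[OF u v] ps(2) qs(2) tensor_mult_sum[OF is_vec bilin_mult ps(1) qs(1)] sum_list_concat_pairs
    by (simp add: case_prod_unfold)
  show ?thesis
    unfolding c unfolding ext_sum[OF W B l] unfolding sum_list_concat_pairs by (simp add: case_prod_unfold)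
qed

lemma antipode_sum:
  assumes S: "is_antipode A S" and a: "a \<in> car A"
  shows "(\<Sum>(p, q)\<leftarrow>sweedler A a. mult A (S p) q) = smul A (counit A a) (unity A)"
    "(\<Sum>(p, q)\<leftarrow>sweedler A a. mult A p (S q)) = smul A (counit A a) (unity A)"
proof -
  have l: "lin A A S" using S by (simp add: is_antipode_def)
  have b: "bilin A A A (\<lambda>p q. mult A (S p) q)" "bilin A A A (\<lambda>p q. mult A p (S q))"
    by (rule bilinI; simp add: linD[OF l])+
  show "(\<Sum>(p, q)\<leftarrow>sweedler A a. mult A (S p) q) = smul A (counit A a) (unity A)"
    "(\<Sum>(p, q)\<leftarrow>sweedler A a. mult A p (S q)) = smul A (counit A a) (unity A)"
    using S a by (simp_all add: is_antipode_def ext_comult[OF _ _ b(1)] ext_comult[OF _ _ b(2)])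
qed

text \<open>
  In the convolution algebra, \<open>S = S * (id * S') = (S * id) * S' = S'\<close>.
\<close>

lemma antipode_unique:
  assumes S: "is_antipode A S" and S': "is_antipode A S'" and a: "a \<in> car A"
  shows "S a = S' a"
proof -
  have l: "lin A A S" "lin A A S'" using S S' by (simp_all add: is_antipode_def)
  note [simp] = linD[OF l(1)] linD[OF l(2)]
  let ?T = "\<lambda>p q r. mult A (S p) (mult A q (S' r))"
  have T: "trilin A A A A ?T" by (rule trilinI) simp_all
  have lm: "lin A A (mult A b)" "lin A A (\<lambda>x. mult A x b)" if "b \<in> car A" for b
    using bilin_lin[OF bilin_mult that] by auto
  have "S a = S (\<Sum>(p, q)\<leftarrow>sweedler A a. smul A (counit A q) p)"
    by (simp add: sweedler_counit a)
  also have "\<dots> = (\<Sum>(p, q)\<leftarrow>sweedler A a. mult A (S p) (smul A (counit A q) (unity A)))"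
    by (simp add: sweedler_lin[OF _ _ l(1)] a cong: sweedler_cong)
  also have "\<dots> = (\<Sum>(p, q)\<leftarrow>sweedler A a. \<Sum>(r, s)\<leftarrow>sweedler A q. ?T p r s)"
    by (rule sweedler_cong[OF a])
      (simp add: antipode_sum(2)[OF S', symmetric] sweedler_lin[OF _ _ lm(1)])
  also have "\<dots> = (\<Sum>(p, q)\<leftarrow>sweedler A a. \<Sum>(r, s)\<leftarrow>sweedler A p. ?T r s q)"
    by (rule sweedler_coassoc[OF a is_vec T, symmetric])
  also have "\<dots> = (\<Sum>(p, q)\<leftarrow>sweedler A a. mult A (smul A (counit A p) (unity A)) (S' q))"
    by (rule sweedler_cong[OF a])
      (simp add: antipode_sum(1)[OF S, symmetric] sweedler_lin[OF _ _ lm(2)] mult_assoc[symmetric] cong: sweedler_cong)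
  also have "\<dots> = S' (\<Sum>(p, q)\<leftarrow>sweedler A a. smul A (counit A p) q)"
    by (simp add: sweedler_lin[OF _ _ l(2)] a cong: sweedler_cong)
  also have "\<dots> = S' a" by (simp add: sweedler_counit a)
  finally show ?thesis .
qed

end

section \<open>Isomorphisms of Hopf algebras\<close>

text \<open>
  An isomorphism satisfies \<open>\<Delta>(\<phi> b) = (\<phi> \<otimes> \<phi>)(\<Delta> b)\<close>, so Sweedler expressions pull back along it.
\<close>

lemma iso_ext_comult:
  assumes B: "is_vec B" "lin B (tensor B B) (comult B)" and C: "is_vec C" and iso: "is_hopf_iso B C \<phi>"
    and W: "is_vec W" and F: "bilin C C W F" and b: "b \<in> car B"
  shows "ext C C F (comult C (\<phi> b)) = ext B B (\<lambda>p q. F (\<phi> p) (\<phi> q)) (comult B b)"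
proof -
  have l: "lin B C \<phi>" using iso by (simp add: is_hopf_iso_def)
  have bp: "bilin B B (tensor C C) (\<lambda>p q. pure C C (\<phi> p) (\<phi> q))"
    by (rule bilinI) (simp_all add: linD[OF l] bilinD[OF bilin_pure[OF C C]])
  have "ext C C F (comult C (\<phi> b)) = ext C C F (ext B B (\<lambda>p q. pure C C (\<phi> p) (\<phi> q)) (comult B b))"
    using iso b by (simp add: is_hopf_iso_def)
  also have "\<dots> = ext B B (\<lambda>p q. ext C C F (pure C C (\<phi> p) (\<phi> q))) (comult B b)"
    by (rule ext_compose[OF B(1) B(1) _ W bp lin_ext[OF C C W F]]) (simp_all add: linD[OF B(2)] b)
  also have "\<dots> = ext B B (\<lambda>p q. F (\<phi> p) (\<phi> q)) (comult B b)"
    by (rule ext_cong) (simp add: ext_pure[OF W F] linD[OF l])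
  finally show ?thesis .
qed

lemma hopf_iso_trans:
  assumes B: "is_vec B" "lin B (tensor B B) (comult B)" and C: "is_vec C" and D: "is_vec D"
    and \<phi>: "is_hopf_iso B C \<phi>" and \<psi>: "is_hopf_iso C D \<psi>"
  shows "is_hopf_iso B D (\<lambda>b. \<psi> (\<phi> b))"
proof -
  have l: "lin B C \<phi>" "lin C D \<psi>" using \<phi> \<psi> by (simp_all add: is_hopf_iso_def)
  have bp: "bilin C C (tensor D D) (\<lambda>p q. pure D D (\<psi> p) (\<psi> q))"
    by (rule bilinI) (simp_all add: linD[OF l(2)] bilinD[OF bilin_pure[OF D D]])
  have "bij_betw (\<psi> \<circ> \<phi>) (car B) (car D)"
    using \<phi> \<psi> bij_betw_trans[of \<phi> "car B" "car C" \<psi> "car D"] by (simp add: is_hopf_iso_def)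
  then have bij: "bij_betw (\<lambda>b. \<psi> (\<phi> b)) (car B) (car D)" by (simp add: comp_def)
  have "comult D (\<psi> (\<phi> b)) = ext B B (\<lambda>p q. pure D D (\<psi> (\<phi> p)) (\<psi> (\<phi> q))) (comult B b)"
    if "b \<in> car B" for b
    using \<psi> linD(1)[OF l(1) that] iso_ext_comult[OF B C \<phi> is_vec_tensor bp that] by (simp add: is_hopf_iso_def)
  then show ?thesis
    using \<phi> \<psi> bij lin_compose[OF l] linD(1)[OF l(1)] by (simp add: is_hopf_iso_def)
qed

lemma hopf_iso_sym:
  assumes B: "is_vec B" "lin B (tensor B B) (comult B)" and C: "is_vec C"
    and m: "\<And>x y. x \<in> car B \<Longrightarrow> y \<in> car B \<Longrightarrow> mult B x y \<in> car B" and u: "unity B \<in> car B"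
    and \<phi>: "is_hopf_iso B C \<phi>"
  shows "is_hopf_iso C B (inv_into (car B) \<phi>)"
proof -
  let ?\<psi> = "inv_into (car B) \<phi>"
  have l: "lin B C \<phi>" and bij: "bij_betw \<phi> (car B) (car C)" using \<phi> by (simp_all add: is_hopf_iso_def)
  have inv: "?\<psi> (\<phi> b) = b" if "b \<in> car B" for b
    using bij that by (simp add: bij_betw_def)
  have sur: "\<exists>b\<in>car B. c = \<phi> b" if "c \<in> car C" for c using bij that by (auto simp: bij_betw_def)
  note [simp] = vec_closed[OF B(1)]
  have l': "lin C B ?\<psi>"
  proof (rule linI)
    fix x assume "x \<in> car C"
    then obtain b where b: "b \<in> car B" "x = \<phi> b" using sur by blast
    show "?\<psi> x \<in> car B" using b inv by simp
    show "?\<psi> (smul C c x) = smul B c (?\<psi> x)" for c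
      using b inv[of b] inv[of "smul B c b"] by (simp add: linD[OF l])
    fix y assume "y \<in> car C"
    then obtain d where d: "d \<in> car B" "y = \<phi> d" using sur by blast
    show "?\<psi> (x + y) = ?\<psi> x + ?\<psi> y"
      using b d inv[of b] inv[of d] inv[of "b + d"] by (simp add: linD[OF l])
  qed
  have bp: "bilin C C (tensor B B) (\<lambda>p q. pure B B (?\<psi> p) (?\<psi> q))"
    by (rule bilinI) (simp_all add: linD[OF l'] bilinD[OF bilin_pure[OF B(1) B(1)]])
  have cm: "comult B (?\<psi> c) = ext C C (\<lambda>p q. pure B B (?\<psi> p) (?\<psi> q)) (comult C c)" if c: "c \<in> car C" for c
  proof -
    obtain b where b: "b \<in> car B" "c = \<phi> b" using sur[OF c] by blast
    have "ext C C (\<lambda>p q. pure B B (?\<psi> p) (?\<psi> q)) (comult C c) = ext B B (pure B B) (comult B b)"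
      unfolding b(2) iso_ext_comult[OF B C \<phi> is_vec_tensor bp b(1)]
      by (rule ext_cong) (simp add: inv)
    also have "\<dots> = comult B b" by (rule ext_pure_id[OF B(1) B(1) linD(1)[OF B(2) b(1)]])
    finally show ?thesis using b inv by simp
  qed
  have mm: "?\<psi> (mult C x y) = mult B (?\<psi> x) (?\<psi> y)" if xy: "x \<in> car C" "y \<in> car C" for x y
  proof -
    obtain b d where b: "b \<in> car B" "x = \<phi> b" "d \<in> car B" "y = \<phi> d" using sur xy by metis
    have "mult C x y = \<phi> (mult B b d)" using \<phi> b by (simp add: is_hopf_iso_def)
    then show ?thesis using b inv[of b] inv[of d] inv[OF m[of b d]] by simp
  qed
  have "?\<psi> (unity C) = unity B" using \<phi> inv[OF u] by (simp add: is_hopf_iso_def)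
  moreover have "counit B (?\<psi> c) = counit C c" if "c \<in> car C" for c
    using sur[OF that] \<phi> inv by (auto simp: is_hopf_iso_def)
  ultimately show ?thesis
    using l' cm mm bij_betw_inv_into[OF bij] by (simp add: is_hopf_iso_def)
qed

text \<open>
  The compatibility of \<open>\<phi>\<close> with the operations determines those of \<open>C\<close> on the image of \<open>\<phi>\<close>, which is the
  whole carrier; each axiom for \<open>C\<close> is thus the image of the corresponding one for \<open>B\<close>.
\<close>

lemma hopf_transport:
  assumes B: "is_hopf B" and C: "is_vec C" and \<phi>: "is_hopf_iso B C \<phi>"
  shows "is_hopf C"
proof -
  interpret B: hopf B by unfold_locales (rule B)
  let ?\<psi> = "inv_into (car B) \<phi>"
  have l: "lin B C \<phi>" and bij: "bij_betw \<phi> (car B) (car C)"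
    and m: "\<And>a b. a \<in> car B \<Longrightarrow> b \<in> car B \<Longrightarrow> mult C (\<phi> a) (\<phi> b) = \<phi> (mult B a b)"
    and u: "unity C = \<phi> (unity B)"
    and cm: "\<And>a. a \<in> car B \<Longrightarrow> comult C (\<phi> a) = ext B B (\<lambda>p q. pure C C (\<phi> p) (\<phi> q)) (comult B a)"
    and cu: "\<And>a. a \<in> car B \<Longrightarrow> counit C (\<phi> a) = counit B a"
    using \<phi> by (simp_all add: is_hopf_iso_def)
  note [simp] = linD[OF l] m u cu vec_closed[OF C] vec_smul[OF C]
  have im: "car C = \<phi> ` car B" using bij by (simp add: bij_betw_def)
  have sur: "(\<And>b. b \<in> car B \<Longrightarrow> P (\<phi> b)) \<Longrightarrow> c \<in> car C \<Longrightarrow> P c" for c P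
    unfolding im by blast
  have inv: "?\<psi> (\<phi> b) = b" if "b \<in> car B" for b
    using bij that by (simp add: bij_betw_def)
  have bp: "bilin B B (tensor C C) (\<lambda>p q. pure C C (\<phi> p) (\<phi> q))"
    by (rule bilinI) (simp_all add: bilinD[OF bilin_pure[OF C C]])
  have cml: "lin B (tensor C C) (\<lambda>b. comult C (\<phi> b))"
    using lin_compose[OF B.lin_comult lin_ext[OF B.is_vec B.is_vec is_vec_tensor bp]]
    by (simp only: lin_cong[OF B.is_vec cm])
  have lC: "lin C W h" if "lin B W (\<lambda>b. h (\<phi> b))" for W :: "('a, 'w::ab_group_add, 'm) vec_scheme" and h
    using that unfolding lin_def im by (auto simp del: linD[OF l] simp flip: linD(2,3)[OF l])
  have bm: "bilin C C C (mult C)"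
  proof (rule bilinI)
    fix x y assume xy: "x \<in> car C" "y \<in> car C"
    obtain p q where p: "p \<in> car B" "q \<in> car B" "x = \<phi> p" "y = \<phi> q" using xy im by blast
    show "mult C x y \<in> car C" using p by simp
    fix c
    show "mult C (smul C c x) y = smul C c (mult C x y)" "mult C x (smul C c y) = smul C c (mult C x y)"
      using p by (simp_all flip: linD(3)[OF l])
    fix z assume z: "z \<in> car C"
    obtain r where r: "r \<in> car B" "z = \<phi> r" using z im by blast
    show "mult C (x + z) y = mult C x y + mult C z y" "mult C x (y + z) = mult C x y + mult C x z"
      using p r by (simp_all flip: linD(2)[OF l])
  qed
  have alg: "is_algebra C"
    unfolding is_algebra_def im by (auto simp: C bm B.mult_assoc)
  have cmC: "lin C (tensor C C) (comult C)" by (rule lC[OF cml])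
  have cuC: "lin C ground (counit C)"
    by (rule lC) (use B.lin_counit in \<open>simp only: lin_cong[OF B.is_vec cu]\<close>)
  interpret C: comult_space C by unfold_locales (rule C cmC)+
  note ie = iso_ext_comult[OF B.is_vec B.lin_comult C \<phi>]
  have bl: "bilin B B W (\<lambda>p q. F (\<phi> p) (\<phi> q))" if "bilin C C W F"
    for W :: "('a, 'w::ab_group_add, 'm) vec_scheme" and F
    by (rule bilinI) (simp_all add: bilinD[OF that])
  have sw: "ext C C F (comult C (\<phi> b)) = (\<Sum>(p, q)\<leftarrow>sweedler B b. F (\<phi> p) (\<phi> q))"
    if "is_vec W" "bilin C C W F" "b \<in> car B" for W :: "('a, 'w::ab_group_add, 'm) vec_scheme" and F b
    using ie[OF that] B.ext_comult[OF that(3,1) bl[OF that(2)]] by simp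
  have tp: "trilin B B B (tensor C (tensor C C)) (\<lambda>p q r. pure C (tensor C C) (\<phi> p) (pure C C (\<phi> q) (\<phi> r)))"
    by (rule trilinI) (simp_all add: pure_closed bilinD[OF C.bilin_pure'] bilinD[OF bilin_pure])
  have coassoc: "ext C C (\<lambda>p q. ext C C (\<lambda>r s. pure C (tensor C C) r (pure C C s q)) (comult C p)) (comult C (\<phi> b)) =
        ext C C (\<lambda>p q. ext C C (\<lambda>r s. pure C (tensor C C) p (pure C C r s)) (comult C q)) (comult C (\<phi> b))"
    if b: "b \<in> car B" for b
    using B.sweedler_coassoc[OF b _ tp]
    by (simp add: sw[OF _ C.bilin_coassoc(1) b] sw[OF _ C.bilin_coassoc(2) b]
        sw[OF _ trilinD(1)[OF C.trilin_pure_pure]] sw[OF _ trilinD(3)[OF C.trilin_pure_pure]]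
       cong: B.sweedler_cong[OF b])
  have bc: "bilin C C C (\<lambda>p q. smul C (counit C p) q)" "bilin C C C (\<lambda>p q. smul C (counit C q) p)"
    by (rule bilinI; simp add: linD[OF cuC] mult.commute; simp add: ground_def mult.commute)+
  have counit: "ext C C (\<lambda>p q. smul C (counit C p) q) (comult C (\<phi> b)) = \<phi> b"
    "ext C C (\<lambda>p q. smul C (counit C q) p) (comult C (\<phi> b)) = \<phi> b" if b: "b \<in> car B" for b
  proof -
    have "(\<Sum>(p, q)\<leftarrow>sweedler B b. smul C (counit B p) (\<phi> q)) = \<phi> (\<Sum>(p, q)\<leftarrow>sweedler B b. smul B (counit B p) q)"
      "(\<Sum>(p, q)\<leftarrow>sweedler B b. smul C (counit B q) (\<phi> p)) = \<phi> (\<Sum>(p, q)\<leftarrow>sweedler B b. smul B (counit B q) p)"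
      by (simp_all add: B.sweedler_lin[OF b B.is_vec l] cong: B.sweedler_cong[OF b])
    then show "ext C C (\<lambda>p q. smul C (counit C p) q) (comult C (\<phi> b)) = \<phi> b"
      "ext C C (\<lambda>p q. smul C (counit C q) p) (comult C (\<phi> b)) = \<phi> b"
      by (simp_all add: sw[OF _ bc(1) b] sw[OF _ bc(2) b] B.sweedler_counit b cong: B.sweedler_cong[OF b])
  qed
  have coalg: "is_coalgebra C"
    unfolding is_coalgebra_def
    by (intro conjI ballI; (rule C cmC cuC)?; erule sur[rotated]; rule coassoc counit; assumption)
  have cmm: "comult C (mult C (\<phi> a) (\<phi> b)) = tensor_mult C (comult C (\<phi> a)) (comult C (\<phi> b))"
    if a: "a \<in> car B" and b: "b \<in> car B" for a b
  proof -
    have s: "comult C (\<phi> a) = (\<Sum>(p, q)\<leftarrow>map (map_prod \<phi> \<phi>) (sweedler B a). pure C C p q)"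
      "set (map (map_prod \<phi> \<phi>) (sweedler B a)) \<subseteq> car C \<times> car C" if a: "a \<in> car B" for a
      using B.ext_comult[OF a is_vec_tensor bp] B.sweedler_in[OF _ a]
      by (auto simp: cm a comp_def case_prod_unfold)
    have "tensor_mult C (comult C (\<phi> a)) (comult C (\<phi> b)) =
      (\<Sum>(p, q)\<leftarrow>sweedler B a. \<Sum>(p', q')\<leftarrow>sweedler B b. pure C C (mult C (\<phi> p) (\<phi> p')) (mult C (\<phi> q) (\<phi> q')))"
      unfolding s(1)[OF a] s(1)[OF b] tensor_mult_sum[OF C bm s(2)[OF a] s(2)[OF b]]
      by (simp add: comp_def case_prod_unfold)
    also have "\<dots> = (\<Sum>(p, q)\<leftarrow>sweedler B a. \<Sum>(p', q')\<leftarrow>sweedler B b. pure C C (\<phi> (mult B p p')) (\<phi> (mult B q q')))"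
      using a b by (simp cong: B.sweedler_cong)
    also have "\<dots> = ext B B (\<lambda>p q. pure C C (\<phi> p) (\<phi> q)) (comult B (mult B a b))"
      unfolding B.comult_mult_sum[OF a b] using a b
      by (simp add: B.sweedler_lin[OF _ _ lin_ext[OF B.is_vec B.is_vec is_vec_tensor bp]]
         B.sweedler_closed ext_pure[OF is_vec_tensor bp] cong: B.sweedler_cong)
    also have "\<dots> = comult C (mult C (\<phi> a) (\<phi> b))" using a b by (simp add: cm)
    finally show ?thesis by simp
  qed
  have bialg: "is_bialgebra C"
    unfolding is_bialgebra_def im
    using cmm B.ext_comult
    by (auto simp: alg coalg B.comult_unity cm ext_pure[OF is_vec_tensor bp])
  obtain S where S: "is_antipode B S" using B by (auto simp: is_hopf_def)
  have lS: "lin B B S" using S by (simp add: is_antipode_def)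
  note [simp] = linD[OF lS]
  have "is_antipode C (\<lambda>c. \<phi> (S (?\<psi> c)))" (is "is_antipode C ?S")
  proof -
    have lS': "lin C C ?S"
      using lin_compose[OF lS l] by (intro lC) (simp add: lin_cong[OF B.is_vec, of "\<lambda>b. \<phi> (S (?\<psi> (\<phi> b)))" "\<lambda>b. \<phi> (S b)"] inv)
    have b: "bilin C C C (\<lambda>p q. mult C (?S p) q)" "bilin C C C (\<lambda>p q. mult C p (?S q))"
      by (rule bilinI; simp add: linD[OF lS'] bilinD[OF bm])+
    have "ext C C (\<lambda>p q. mult C (?S p) q) (comult C (\<phi> b)) = smul C (counit C (\<phi> b)) (unity C)"
      "ext C C (\<lambda>p q. mult C p (?S q)) (comult C (\<phi> b)) = smul C (counit C (\<phi> b)) (unity C)"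
      if b': "b \<in> car B" for b
    proof -
      have "(\<Sum>(p, q)\<leftarrow>sweedler B b. mult C (?S (\<phi> p)) (\<phi> q)) = \<phi> (\<Sum>(p, q)\<leftarrow>sweedler B b. mult B (S p) q)"
        "(\<Sum>(p, q)\<leftarrow>sweedler B b. mult C (\<phi> p) (?S (\<phi> q))) = \<phi> (\<Sum>(p, q)\<leftarrow>sweedler B b. mult B p (S q))"
        by (simp_all add: B.sweedler_lin[OF b' B.is_vec l] inv cong: B.sweedler_cong[OF b'])
      then show "ext C C (\<lambda>p q. mult C (?S p) q) (comult C (\<phi> b)) = smul C (counit C (\<phi> b)) (unity C)"
        "ext C C (\<lambda>p q. mult C p (?S q)) (comult C (\<phi> b)) = smul C (counit C (\<phi> b)) (unity C)"
        by (simp_all only: sw[OF C b(1) b'] sw[OF C b(2) b'] B.antipode_sum[OF S b'] linD(3)[OF l B.unity_simps(1)] cu[OF b'] u)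
    qed
    then show ?thesis
      unfolding is_antipode_def im using lS' by (auto simp del: u cu)
  qed
  then show ?thesis using bialg by (auto simp: is_hopf_def)
qed

section \<open>The coalgebra on coordinates\<close>

lemma put_simps [simp]:
  fixes p q :: "'a::ab_group_add"
  shows "put (0::'a) b = 0" "put (p + q) b = put p b + put q b"
  "put (- p) b = - put p b" "put (p - q) b = put p b - put q b"
  by (auto simp: put_def fun_eq_iff)

lemma put_apply: "put p b c = (if c = b then p else 0)"
  by (simp add: put_def)

lemma eq_coordsI: "u B1 = v B1 \<Longrightarrow> u Bg = v Bg \<Longrightarrow> u Bx = v Bx \<Longrightarrow> u Bgx = v Bgx \<Longrightarrow> u = v"
  by (rule HOL.ext, rename_tac b, case_tac b) simp_all

lemma expand_put:
  "u = put (u B1) B1 + put (u Bg) Bg + put (u Bx) Bx + put (u Bgx :: 'a::ab_group_add) Bgx"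
proof
  fix b show "u b = (put (u B1) B1 + put (u Bg) Bg + put (u Bx) Bx + put (u Bgx) Bgx) b"
    by (cases b) (simp_all add: put_apply)
qed

text \<open>
  The coproduct of a basis vector of \<open>H\<^sub>4\<close> is a sum of tensors of basis vectors in which all
  coefficients are \<open>1\<close>, so it can be recorded as a list of pairs.
\<close>

fun h4_comult :: "h4b \<Rightarrow> (h4b \<times> h4b) list" where
  "h4_comult B1 = [(B1, B1)]"
| "h4_comult Bg = [(Bg, Bg)]"
| "h4_comult Bx = [(Bx, B1), (Bg, Bx)]"
| "h4_comult Bgx = [(Bgx, Bg), (B1, Bgx)]"

text \<open>
  The coalgebra \<open>A \<otimes> H\<^sub>4\<close> on coordinate functions, with an arbitrary product: it underlies both
  \<open>A\<^sub>(\<^sub>a\<^sub>)\<close> and the crossed products.  The coproduct and the counit of \<open>Aa A a\<close> are the same for all \<open>a\<close>, and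
  \<open>0\<close> is just a representative.
\<close>

locale h4_coords = hopf A for A :: "('k::field, 'a::ab_group_add) bialg" +
  fixes X :: "('k, h4b \<Rightarrow> 'a) bialg"
  assumes X: "car X = car (Aa_vec A)" "smul X = smul (Aa_vec A)" "unity X = put (unity A) B1"
    "comult X = comult (Aa A 0)" "counit X = counit (Aa A 0)"
begin

lemmas unity_X = X(3)

lemma car_X: "u \<in> car X \<longleftrightarrow> (\<forall>b. u b \<in> car A)"
  by (simp add: X Aa_vec_def)

lemma smul_X: "smul X c u = (\<lambda>b. smul A c (u b))"
  by (simp add: X Aa_vec_def)

lemma is_vec_X: "is_vec X"
proof -
  interpret vector_space "smul X"
    by unfold_locales (auto simp: fun_eq_iff smul_X)
  have "subspace (car X)" by (auto simp: subspace_def car_X smul_X)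
  then show ?thesis
    unfolding is_vec_def using vector_space_axioms by simp
qed

lemma put_closed [simp]: "p \<in> car A \<Longrightarrow> put p b \<in> car X"
  by (simp add: car_X put_apply)

lemma put_smul [simp]: "put (smul A c p) b = smul X c (put p b)"
  by (auto simp: smul_X put_apply)

lemma lin_put: "lin A X (\<lambda>p. put p b)"
  by (rule linI) simp_all

lemma coord_closed [simp]: "u \<in> car X \<Longrightarrow> u b \<in> car A"
  by (simp add: car_X)

lemma lin_coord: "lin X A (\<lambda>u. u b)"
  by (rule linI) (simp_all add: smul_X)

lemma lin_eq_putI:
  assumes "lin X W F" "lin X W G" "\<And>p b. p \<in> car A \<Longrightarrow> F (put p b) = G (put p b)" "u \<in> car X"
  shows "F u = G u"
proof -
  note [simp] = vec_closed[OF is_vec_X]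
  show ?thesis
    by (subst (1 2) expand_put) (simp add: linD(2)[OF assms(1)] linD(2)[OF assms(2)] assms(3,4))
qed

lemma bilin_eq_putI:
  assumes "bilin X X W F" "bilin X X W G"
    and "\<And>p q b c. p \<in> car A \<Longrightarrow> q \<in> car A \<Longrightarrow> F (put p b) (put q c) = G (put p b) (put q c)"
    and "u \<in> car X" "v \<in> car X"
  shows "F u v = G u v"
proof -
  have "F (put p b) v = G (put p b) v" if p: "p \<in> car A" for p b
    by (rule lin_eq_putI[where F = "F (put p b)" and G = "G (put p b)",
          OF bilin_lin(1)[OF assms(1)] bilin_lin(1)[OF assms(2)] assms(3)[OF p] assms(5)])
      (simp_all add: p)
  then show ?thesis
    by (rule lin_eq_putI[where F = "\<lambda>u. F u v" and G = "\<lambda>u. G u v", OF bilin_lin(2)[OF assms(1,5)] bilin_lin(2)[OF assms(2,5)] _ assms(4)])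
qed

lemma bilin_put: "bilin X X W F \<Longrightarrow> bilin A A W (\<lambda>p q. F (put p b) (put q c))"
  by (rule bilinI) (simp_all add: bilinD)

lemma pure_X: "pure (Aa_vec A) (Aa_vec A) = pure X X"
  by (rule pure_vec_cong) (simp_all add: X)

lemma bilin_pure_put: "bilin A A (tensor X X) (\<lambda>p q. pure X X (put p b) (put q c))"
  by (rule bilin_put[OF bilin_pure[OF is_vec_X is_vec_X]])

lemma comult_X: "comult X u =
    ext A A (\<lambda>p q. pure X X (put p B1) (put q B1)) (comult A (u B1)) +
    ext A A (\<lambda>p q. pure X X (put p Bg) (put q Bg)) (comult A (u Bg)) +
    ext A A (\<lambda>p q. pure X X (put p Bx) (put q B1) + pure X X (put p Bg) (put q Bx)) (comult A (u Bx)) +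
    ext A A (\<lambda>p q. pure X X (put p Bgx) (put q Bg) + pure X X (put p B1) (put q Bgx)) (comult A (u Bgx))"
  unfolding X(4) by (simp add: Aa_def Let_def pure_X)

lemmas bilin_put_intros = bilin_add bilin_pure_put is_vec_tensor

sublocale X: comult_space X
proof
  show "is_vec X" by (rule is_vec_X)
  show "lin X (tensor X X) (comult X)"
    unfolding comult_X[abs_def]
    by (intro lin_add is_vec_tensor lin_compose[OF lin_compose[OF lin_coord lin_comult] lin_ext]
        is_vec bilin_put_intros)
qed

lemma comult_put_ext:
  assumes p: "p \<in> car A"
  shows "comult X (put p b) =
    ext A A (\<lambda>p q. \<Sum>(c, d)\<leftarrow>h4_comult b. pure X X (put p c) (put q d)) (comult A p)"
proof -
  have z: "ext A A B (comult A 0) = 0" if "bilin A A (tensor X X) B" for B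
    using lin_0[OF is_vec lin_compose[OF lin_comult lin_ext[OF is_vec is_vec is_vec_tensor that]]] .
  note [simp] = z[OF bilin_pure_put] z[OF bilin_add[OF is_vec_tensor bilin_pure_put bilin_pure_put]]
  show ?thesis
    unfolding comult_X by (cases b) (simp_all add: put_apply)
qed

lemma bilin_comult_put:
  "bilin A A (tensor X X) (\<lambda>p q. \<Sum>(c, d)\<leftarrow>h4_comult b. pure X X (put p c) (put q d))"
  by (cases b) (simp_all add: bilin_put_intros)

lemma comult_put:
  assumes p: "p \<in> car A"
  shows "comult X (put p b) =
    (\<Sum>(p1, p2)\<leftarrow>sweedler A p. \<Sum>(c, d)\<leftarrow>h4_comult b. pure X X (put p1 c) (put p2 d))"
  unfolding comult_put_ext[OF p] by (rule ext_comult[OF p is_vec_tensor bilin_comult_put])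

abbreviation comult_list where
  "comult_list p b \<equiv> concat (map (\<lambda>(p1, p2). map (\<lambda>(c, d). (put p1 c, put p2 d)) (h4_comult b)) (sweedler A p))"

lemma comult_list:
  assumes p: "p \<in> car A"
  shows "set (comult_list p b) \<subseteq> car X \<times> car X"
    "comult X (put p b) = (\<Sum>(u, v)\<leftarrow>comult_list p b. pure X X u v)"
  unfolding comult_put[OF p] sum_list_concat_pairs
  using sweedler_in[OF _ p] by (auto simp: case_prod_unfold)

lemma sum_comult_list:
  fixes F :: "(h4b \<Rightarrow> 'a) \<Rightarrow> (h4b \<Rightarrow> 'a) \<Rightarrow> 'z::comm_monoid_add"
  shows "(\<Sum>(u, v)\<leftarrow>comult_list p b. F u v) =
    (\<Sum>(p1, p2)\<leftarrow>sweedler A p. \<Sum>(c, d)\<leftarrow>h4_comult b. F (put p1 c) (put p2 d))"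
  unfolding sum_list_concat_pairs by (simp add: case_prod_unfold)

lemma ext_comult_put:
  assumes p: "p \<in> car A" and W: "is_vec W" and F: "bilin X X W F"
  shows "ext X X F (comult X (put p b)) =
    (\<Sum>(p1, p2)\<leftarrow>sweedler A p. \<Sum>(c, d)\<leftarrow>h4_comult b. F (put p1 c) (put p2 d))"
  unfolding comult_list(2)[OF p] ext_sum[OF W F comult_list(1)[OF p]] by (rule sum_comult_list)

lemma counit_X: "counit X u = counit A (u B1) + counit A (u Bg)"
  by (simp add: X Aa_def)

text \<open>
  For \<open>p \<cdot> b\<close> with a basis vector \<open>b\<close> both sides are sums over the iterated coproduct of \<open>b\<close>, which is
  the same list of triples on both sides; for each triple the identity is coassociativity of \<open>A\<close>.
\<close>

lemma coassoc_X:
  assumes u: "u \<in> car X"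
  shows "ext X X (\<lambda>p q. ext X X (\<lambda>r s. pure X (tensor X X) r (pure X X s q)) (comult X p)) (comult X u) =
    ext X X (\<lambda>p q. ext X X (\<lambda>r s. pure X (tensor X X) p (pure X X r s)) (comult X q)) (comult X u)"
proof -
  let ?L = "\<lambda>u. ext X X (\<lambda>p q. ext X X (\<lambda>r s. pure X (tensor X X) r (pure X X s q)) (comult X p)) (comult X u)"
  let ?R = "\<lambda>u. ext X X (\<lambda>p q. ext X X (\<lambda>r s. pure X (tensor X X) p (pure X X r s)) (comult X q)) (comult X u)"
  have "?L u = ?R u"
  proof (rule lin_eq_putI[where F = ?L and G = ?R, OF _ _ _ u])
  show "lin X (tensor X (tensor X X)) ?L" "lin X (tensor X (tensor X X)) ?R"
    by (intro lin_compose[OF X.lin_comult lin_ext] X.bilin_coassoc is_vec_X is_vec_tensor)+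
  fix p b assume p: "p \<in> car A"
  let ?T = "\<lambda>b c d p q r. pure X (tensor X X) (put p b) (pure X X (put q c) (put r d))"
  have T: "trilin A A A (tensor X (tensor X X)) (?T b c d)" for b c d
    by (rule trilinI) (simp_all add: pure_closed bilinD[OF X.bilin_pure'] bilinD[OF bilin_pure])
  note co = sweedler_coassoc[OF p is_vec_tensor T]
  show "ext X X (\<lambda>p q. ext X X (\<lambda>r s. pure X (tensor X X) r (pure X X s q)) (comult X p)) (comult X (put p b)) =
    ext X X (\<lambda>p q. ext X X (\<lambda>r s. pure X (tensor X X) p (pure X X r s)) (comult X q)) (comult X (put p b))"
    apply (simp add: ext_comult_put[OF p is_vec_tensor X.bilin_coassoc(1)] ext_comult_put[OF p is_vec_tensor X.bilin_coassoc(2)]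
      ext_comult_put[OF _ is_vec_tensor trilinD(1)[OF X.trilin_pure_pure]] ext_comult_put[OF _ is_vec_tensor trilinD(3)[OF X.trilin_pure_pure]]
      cong: sweedler_cong[OF p])
    using co by (cases b) (simp_all add: case_prod_unfold sum_list_addf add_ac)
  qed
  then show ?thesis .
qed

lemma counit_comult_X:
  assumes u: "u \<in> car X"
  shows "ext X X (\<lambda>p q. smul X (counit X p) q) (comult X u) = u"
    "ext X X (\<lambda>p q. smul X (counit X q) p) (comult X u) = u"
proof -
  let ?L = "\<lambda>u. ext X X (\<lambda>p q. smul X (counit X p) q) (comult X u)"
  let ?R = "\<lambda>u. ext X X (\<lambda>p q. smul X (counit X q) p) (comult X u)"
  have b: "bilin X X X (\<lambda>p q. smul X (counit X p) q)"
    by (rule bilinI) (simp_all add: counit_X smul_X car_X fun_eq_iff algebra_simps)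
  have b': "bilin X X X (\<lambda>p q. smul X (counit X q) p)"
    by (rule bilinI) (simp_all add: counit_X smul_X car_X fun_eq_iff algebra_simps)
  note b = b b'
  have l: "lin X X ?L" "lin X X ?R"
    by (intro lin_compose[OF X.lin_comult lin_ext] is_vec_X b)+
  have id: "lin X X (\<lambda>u. u)" by (simp add: lin_def)
  have *: "?L (put p b) = put p b \<and> ?R (put p b) = put p b" if p: "p \<in> car A" for p b
  proof -
    have "(\<Sum>(p, q)\<leftarrow>sweedler A p. put (smul A (counit A p) q) c) = put p c"
      "(\<Sum>(p, q)\<leftarrow>sweedler A p. put (smul A (counit A q) p) c) = put p c" for c
      by (simp_all add: sweedler_lin[OF p is_vec lin_put, symmetric] sweedler_counit[OF p] del: put_smul)
    then show ?thesis
      unfolding ext_comult_put[OF p is_vec_X b(1)] ext_comult_put[OF p is_vec_X b(2)]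
      by (cases b) (simp_all add: counit_X put_apply)
  qed
  show "?L u = u" by (rule lin_eq_putI[where F = ?L, OF l(1) id _ u]) (simp add: *)
  show "?R u = u" by (rule lin_eq_putI[where F = ?R, OF l(2) id _ u]) (simp add: *)
qed

lemma is_coalgebra_X: "is_coalgebra X"
proof -
  have "lin X ground (counit X)"
    by (rule linI) (simp_all add: counit_X[abs_def] ground_def smul_X distrib_left)
  then show ?thesis
    unfolding is_coalgebra_def using is_vec_X X.lin_comult coassoc_X counit_comult_X by simp
qed

end

section \<open>The Hopf algebra of a central primitive element\<close>

fun h4_mult :: "h4b \<Rightarrow> h4b \<Rightarrow> h4b" where
  "h4_mult B1 c = c"
| "h4_mult Bg c = (case c of B1 \<Rightarrow> Bg | Bg \<Rightarrow> B1 | Bx \<Rightarrow> Bgx | Bgx \<Rightarrow> Bx)"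
| "h4_mult Bx c = (case c of B1 \<Rightarrow> Bx | Bg \<Rightarrow> Bgx | Bx \<Rightarrow> B1 | Bgx \<Rightarrow> Bg)"
| "h4_mult Bgx c = (case c of B1 \<Rightarrow> Bgx | Bg \<Rightarrow> Bx | Bx \<Rightarrow> Bg | Bgx \<Rightarrow> B1)"

text \<open>
  In \<open>A\<^sub>(\<^sub>a\<^sub>)\<close> the product of the basis vectors \<open>b\<close> and \<open>c\<close> is \<open>coef A a b c\<close> times the basis vector
  \<open>h4_mult b c\<close>.  The latter is the multiplication of the Klein four-group, on which the former is a
  2-cocycle with central values.
\<close>

definition coef where
  "coef A a b c = (if b = B1 \<or> b = Bg then unity A else
     (case c of B1 \<Rightarrow> unity A | Bg \<Rightarrow> - unity A | Bx \<Rightarrow> a | Bgx \<Rightarrow> - a))"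

text \<open>
  An expansion of the coproduct of \<open>coef A a b c\<close> when \<open>a\<close> is primitive.
\<close>

definition coef_comult where
  "coef_comult A a b c = (if b = B1 \<or> b = Bg then [(unity A, unity A)] else
     (case c of B1 \<Rightarrow> [(unity A, unity A)] | Bg \<Rightarrow> [(- unity A, unity A)]
       | Bx \<Rightarrow> [(a, unity A), (unity A, a)] | Bgx \<Rightarrow> [(- a, unity A), (- unity A, a)]))"

locale hopf_ZP = hopf A for A :: "('k::field, 'a::ab_group_add) bialg" +
  fixes a :: 'a
  assumes ZP: "a \<in> ZP A"
begin

lemma a_in [simp]: "a \<in> car A" and comult_a: "comult A a = pure A A a (unity A) + pure A A (unity A) a"
  and central: "p \<in> car A \<Longrightarrow> mult A a p = mult A p a"
  using ZP by (auto simp: ZP_def primitives_def center_def)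

text \<open>
  Applying \<open>\<epsilon> \<otimes> id\<close> to \<open>\<Delta>(a) = a \<otimes> 1 + 1 \<otimes> a\<close> gives \<open>a = \<epsilon>(a) 1 + a\<close>.
\<close>

lemma counit_a [simp]: "counit A a = 0"
proof -
  have "ext A A (\<lambda>p q. smul A (counit A p) q) (comult A a) = a"
    using coalgebra by (simp add: is_coalgebra_def)
  then have "smul A (counit A a) (unity A) + a = a"
    unfolding comult_a
    by (simp add: linD(2)[OF lin_ext[OF is_vec is_vec is_vec bilin_counit(1)]] ext_pure[OF is_vec bilin_counit(1)])
  then have "counit A (smul A (counit A a) (unity A)) = 0" by simp
  then show ?thesis by (simp del: add_cancel_right_left)
qed

sublocale h4_coords A "Aa A a"
  by unfold_locales (simp_all add: Aa_def)

abbreviation "X \<equiv> Aa A a"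

lemma coef_in [simp]: "coef A a b c \<in> car A"
  by (cases c) (simp_all add: coef_def)

lemma mult_X:
  "mult X u v B1 = mult A (u B1) (v B1) + mult A (u Bg) (v Bg) + mult A (mult A (u Bx) (v Bx)) a - mult A (mult A (u Bgx) (v Bgx)) a"
  "mult X u v Bg = mult A (u B1) (v Bg) + mult A (u Bg) (v B1) - mult A (mult A (u Bx) (v Bgx)) a + mult A (mult A (u Bgx) (v Bx)) a"
  "mult X u v Bx = mult A (u B1) (v Bx) + mult A (u Bg) (v Bgx) + mult A (u Bx) (v B1) - mult A (u Bgx) (v Bg)"
  "mult X u v Bgx = mult A (u B1) (v Bgx) + mult A (u Bg) (v Bx) - mult A (u Bx) (v Bg) + mult A (u Bgx) (v B1)"
  by (simp_all add: Aa_def Let_def)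

lemma mult_put:
  assumes "p \<in> car A" "q \<in> car A"
  shows "mult X (put p b) (put q c) = put (mult A (mult A p q) (coef A a b c)) (h4_mult b c)"
  using assms
  by (intro eq_coordsI; cases b; cases c; simp add: mult_X put_apply coef_def)

lemma bilin_mult_X: "bilin X X X (mult X)"
proof (rule bilinI)
  fix u v w :: "h4b \<Rightarrow> 'a" and c
  assume u: "u \<in> car X" and v: "v \<in> car X"
  note [simp] = coord_closed[OF u] coord_closed[OF v]
  show "mult X u v \<in> car X"
    unfolding car_X
  proof
    fix b show "mult X u v b \<in> car A" by (cases b) (simp_all add: mult_X)
  qed
  show "mult X (smul X c u) v = smul X c (mult X u v)" "mult X u (smul X c v) = smul X c (mult X u v)"
    by (intro eq_coordsI; simp add: mult_X smul_X)+
next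
  fix u v w :: "h4b \<Rightarrow> 'a"
  assume u: "u \<in> car X" and v: "v \<in> car X" and w: "w \<in> car X"
  note [simp] = coord_closed[OF u] coord_closed[OF v] coord_closed[OF w]
  show "mult X u (v + w) = mult X u v + mult X u w"
    by (intro eq_coordsI; simp add: mult_X add_ac)
  show "mult X (u + v) w = mult X u w + mult X v w"
    by (intro eq_coordsI; simp add: mult_X add_ac)
qed

lemmas bilin_mult_X_lin = bilin_lin[OF bilin_mult_X]

text \<open>
  By trilinearity it is enough to treat \<open>p \<cdot> b\<close>, \<open>q \<cdot> c\<close>, \<open>r \<cdot> d\<close>, where associativity is the cocycle identity
  \<open>coef b c * coef (bc) d = coef c d * coef b (cd)\<close> and the fact that \<open>a\<close> can be moved past \<open>r\<close>.
\<close>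

lemma mult_X_assoc:
  assumes u: "u \<in> car X" and v: "v \<in> car X" and w: "w \<in> car X"
  shows "mult X (mult X u v) w = mult X u (mult X v w)"
proof -
  note m = bilinD(1)[OF bilin_mult_X] and l = bilin_mult_X_lin
  have 1: "mult X (mult X (put p b) (put q c)) (put r d) = mult X (put p b) (mult X (put q c) (put r d))"
    if pqr: "p \<in> car A" "q \<in> car A" "r \<in> car A" for p q r b c d
  proof -
    have "mult A (mult A (mult A (mult A p q) (coef A a b c)) r) (coef A a (h4_mult b c) d) =
      mult A (mult A p (mult A (mult A q r) (coef A a c d))) (coef A a b (h4_mult c d))"
      using pqr by (cases b; cases c; cases d; simp add: coef_def mult_assoc central[of r] central[of "mult A q r"])
    moreover have "h4_mult (h4_mult b c) d = h4_mult b (h4_mult c d)"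
      by (cases b; cases c; cases d; simp)
    ultimately show ?thesis using pqr by (simp add: mult_put)
  qed
  have 2: "mult X (mult X (put p b) (put q c)) w = mult X (put p b) (mult X (put q c) w)"
    if pq: "p \<in> car A" "q \<in> car A" for p q b c
    by (rule lin_eq_putI[of X "\<lambda>w. mult X (mult X (put p b) (put q c)) w" "\<lambda>w. mult X (put p b) (mult X (put q c) w)", OF l(1) lin_compose[OF l(1,1)] 1 w])
      (use pq m in simp_all)
  have 3: "mult X (mult X (put p b) v) w = mult X (put p b) (mult X v w)"
    if p: "p \<in> car A" for p b
    by (rule lin_eq_putI[of X "\<lambda>v. mult X (mult X (put p b) v) w" "\<lambda>v. mult X (put p b) (mult X v w)", OF lin_compose[OF l(1,2)] lin_compose[OF l(2,1)] 2 v])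
      (use p w in simp_all)
  show ?thesis
    by (rule lin_eq_putI[of X "\<lambda>u. mult X (mult X u v) w" "\<lambda>u. mult X u (mult X v w)", OF lin_compose[OF l(2,2)] l(2) 3 u])
      (use v w m in simp_all)
qed

lemma is_algebra_X: "is_algebra X"
proof -
  have "mult X (unity X) u = u \<and> mult X u (unity X) = u" if u: "u \<in> car X" for u
  proof -
    have "mult X (unity X) u b = u b \<and> mult X u (unity X) b = u b" for b
      using u by (cases b) (simp_all add: mult_X put_apply unity_X)
    then show ?thesis by (simp add: fun_eq_iff)
  qed
  then show ?thesis
    unfolding is_algebra_def by (simp add: bilin_mult_X mult_X_assoc is_vec_X unity_X)
qed

lemma comult_coef:
  "set (coef_comult A a b c) \<subseteq> car A \<times> car A"
  "comult A (coef A a b c) = (\<Sum>(k1, k2)\<leftarrow>coef_comult A a b c. pure A A k1 k2)"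
  by (cases c; simp add: coef_def coef_comult_def comult_unity comult_a lin_minus[OF is_vec is_vec_tensor lin_comult]
      bilin_minus[OF is_vec is_vec is_vec_tensor bilin_pure'])+

text \<open>
  This is \<open>\<Delta>(b) \<Delta>(c) = \<Delta>(bc)\<close> for basis vectors \<open>b\<close>, \<open>c\<close>, multiplied with pure tensors over \<open>A\<close>.  In the
  critical case \<open>b = c = x\<close> the terms \<open>xg \<otimes> x\<close> and \<open>gx \<otimes> x\<close> cancel, and \<open>x\<^sup>2 \<otimes> 1 + g\<^sup>2 \<otimes> x\<^sup>2\<close> is \<open>\<Delta>(a)\<close> because \<open>a\<close>
  is primitive.
\<close>

lemma comult_mult_basis:
  assumes p: "p1 \<in> car A" "p2 \<in> car A" and q: "q1 \<in> car A" "q2 \<in> car A"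
  shows "(\<Sum>(b1, b2)\<leftarrow>h4_comult b. \<Sum>(c1, c2)\<leftarrow>h4_comult c.
       pure X X (mult X (put p1 b1) (put q1 c1)) (mult X (put p2 b2) (put q2 c2))) =
     (\<Sum>(k1, k2)\<leftarrow>coef_comult A a b c. \<Sum>(d1, d2)\<leftarrow>h4_comult (h4_mult b c).
       pure X X (put (mult A (mult A p1 q1) k1) d1) (put (mult A (mult A p2 q2) k2) d2))"
proof -
  note [simp] = bilin_minus[OF is_vec_X is_vec_X is_vec_tensor X.bilin_pure']
  show ?thesis
    using p q by (cases b; cases c; simp add: mult_put coef_def coef_comult_def add_ac)
qed

lemma comult_X_mult:
  assumes u: "u \<in> car X" and v: "v \<in> car X"
  shows "comult X (mult X u v) = tensor_mult X (comult X u) (comult X v)"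
proof -
  note m = bilinD(1)[OF bilin_mult_X]
  note l = bilin_mult_X_lin
  have 1: "comult X (mult X (put p b) (put q c)) = tensor_mult X (comult X (put p b)) (comult X (put q c))"
    if p: "p \<in> car A" and q: "q \<in> car A" for p q b c
  proof -
    let ?G = "\<lambda>d p q. \<Sum>(d1, d2)\<leftarrow>h4_comult d. pure X X (put p d1) (put q d2)"
    let ?d = "h4_mult b c"
    note lG = lin_ext[OF is_vec is_vec is_vec_tensor bilin_comult_put[of ?d]]
    have "comult X (mult X (put p b) (put q c)) =
      ext A A (?G ?d) (\<Sum>(p1, p2)\<leftarrow>sweedler A p. \<Sum>(q1, q2)\<leftarrow>sweedler A q. \<Sum>(k1, k2)\<leftarrow>coef_comult A a b c.
       pure A A (mult A (mult A p1 q1) k1) (mult A (mult A p2 q2) k2))"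
      using p q by (simp add: mult_put comult_put_ext comult_mult_mult[OF _ _ _ comult_coef])
    also have "\<dots> = (\<Sum>(p1, p2)\<leftarrow>sweedler A p. \<Sum>(q1, q2)\<leftarrow>sweedler A q. \<Sum>(k1, k2)\<leftarrow>coef_comult A a b c.
       ?G ?d (mult A (mult A p1 q1) k1) (mult A (mult A p2 q2) k2))"
    proof -
      have s: "(\<Sum>(k1, k2)\<leftarrow>coef_comult A a b c. pure A A (mult A p1 k1) (mult A p2 k2)) \<in> car (tensor A A)"
        "ext A A (?G ?d) (\<Sum>(k1, k2)\<leftarrow>coef_comult A a b c. pure A A (mult A p1 k1) (mult A p2 k2)) =
           (\<Sum>(k1, k2)\<leftarrow>coef_comult A a b c. ?G ?d (mult A p1 k1) (mult A p2 k2))"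
        if "p1 \<in> car A" "p2 \<in> car A" for p1 p2
      proof -
        have i: "(case x of (k1, k2) \<Rightarrow> pure A A (mult A p1 k1) (mult A p2 k2)) \<in> car (tensor A A)"
          if "x \<in> set (coef_comult A a b c)" for x
          using that comult_coef(1)[of b c] \<open>p1 \<in> car A\<close> \<open>p2 \<in> car A\<close> by auto
        then show "(\<Sum>(k1, k2)\<leftarrow>coef_comult A a b c. pure A A (mult A p1 k1) (mult A p2 k2)) \<in> car (tensor A A)"
          by (rule vec_sum_list[OF is_vec_tensor])
        show "ext A A (?G ?d) (\<Sum>(k1, k2)\<leftarrow>coef_comult A a b c. pure A A (mult A p1 k1) (mult A p2 k2)) =
           (\<Sum>(k1, k2)\<leftarrow>coef_comult A a b c. ?G ?d (mult A p1 k1) (mult A p2 k2))"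
          apply (subst lin_sum_list[OF is_vec_tensor lG i], assumption)
          apply (rule arg_cong[where f = sum_list], rule map_cong, rule refl)
          using comult_coef(1)[of b c] that by (auto simp: ext_pure[OF is_vec_tensor bilin_comult_put])
      qed
      show ?thesis
        using p q by (simp add: sweedler_lin[OF _ is_vec_tensor lG] sweedler_closed s cong: sweedler_cong)
    qed
    also have "\<dots> = (\<Sum>(p1, p2)\<leftarrow>sweedler A p. \<Sum>(q1, q2)\<leftarrow>sweedler A q.
      \<Sum>(b1, b2)\<leftarrow>h4_comult b. \<Sum>(c1, c2)\<leftarrow>h4_comult c.
       pure X X (mult X (put p1 b1) (put q1 c1)) (mult X (put p2 b2) (put q2 c2)))"
      using p q by (simp add: comult_mult_basis[symmetric] cong: sweedler_cong)
    also have "\<dots> = (\<Sum>(p1, p2)\<leftarrow>sweedler A p. \<Sum>(b1, b2)\<leftarrow>h4_comult b. \<Sum>(q1, q2)\<leftarrow>sweedler A q.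
       \<Sum>(c1, c2)\<leftarrow>h4_comult c.
       pure X X (mult X (put p1 b1) (put q1 c1)) (mult X (put p2 b2) (put q2 c2)))"
      by (subst sum_list_swap) (rule refl)
    also have "\<dots> = tensor_mult X (comult X (put p b)) (comult X (put q c))"
      unfolding comult_list(2)[OF p] comult_list(2)[OF q]
      unfolding tensor_mult_sum[OF is_vec_X bilin_mult_X comult_list(1)[OF p] comult_list(1)[OF q]]
      unfolding sum_comult_list by (rule refl)
    finally show ?thesis .
  qed
  have bt: "bilin (tensor X X) (tensor X X) (tensor X X) (tensor_mult X)"
    by (rule bilin_tensor_mult[OF is_vec_X bilin_mult_X])
  note lt = bilin_lin[OF bt]
  have 2: "comult X (mult X (put p b) v) = tensor_mult X (comult X (put p b)) (comult X v)"
    if p: "p \<in> car A" for p b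
    by (rule lin_eq_putI[of "tensor X X" "\<lambda>v. comult X (mult X (put p b) v)" "\<lambda>v. tensor_mult X (comult X (put p b)) (comult X v)", OF lin_compose[OF l(1) X.lin_comult] lin_compose[OF X.lin_comult lt(1)] 1 v])
      (use p in simp_all)
  show ?thesis
    by (rule lin_eq_putI[of "tensor X X" "\<lambda>u. comult X (mult X u v)" "\<lambda>u. tensor_mult X (comult X u) (comult X v)", OF lin_compose[OF l(2) X.lin_comult] lin_compose[OF X.lin_comult lt(2)] 2 u])
      (use v in simp_all)
qed

lemma is_bialgebra_X: "is_bialgebra X"
proof -
  have "comult X (unity X) = pure X X (unity X) (unity X)"
    by (simp add: unity_X comult_put_ext comult_unity ext_pure[OF is_vec_tensor bilin_pure_put])
  moreover have "counit X (mult X u v) = counit X u * counit X v" if "u \<in> car X" "v \<in> car X" for u v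
    using that by (simp add: counit_X mult_X algebra_simps diff_conv_add_uminus del: add_uminus_conv_diff)
  moreover have "counit X (unity X) = 1"
    by (simp add: counit_X unity_X put_apply)
  ultimately show ?thesis
    unfolding is_bialgebra_def by (simp add: is_algebra_X is_coalgebra_X comult_X_mult)
qed

text \<open>
  The antipode is an anti-homomorphism with \<open>S(g) = g\<close> and \<open>S(x) = -gx\<close>, hence \<open>S(gx) = S(x) g = x\<close>; it
  exchanges the \<open>x\<close>- and \<open>gx\<close>-coordinates up to sign.
\<close>

definition antipode_X where
  "antipode_X S u = (\<lambda>b. case b of B1 \<Rightarrow> S (u B1) | Bg \<Rightarrow> S (u Bg) | Bx \<Rightarrow> S (u Bgx) | Bgx \<Rightarrow> - S (u Bx))"

lemma antipode_X:
  assumes S: "is_antipode A S"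
  shows "is_antipode X (antipode_X S)"
proof -
  let ?S = "antipode_X S"
  have lS: "lin A A S" using S by (simp add: is_antipode_def)
  note [simp] = linD[OF lS] lin_0[OF is_vec lS] lin_minus[OF is_vec is_vec lS]
  have lS': "lin X X ?S"
  proof (rule linI)
    fix u v c assume u: "u \<in> car X"
    show "?S u \<in> car X" using u by (auto simp: car_X antipode_X_def split: h4b.split)
    show "?S (smul X c u) = smul X c (?S u)" using u by (intro eq_coordsI) (simp_all add: antipode_X_def smul_X)
    assume v: "v \<in> car X"
    show "?S (u + v) = ?S u + ?S v" using u v by (intro eq_coordsI) (simp_all add: antipode_X_def)
  qed
  have S_put: "?S (put p B1) = put (S p) B1" "?S (put p Bg) = put (S p) Bg"
    "?S (put p Bx) = - put (S p) Bgx" "?S (put p Bgx) = put (S p) Bx" if "p \<in> car A" for p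
    by (intro eq_coordsI; simp add: antipode_X_def put_apply)+
  note m = bilinD[OF bilin_mult_X]
  have b: "bilin X X X (\<lambda>p q. mult X (?S p) q)" "bilin X X X (\<lambda>p q. mult X p (?S q))"
    by (rule bilinI; simp add: linD[OF lS'] m)+
  let ?L = "\<lambda>u. ext X X (\<lambda>p q. mult X (?S p) q) (comult X u)"
  let ?R = "\<lambda>u. ext X X (\<lambda>p q. mult X p (?S q)) (comult X u)"
  let ?e = "\<lambda>u. smul X (counit X u) (unity X)"
  have l: "lin X X ?L" "lin X X ?R"
    by (intro lin_compose[OF X.lin_comult lin_ext] is_vec_X b)+
  have le: "lin X X ?e"
    by (rule linI) (simp_all add: counit_X smul_X unity_X car_X put_apply fun_eq_iff distrib_right distrib_left)
  note mi = bilin_minus[OF is_vec_X is_vec_X is_vec_X bilin_mult_X]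
  have put_sum: "(\<Sum>(p1, p2)\<leftarrow>sweedler A p. put (mult A (S p1) p2) c) = put (smul A (counit A p) (unity A)) c"
    "(\<Sum>(p1, p2)\<leftarrow>sweedler A p. put (mult A p1 (S p2)) c) = put (smul A (counit A p) (unity A)) c"
    if p: "p \<in> car A" for p c
    by (simp_all add: sweedler_lin[OF p is_vec lin_put, symmetric] antipode_sum[OF S p] del: put_smul)
  have *: "?L (put p b) = ?e (put p b) \<and> ?R (put p b) = ?e (put p b)" if p: "p \<in> car A" for p b
    unfolding ext_comult_put[OF p is_vec_X b(1)] ext_comult_put[OF p is_vec_X b(2)]
    using p by (cases b) (simp_all add: S_put mi mult_put coef_def put_sum sum_list_zero counit_X unity_X put_apply cong: sweedler_cong)
  have "?L u = ?e u \<and> ?R u = ?e u" if u: "u \<in> car X" for u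
    using lin_eq_putI[where F = ?L and G = ?e, OF l(1) le _ u] lin_eq_putI[where F = ?R and G = ?e, OF l(2) le _ u] *
    by blast
  then show ?thesis unfolding is_antipode_def using lS' by simp
qed

lemma is_hopf_X: "is_hopf X"
  using hopf is_bialgebra_X antipode_X by (auto simp: is_hopf_def)

end

lemma is_basis_cong:
  assumes "\<And>i. i \<in> I \<Longrightarrow> e i = e' i" shows "is_basis V I e = is_basis V I e'"
  unfolding is_basis_def using assms by (simp cong: inj_on_cong image_cong)

lemma (in h4_coords) is_basis_put:
  assumes "is_basis A I e"
  shows "is_basis X (I \<times> UNIV) (\<lambda>(i, b). put (e i) b)"
proof -
  interpret VA: vector_space "smul A" by (rule is_vecD[OF is_vec])
  interpret VX: vector_space "smul X" by (rule is_vecD[OF is_vec_X])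
  let ?f = "\<lambda>(i, b). put (e i) b"
  have inj: "inj_on e I" and ind: "VA.independent (e ` I)" and span: "VA.span (e ` I) = car A"
    using assms by (simp_all add: is_basis_def)
  have ne: "e i \<noteq> 0" if "i \<in> I" for i
    using VA.dependent_zero[of "e ` I"] ind that by force
  have eq: "b = c \<and> e i = e j" if "put (e i) b = put (e j) c" "i \<in> I" for i j b c
    using fun_cong[OF that(1), of b] ne[OF that(2)] by (auto simp: put_apply split: if_splits)
  have "inj_on ?f (I \<times> UNIV)"
    using inj by (auto simp: inj_on_def dest: eq)
  moreover have "VX.independent (?f ` (I \<times> UNIV))"
    unfolding VX.dependent_explicit
  proof safe
    fix T r v
    assume T: "finite T" "T \<subseteq> ?f ` (I \<times> UNIV)" and s: "(\<Sum>v\<in>T. smul X (r v) v) = 0"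
      and v: "v \<in> T" "r v \<noteq> 0"
    obtain i b where ib: "i \<in> I" "v = put (e i) b" using T(2) v(1) by auto
    \<comment> \<open>Of the vectors \<open>e j \<cdot> c\<close> only those with \<open>c = b\<close> contribute to the \<open>b\<close>-coordinate, which is therefore
      a linear relation between the \<open>e j\<close>.\<close>
    let ?T = "{w \<in> T. w b \<noteq> 0}"
    have put: "\<exists>j\<in>I. w = put (e j) b" if "w \<in> ?T" for w
    proof -
      have "w \<in> ?f ` (I \<times> UNIV)" "w b \<noteq> 0" using that T(2) by auto
      then obtain j c where "j \<in> I" "w = put (e j) c" "w b \<noteq> 0" by auto
      then show ?thesis by (cases "c = b") (auto simp: put_apply)
    qed
    have injT: "inj_on (\<lambda>w. w b) ?T"
    proof (rule inj_on_inverseI[where g = "\<lambda>p. put p b"])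
      show "put (w b) b = w" if "w \<in> ?T" for w using put[OF that] by (auto simp: put_apply)
    qed
    have "0 = (\<Sum>v\<in>T. smul X (r v) v) b" by (simp add: s)
    also have "\<dots> = (\<Sum>w\<in>T. smul A (r w) (w b))"
      using T(1) by (induction T rule: finite_induct) (simp_all add: smul_X)
    also have "\<dots> = (\<Sum>w\<in>?T. smul A (r w) (w b))"
      by (rule sum.mono_neutral_right) (use T(1) in auto)
    also have "\<dots> = (\<Sum>p\<in>(\<lambda>w. w b) ` ?T. smul A (r (the_inv_into ?T (\<lambda>w. w b) p)) p)"
      by (simp add: sum.reindex[OF injT] the_inv_into_f_f[OF injT])
    finally have z: "(\<Sum>p\<in>(\<lambda>w. w b) ` ?T. smul A (r (the_inv_into ?T (\<lambda>w. w b) p)) p) = 0" by simp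
    have vT: "v \<in> ?T" using v ib ne by (simp add: put_apply)
    have "r (the_inv_into ?T (\<lambda>w. w b) (v b)) = 0"
      using VA.independentD[OF ind _ _ z, of "v b"] T(1) put vT by (force simp: put_apply)
    then show False using the_inv_into_f_f[OF injT vT] v(2) by simp
  qed
  moreover have "VX.span (?f ` (I \<times> UNIV)) = car X"
  proof
    have "VX.subspace (car X)" using is_vecD(2)[OF is_vec_X] .
    moreover have "?f ` (I \<times> UNIV) \<subseteq> car X" using VA.span_base[of _ "e ` I"] span by auto
    ultimately show "VX.span (?f ` (I \<times> UNIV)) \<subseteq> car X" by (rule VX.span_minimal[rotated])
    show "car X \<subseteq> VX.span (?f ` (I \<times> UNIV))"
    proof
      fix u assume u: "u \<in> car X"
      have p: "put p b \<in> VX.span (?f ` (I \<times> UNIV))" if "p \<in> car A" for p b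
        using that unfolding span[symmetric]
      proof (induction rule: VA.span_induct_alt)
        case base
        show ?case unfolding put_simps by (rule VX.span_zero)
      next
        case (step c x y)
        then have "put x b \<in> ?f ` (I \<times> UNIV)" by force
        moreover have "x \<in> car A" using step(1) span VA.span_base by blast
        ultimately show ?case
          unfolding put_simps put_smul by (intro VX.span_add VX.span_scale step) (rule VX.span_base)
      qed
      show "u \<in> VX.span (?f ` (I \<times> UNIV))"
        by (subst expand_put) (use u in \<open>intro VX.span_add p coord_closed\<close>)
    qed
  qed
  ultimately show ?thesis unfolding is_basis_def by blast
qed

text \<open>
  The statements about antipodes hold for any pair of antipodes because each is unique, so the one of
  \<open>A\<^sub>(\<^sub>a\<^sub>)\<close> is \<open>antipode_X\<close>.
\<close>

lemma (in hopf_ZP) is_presented_X: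
  assumes basis: "is_basis A I e"
  shows "is_presented A I e a X (\<lambda>p. put p B1) (put (unity A) Bg) (put (unity A) Bx)"
proof -
  interpret VA: vector_space "smul A" by (rule is_vecD[OF is_vec])
  interpret X: hopf X by unfold_locales (rule is_hopf_X)
  have e: "e i \<in> car A" if "i \<in> I" for i
    using basis VA.span_base[of "e i" "e ` I"] that by (auto simp: is_basis_def)
  have b: "is_basis X (I \<times> UNIV) (\<lambda>(i, b). case b of B1 \<Rightarrow> put (e i) B1
     | Bg \<Rightarrow> mult X (put (e i) B1) (put (unity A) Bg) | Bx \<Rightarrow> mult X (put (e i) B1) (put (unity A) Bx)
     | Bgx \<Rightarrow> mult X (put (e i) B1) (mult X (put (unity A) Bg) (put (unity A) Bx)))"
    using is_basis_put[OF basis]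
    by (subst is_basis_cong[where e' = "\<lambda>(i, b). put (e i) b"])
      (auto simp: e mult_put coef_def split: h4b.split)
  have S: "SB (put p B1) = put (SA p) B1" "SB (put (unity A) Bg) = put (unity A) Bg"
     "SB (put (unity A) Bx) = - put (unity A) Bgx"
    if SA: "is_antipode A SA" and SB: "is_antipode X SB" and p: "p \<in> car A" for SA SB p
  proof -
    have l: "lin A A SA" using SA by (simp add: is_antipode_def)
    have 0: "SA 0 = 0" by (rule lin_0[OF is_vec l])
    have "smul A 1 (unity A) = ext A A (\<lambda>p q. mult A (SA p) q) (comult A (unity A))"
      using SA by (simp add: is_antipode_def)
    also have "\<dots> = SA (unity A)"
    proof -
      have "bilin A A A (\<lambda>p q. mult A (SA p) q)" by (rule bilinI) (simp_all add: linD[OF l])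
      then show ?thesis by (simp add: comult_unity ext_pure[OF is_vec] linD[OF l])
    qed
    finally have 1: "SA (unity A) = unity A" by simp
    have "SB u = antipode_X SA u" if "u \<in> car X" for u
      by (rule X.antipode_unique[OF SB antipode_X[OF SA] that])
    then show "SB (put p B1) = put (SA p) B1" "SB (put (unity A) Bg) = put (unity A) Bg"
       "SB (put (unity A) Bx) = - put (unity A) Bgx"
      using p by (auto intro!: eq_coordsI simp: antipode_X_def put_apply 0 1)
  qed
  have cA: "comult X (put p B1) = ext A A (\<lambda>p q. pure X X (put p B1) (put q B1)) (comult A p)"
    if "p \<in> car A" for p using that by (simp add: comult_put_ext)
  have cg: "comult X (put (unity A) Bg) = pure X X (put (unity A) Bg) (put (unity A) Bg)"
    by (simp add: comult_put_ext comult_unity ext_pure[OF is_vec_tensor bilin_pure_put])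
  have cx: "comult X (put (unity A) Bx) =
    pure X X (put (unity A) Bx) (unity X) + pure X X (put (unity A) Bg) (put (unity A) Bx)"
    by (simp add: comult_put_ext comult_unity unity_X
       ext_pure[OF is_vec_tensor bilin_add[OF is_vec_tensor bilin_pure_put bilin_pure_put]])
  show ?thesis
    unfolding is_presented_def
    apply (intro conjI ballI allI impI; (elim conjE)?)
    subgoal by (rule is_hopf_X)
    subgoal by (rule lin_put)
    prefer 4
    subgoal by (rule b)
    using S(1) S(2,3)[OF _ _ unity_simps(1)]
    by (auto simp: unity_X mult_put coef_def e cA cg cx counit_X put_apply)
qed

section \<open>Sweedler's Hopf algebra\<close>

lemma car_H4 [simp]: "h \<in> car H4" and smul_H4: "smul H4 c h = (\<lambda>b. c * h b)"
  by (simp_all add: H4_def H4_vec_def)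

lemma is_vec_H4 [simp]: "is_vec (H4 :: ('k::field, h4b \<Rightarrow> 'k) bialg)"
proof -
  interpret vector_space "smul (H4 :: ('k::field, h4b \<Rightarrow> 'k) bialg)"
    by unfold_locales (auto simp: fun_eq_iff smul_H4 algebra_simps)
  have "car (H4 :: ('k::field, h4b \<Rightarrow> 'k) bialg) = UNIV" by auto
  then show ?thesis
    unfolding is_vec_def using vector_space_axioms by simp
qed

lemma unity_H4: "unity H4 = put 1 B1"
  by (simp add: H4_def)

lemma counit_H4: "counit H4 h = h B1 + h Bg"
  by (simp add: H4_def)

lemma mult_H4:
  "mult H4 u v B1 = u B1 * v B1 + u Bg * v Bg"
  "mult H4 u v Bg = u B1 * v Bg + u Bg * v B1"
  "mult H4 u v Bx = u B1 * v Bx + u Bg * v Bgx + u Bx * v B1 - u Bgx * v Bg"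
  "mult H4 u v Bgx = u B1 * v Bgx + u Bg * v Bx - u Bx * v Bg + u Bgx * v B1"
  by (simp_all add: H4_def)

lemma bilin_mult_H4: "bilin H4 H4 H4 (mult H4)"
  by (rule bilinI; (intro eq_coordsI)?; simp add: mult_H4 smul_H4 algebra_simps)

text \<open>
  The analogue of \<open>coef\<close> for \<open>H\<^sub>4\<close>, in which \<open>x\<^sup>2 = 0\<close>.
\<close>

definition h4_coef :: "h4b \<Rightarrow> h4b \<Rightarrow> 'k::field" where
  "h4_coef b c = (if b = B1 \<or> b = Bg then 1 else (case c of B1 \<Rightarrow> 1 | Bg \<Rightarrow> - 1 | Bx \<Rightarrow> 0 | Bgx \<Rightarrow> 0))"

lemma mult_H4_put: "mult H4 (put 1 b) (put 1 c) = put (h4_coef b c) (h4_mult b c)"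
  by (intro eq_coordsI; cases b; cases c; simp add: mult_H4 put_apply h4_coef_def)

lemma pure_H4: "pure H4_vec H4_vec = pure H4 H4"
  by (rule pure_vec_cong) (simp_all add: H4_def)

lemma comult_H4: "comult H4 h =
    tsmul (h B1) (pure H4 H4 (put 1 B1) (put 1 B1)) + tsmul (h Bg) (pure H4 H4 (put 1 Bg) (put 1 Bg)) +
    tsmul (h Bx) (pure H4 H4 (put 1 Bx) (put 1 B1) + pure H4 H4 (put 1 Bg) (put 1 Bx)) +
    tsmul (h Bgx) (pure H4 H4 (put 1 Bgx) (put 1 Bg) + pure H4 H4 (put 1 B1) (put 1 Bgx))"
  unfolding pure_H4[symmetric] by (simp add: H4_def Let_def)

lemma smul_tensor: "smul (tensor U V) = tsmul"
  by (simp add: tensor_def)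

lemma tensor_smul_closed:
  "t \<in> car (tensor U V) \<Longrightarrow> tsmul c t \<in> car (tensor U V)"
  using vec_closed(3)[OF is_vec_tensor] by (simp add: smul_tensor)

lemma lin_comult_H4: "lin H4 (tensor H4 H4) (comult H4)"
proof -
  note [simp] = vec_smul[OF is_vec_tensor, unfolded smul_tensor]
  show ?thesis
    by (rule linI)
      (simp_all add: comult_H4 vec_closed(2) tensor_smul_closed pure_closed smul_H4 smul_tensor add_ac)
qed

lemma ext_comult_H4:
  fixes F :: "(h4b \<Rightarrow> 'k::field) \<Rightarrow> (h4b \<Rightarrow> 'k) \<Rightarrow> 'w::ab_group_add"
  assumes "is_vec W" "bilin H4 H4 W F"
  shows "ext H4 H4 F (comult H4 (put 1 b)) = (\<Sum>(c, d)\<leftarrow>h4_comult b. F (put 1 c) (put 1 d))"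
proof -
  let ?l = "map (\<lambda>(c, d). (put (1::'k) c, put (1::'k) d)) (h4_comult b)"
  have "comult H4 (put 1 b) = (\<Sum>(u, v)\<leftarrow>?l. pure H4 H4 u v)"
    unfolding comult_H4 by (cases b) (simp_all add: put_apply vec_smul[OF is_vec_tensor, unfolded smul_tensor])
  moreover have "ext H4 H4 F (\<Sum>(u, v)\<leftarrow>?l. pure H4 H4 u v) = (\<Sum>(u, v)\<leftarrow>?l. F u v)"
    by (rule ext_sum[OF assms]) auto
  ultimately show ?thesis by (simp add: case_prod_unfold comp_def)
qed

section \<open>Crossed products in coordinates\<close>

text \<open>
  The data of a crossed product, whose multiplication is not yet required to give a Hopf algebra.
\<close>

locale crossed_H4 = hopf A for A :: "('k::field, 'a::ab_group_add) bialg" +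
  fixes act :: "(h4b \<Rightarrow> 'k) \<Rightarrow> 'a \<Rightarrow> 'a" and f :: "(h4b \<Rightarrow> 'k) \<Rightarrow> (h4b \<Rightarrow> 'k) \<Rightarrow> 'a"
  assumes weak: "is_weak_action H4 A act" and bilin_f: "bilin H4 H4 A f"
begin

abbreviation "K \<equiv> crossed A H4 act f"

lemma bilin_act: "bilin H4 A A act"
  using weak by (simp add: is_weak_action_def)

lemmas act_simps [simp] = bilinD[OF bilin_act] bilin_0(2)[OF is_vec_H4 is_vec bilin_act]
lemmas f_simps [simp] = bilinD[OF bilin_f]
lemmas pure_AH [simp] = bilinD[OF bilin_pure[OF is_vec is_vec_H4]]
lemmas mult_H4_simps [simp] = bilinD[OF bilin_mult_H4]

abbreviation "P a h1 c h2 g1 h3 g2 \<equiv>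
  pure A H4 (mult A (mult A a (act h1 c)) (f h2 g1)) (mult H4 h3 g2)"

text \<open>
  The integrand of \<open>crossed_mult\<close> is linear in each of its seven arguments; contracting three
  coproducts one after the other leaves an expression that is linear in \<open>a\<close>, \<open>h\<close>, \<open>c\<close>, \<open>g\<close>.
\<close>

lemma lin_P:
  "c \<in> car A \<Longrightarrow> lin A (tensor A H4) (\<lambda>a. P a h1 c h2 g1 h3 g2)"
  "a \<in> car A \<Longrightarrow> c \<in> car A \<Longrightarrow> lin H4 (tensor A H4) (\<lambda>h1. P a h1 c h2 g1 h3 g2)"
  "a \<in> car A \<Longrightarrow> lin A (tensor A H4) (\<lambda>c. P a h1 c h2 g1 h3 g2)"
  "a \<in> car A \<Longrightarrow> c \<in> car A \<Longrightarrow> lin H4 (tensor A H4) (\<lambda>h2. P a h1 c h2 g1 h3 g2)"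
  "a \<in> car A \<Longrightarrow> c \<in> car A \<Longrightarrow> lin H4 (tensor A H4) (\<lambda>g1. P a h1 c h2 g1 h3 g2)"
  "a \<in> car A \<Longrightarrow> c \<in> car A \<Longrightarrow> lin H4 (tensor A H4) (\<lambda>h3. P a h1 c h2 g1 h3 g2)"
  "a \<in> car A \<Longrightarrow> c \<in> car A \<Longrightarrow> lin H4 (tensor A H4) (\<lambda>g2. P a h1 c h2 g1 h3 g2)"
  by (rule linI; simp)+

lemmas lin_intros = bilin_linI lin_ext_param lin_compose[OF lin_comult_H4 lin_ext] lin_P
   is_vec is_vec_H4 is_vec_tensor linD(1)[OF lin_comult_H4] car_H4

lemma crossed_mult_lin:
  "a \<in> car A \<Longrightarrow> c \<in> car A \<Longrightarrow> lin H4 (tensor A H4) (\<lambda>h. crossed_mult A H4 act f a h c g)"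
  "a \<in> car A \<Longrightarrow> c \<in> car A \<Longrightarrow> lin H4 (tensor A H4) (\<lambda>g. crossed_mult A H4 act f a h c g)"
  "c \<in> car A \<Longrightarrow> lin A (tensor A H4) (\<lambda>a. crossed_mult A H4 act f a h c g)"
  "a \<in> car A \<Longrightarrow> lin A (tensor A H4) (\<lambda>c. crossed_mult A H4 act f a h c g)"
  unfolding crossed_mult_def by ((intro lin_intros; assumption)+)

lemma smul_K: "car K = car (tensor A H4)" "smul K = smul (tensor A H4)"
  by (simp_all add: crossed_def)

lemma is_vec_K [simp]: "is_vec K"
  using is_vec_cong[OF smul_K] by simp

lemma lin_K: "lin V K = lin V (tensor A H4)" "lin K W = lin (tensor A H4) W"
  by (rule lin_vec_cong; simp add: smul_K)+

lemma bilin_crossed_mult: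
  "a \<in> car A \<Longrightarrow> bilin A H4 (tensor A H4) (crossed_mult A H4 act f a h)"
  "c \<in> car A \<Longrightarrow> bilin A H4 (tensor A H4) (\<lambda>a h. crossed_mult A H4 act f a h c g)"
  by (rule bilin_linI; simp add: crossed_mult_lin)+

lemma mult_K: "mult K = (\<lambda>s t. ext A H4 (\<lambda>a h. ext A H4 (crossed_mult A H4 act f a h) t) s)"
  by (simp add: crossed_def)

lemma bilin_mult_K_inner:
  assumes "t \<in> car (tensor A H4)"
  shows "bilin A H4 (tensor A H4) (\<lambda>a h. ext A H4 (crossed_mult A H4 act f a h) t)"
  by (rule bilin_ext_param) (simp_all add: bilin_crossed_mult assms)

lemma bilin_mult_K: "bilin (tensor A H4) (tensor A H4) (tensor A H4) (mult K)"
  unfolding mult_K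
  by (intro bilin_linI lin_ext_param)
     (auto intro!: bilin_mult_K_inner lin_ext bilin_crossed_mult crossed_mult_lin)

lemma mult_K_pure:
  assumes "a \<in> car A" "c \<in> car A"
  shows "mult K (pure A H4 a h) (pure A H4 c g) = crossed_mult A H4 act f a h c g"
  unfolding mult_K
  using assms by (simp add: ext_pure[OF is_vec_tensor bilin_mult_K_inner] ext_pure[OF is_vec_tensor bilin_crossed_mult(1)])

lemma crossed_mult_put:
  assumes "p \<in> car A" "q \<in> car A"
  shows "crossed_mult A H4 act f p (put 1 b) q (put 1 c) =
    (\<Sum>(b1, b')\<leftarrow>h4_comult b. \<Sum>(b2, b3)\<leftarrow>h4_comult b'. \<Sum>(c1, c2)\<leftarrow>h4_comult c.
      pure A H4 (mult A (mult A p (act (put 1 b1) q)) (f (put 1 b2) (put 1 c1))) (mult H4 (put 1 b3) (put 1 c2)))"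
proof -
  let ?T = "\<lambda>h1 h2 h3 g1 g2. P p h1 q h2 g1 h3 g2"
  let ?I = "\<lambda>h1 h2 h3. ext H4 H4 (?T h1 h2 h3) (comult H4 (put 1 c))"
  have 1: "bilin H4 H4 (tensor A H4) (?T h1 h2 h3)" for h1 h2 h3
    by (intro lin_intros; (rule assms)?)
  have 2: "bilin H4 H4 (tensor A H4) (?I h1)" for h1
    by (intro lin_intros; (rule assms)?)
  have 3: "bilin H4 H4 (tensor A H4) (\<lambda>h1 h'. ext H4 H4 (?I h1) (comult H4 h'))"
    by (intro lin_intros; (rule assms)?)
  show ?thesis
    unfolding crossed_mult_def
    unfolding ext_comult_H4[OF is_vec_tensor 3]
    unfolding ext_comult_H4[OF is_vec_tensor 2]
    unfolding ext_comult_H4[OF is_vec_tensor 1] by (rule refl)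
qed

text \<open>
  \<open>\<Phi>\<close> and \<open>\<Psi>\<close> are the mutually inverse linear maps between \<open>A\<^sup>4\<close> and \<open>A \<otimes> H\<^sub>4\<close>.
\<close>

definition \<Phi> :: "(h4b \<Rightarrow> 'a) \<Rightarrow> ('a, h4b \<Rightarrow> 'k, 'k) tens" where
  "\<Phi> u = pure A H4 (u B1) (put 1 B1) + pure A H4 (u Bg) (put 1 Bg) +
    pure A H4 (u Bx) (put 1 Bx) + pure A H4 (u Bgx) (put 1 Bgx)"

definition \<Psi> :: "('a, h4b \<Rightarrow> 'k, 'k) tens \<Rightarrow> h4b \<Rightarrow> 'a" where
  "\<Psi> = ext A H4 (\<lambda>p h b. smul A (h b) p)"

text \<open>
  The crossed product with its multiplication carried over to coordinates.
\<close>

definition C :: "('k, h4b \<Rightarrow> 'a) bialg" where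
  "C = (Aa A 0)\<lparr>mult := \<lambda>u v. \<Psi> (mult K (\<Phi> u) (\<Phi> v))\<rparr>"

sublocale h4_coords A C
  by unfold_locales (simp_all add: C_def Aa_def)

lemma bilin_smul: "bilin A H4 C (\<lambda>p h b. smul A (h b) p)"
  by (rule bilinI) (auto simp: car_X smul_X smul_H4 fun_eq_iff mult.commute)

lemma lin_\<Psi>: "lin (tensor A H4) C \<Psi>"
  unfolding \<Psi>_def by (rule lin_ext[OF is_vec is_vec_H4 is_vec_X bilin_smul])

lemma \<Psi>_pure: "p \<in> car A \<Longrightarrow> \<Psi> (pure A H4 p h) = (\<lambda>b. smul A (h b) p)"
  unfolding \<Psi>_def by (rule ext_pure[OF is_vec_X bilin_smul]) auto

lemma lin_\<Phi>: "lin C (tensor A H4) \<Phi>"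
  by (rule linI) (simp_all add: \<Phi>_def vec_closed(2) pure_closed smul_X vec_smul add_ac)

lemma pure_AH_0: "pure A H4 0 h = 0"
  by (rule bilin_0(1)[OF is_vec is_vec_H4 bilin_pure[OF is_vec is_vec_H4]]) simp

lemma \<Phi>_put: "\<Phi> (put p b) = pure A H4 p (put 1 b)"
  by (cases b) (simp_all add: \<Phi>_def put_apply pure_AH_0)

lemma \<Psi>_\<Phi>: "u \<in> car C \<Longrightarrow> \<Psi> (\<Phi> u) = u"
proof (rule lin_eq_putI[where F = "\<lambda>u. \<Psi> (\<Phi> u)" and G = "\<lambda>u. u"])
  show "lin C C (\<lambda>u. \<Psi> (\<Phi> u))" by (rule lin_compose[OF lin_\<Phi> lin_\<Psi>])
  show "lin C C (\<lambda>u. u)" by (simp add: lin_def)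
  show "\<Psi> (\<Phi> (put p b)) = put p b" if "p \<in> car A" for p b
    using that by (simp add: \<Phi>_put \<Psi>_pure fun_eq_iff put_apply)
qed

lemma \<Phi>_\<Psi>: "t \<in> car (tensor A H4) \<Longrightarrow> \<Phi> (\<Psi> t) = t"
proof (rule lin_eq_tensorI[where F = "\<lambda>t. \<Phi> (\<Psi> t)" and G = "\<lambda>t. t", OF is_vec is_vec_H4 is_vec_tensor])
  show "lin (tensor A H4) (tensor A H4) (\<lambda>t. \<Phi> (\<Psi> t))" by (rule lin_compose[OF lin_\<Psi> lin_\<Phi>])
  show "lin (tensor A H4) (tensor A H4) (\<lambda>t. t)" by (simp add: lin_def)
  fix p and h :: "h4b \<Rightarrow> 'k" assume p: "p \<in> car A"
  let ?h = "\<lambda>b. smul H4 (h b) (put 1 b)"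
  have h: "?h B1 + ?h Bg + ?h Bx + ?h Bgx = h"
    by (rule eq_coordsI) (simp_all add: smul_H4 put_apply)
  have "pure A H4 (smul A (h b) p) (put 1 b) = pure A H4 p (?h b)" for b
    using p by simp
  then have "\<Phi> (\<Psi> (pure A H4 p h)) = pure A H4 p (?h B1) + pure A H4 p (?h Bg) + pure A H4 p (?h Bx) + pure A H4 p (?h Bgx)"
    using p by (simp only: \<Psi>_pure \<Phi>_def)
  also have "\<dots> = pure A H4 p (?h B1 + ?h Bg + ?h Bx + ?h Bgx)"
    by (simp only: pure_AH(3)[OF p car_H4 car_H4])
  finally show "\<Phi> (\<Psi> (pure A H4 p h)) = pure A H4 p h" unfolding h .
qed

lemma \<Phi>_closed: "u \<in> car C \<Longrightarrow> \<Phi> u \<in> car (tensor A H4)"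
  by (rule linD(1)[OF lin_\<Phi>])

lemma \<Psi>_closed: "t \<in> car (tensor A H4) \<Longrightarrow> \<Psi> t \<in> car C"
  by (rule linD(1)[OF lin_\<Psi>])

lemma mult_C: "mult C u v = \<Psi> (mult K (\<Phi> u) (\<Phi> v))"
  by (simp add: C_def)

lemma bilin_mult_C: "bilin C C C (mult C)"
proof -
  have "lin C C (\<lambda>v. \<Psi> (mult K (\<Phi> u) (\<Phi> v)))" "lin C C (\<lambda>v. \<Psi> (mult K (\<Phi> v) (\<Phi> u)))" if "u \<in> car C" for u
    by (rule lin_compose[OF lin_compose[OF lin_\<Phi> bilin_lin(1)[OF bilin_mult_K \<Phi>_closed[OF that]]] lin_\<Psi>])
       (rule lin_compose[OF lin_compose[OF lin_\<Phi> bilin_lin(2)[OF bilin_mult_K \<Phi>_closed[OF that]]] lin_\<Psi>])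
  moreover have "mult C = (\<lambda>u v. \<Psi> (mult K (\<Phi> u) (\<Phi> v)))" by (simp add: C_def)
  ultimately show ?thesis by (intro bilin_linI) simp_all
qed

text \<open>
  On basis vectors of \<open>H\<^sub>4\<close> all coproducts in \<open>crossed_mult\<close> are finite lists, so that any particular
  product can be computed by simplification.
\<close>

lemma mult_C_put:
  assumes "p \<in> car A" "q \<in> car A"
  shows "mult C (put p b) (put q c) =
    (\<Sum>(b1, b')\<leftarrow>h4_comult b. \<Sum>(b2, b3)\<leftarrow>h4_comult b'. \<Sum>(c1, c2)\<leftarrow>h4_comult c.
      put (smul A (h4_coef b3 c2) (mult A (mult A p (act (put 1 b1) q)) (f (put 1 b2) (put 1 c1)))) (h4_mult b3 c2))"
proof -
  have s: "\<Psi> (pure A H4 z (mult H4 (put 1 b) (put 1 c))) = put (smul A (h4_coef b c) z) (h4_mult b c)"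
    if "z \<in> car A" for z b c
    using that by (simp add: \<Psi>_pure mult_H4_put fun_eq_iff put_apply del: put_smul)
  note [simp] = linD(2)[OF lin_\<Psi>] pure_closed vec_closed[OF is_vec_tensor]
  show ?thesis
    unfolding mult_C \<Phi>_put mult_K_pure[OF assms] crossed_mult_put[OF assms]
    using assms by (cases b; cases c; simp add: s del: put_smul mult_H4_simps)
qed

lemma unity_K: "unity K = pure A H4 (unity A) (put 1 B1)"
  by (simp add: crossed_def unity_H4)

abbreviation "comult_K_inner p h \<equiv> ext A A (\<lambda>a1 a2. ext H4 H4 (\<lambda>h1 h2.
          pure (tensor A H4) (tensor A H4) (pure A H4 a1 h1) (pure A H4 a2 h2)) (comult H4 h)) (comult A p)"

lemma comult_K: "comult K = ext A H4 (\<lambda>p h. comult_K_inner p h)"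
  by (simp add: crossed_def)

lemma bilin_comult_K:
  "bilin H4 H4 (tensor (tensor A H4) (tensor A H4)) (\<lambda>h1 h2.
          pure (tensor A H4) (tensor A H4) (pure A H4 a1 h1) (pure A H4 a2 h2))" (is ?A) if "a1 \<in> car A" "a2 \<in> car A" for a1 a2
  using that by (intro bilinI) (simp_all add: pure_closed bilinD[OF bilin_pure[OF is_vec_tensor is_vec_tensor]])

lemma bilin_comult_K':
  "bilin A A (tensor (tensor A H4) (tensor A H4)) (\<lambda>a1 a2. ext H4 H4 (\<lambda>h1 h2.
          pure (tensor A H4) (tensor A H4) (pure A H4 a1 h1) (pure A H4 a2 h2)) (comult H4 h))"
  by (rule bilin_ext_param)
    (auto intro!: bilin_comult_K linD(1)[OF lin_comult_H4] bilinI simp: pure_closed bilinD[OF bilin_pure[OF is_vec_tensor is_vec_tensor]])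

lemma bilin_comult_K_inner:
  "bilin A H4 (tensor (tensor A H4) (tensor A H4)) (\<lambda>p h. comult_K_inner p h)"
  by (intro bilin_linI lin_ext_param lin_compose[OF lin_comult_H4 lin_ext] lin_compose[OF lin_comult lin_ext]
      bilin_comult_K bilin_comult_K' is_vec is_vec_H4 is_vec_tensor comult_closed)

lemma pure_K: "pure K K = pure (tensor A H4) (tensor A H4)"
  by (rule pure_vec_cong) (simp_all add: smul_K)

lemma tensor_K: "tensor K K = tensor (tensor A H4) (tensor A H4)"
  by (rule tensor_vec_cong) (simp_all add: smul_K)

lemma comult_K_put:
  assumes p: "p \<in> car A"
  shows "comult K (\<Phi> (put p b)) = (\<Sum>(p1, p2)\<leftarrow>sweedler A p. \<Sum>(c, d)\<leftarrow>h4_comult b.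
    pure K K (\<Phi> (put p1 c)) (\<Phi> (put p2 d)))"
proof -
  have "comult K (\<Phi> (put p b)) = comult_K_inner p (put 1 b)"
    unfolding \<Phi>_put comult_K by (rule ext_pure[OF is_vec_tensor bilin_comult_K_inner p car_H4])
  also have "\<dots> = (\<Sum>(p1, p2)\<leftarrow>sweedler A p. \<Sum>(c, d)\<leftarrow>h4_comult b.
    pure K K (\<Phi> (put p1 c)) (\<Phi> (put p2 d)))"
    unfolding ext_comult[OF p is_vec_tensor bilin_comult_K'] pure_K \<Phi>_put
    by (rule sweedler_cong[OF p]) (rule ext_comult_H4[OF is_vec_tensor bilin_comult_K])
  finally show ?thesis .
qed

text \<open>
  \<open>\<Phi>\<close> respects the multiplication by the definition of \<open>C\<close>, and the coalgebra structures because both are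
  those of \<open>A \<otimes> H\<^sub>4\<close>.
\<close>

lemma iso_C_K: "is_hopf_iso C K \<Phi>"
proof -
  have "bij_betw \<Phi> (car C) (car (tensor A H4))"
    by (rule bij_betw_byWitness[where f' = \<Psi>]) (auto simp: \<Psi>_\<Phi> \<Phi>_\<Psi> \<Phi>_closed \<Psi>_closed)
  moreover have "\<Phi> (mult C u v) = mult K (\<Phi> u) (\<Phi> v)" if "u \<in> car C" "v \<in> car C" for u v
    unfolding mult_C by (rule \<Phi>_\<Psi>) (simp add: bilinD(1)[OF bilin_mult_K] \<Phi>_closed that)
  moreover have "\<Phi> (unity C) = unity K"
    by (simp add: unity_K unity_X \<Phi>_put)
  moreover have "comult K (\<Phi> u) = ext C C (\<lambda>p q. pure K K (\<Phi> p) (\<Phi> q)) (comult C u)" if u: "u \<in> car C" for u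
  proof -
    have b: "bilin C C (tensor K K) (\<lambda>p q. pure K K (\<Phi> p) (\<Phi> q))"
      by (rule bilinI) (simp_all add: linD[OF lin_\<Phi>, folded smul_K] bilinD[OF bilin_pure[OF is_vec_K is_vec_K]])
    have l: "lin C (tensor K K) (\<lambda>u. comult K (\<Phi> u))"
      unfolding tensor_K comult_K
      by (rule lin_compose[OF lin_\<Phi> lin_ext[OF is_vec is_vec_H4 is_vec_tensor bilin_comult_K_inner]])
    show ?thesis
      by (rule lin_eq_putI[where F = "\<lambda>u. comult K (\<Phi> u)" and G = "\<lambda>u. ext C C (\<lambda>p q. pure K K (\<Phi> p) (\<Phi> q)) (comult C u)",
          OF l lin_compose[OF X.lin_comult lin_ext[OF is_vec_X is_vec_X is_vec_tensor b]] _ u])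
        (simp add: comult_K_put ext_comult_put[OF _ is_vec_tensor b])
  qed
  moreover have "counit K (\<Phi> u) = counit C u" if u: "u \<in> car C" for u
  proof -
    have b: "bilin A H4 ground (\<lambda>a h. counit A a * counit H4 h)"
      by (rule bilinI) (simp_all add: counit_H4 smul_H4 ground_def algebra_simps)
    have k: "counit K = ext A H4 (\<lambda>a h. counit A a * counit H4 h)" by (simp add: crossed_def)
    have e: "ext A H4 (\<lambda>a h. counit A a * counit H4 h) (\<Phi> (put p b)) = counit A p * counit H4 (put 1 b)"
      if "p \<in> car A" for p b
      unfolding \<Phi>_put by (rule ext_pure[OF is_vec_ground b that car_H4])
    have l: "lin C ground (counit C)"
      using is_coalgebra_X by (simp add: is_coalgebra_def)
    show ?thesis
      unfolding k
      by (rule lin_eq_putI[where F = "\<lambda>u. ext A H4 (\<lambda>a h. counit A a * counit H4 h) (\<Phi> u)" and G = "counit C",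
          OF lin_compose[OF lin_\<Phi> lin_ext[OF is_vec is_vec_H4 is_vec_ground b]] l _ u], rename_tac p b, case_tac b)
        (simp_all only: e, simp_all add: counit_X counit_H4 put_apply)
  qed
  ultimately show ?thesis
    unfolding is_hopf_iso_def lin_K smul_K using lin_\<Phi> by simp
qed

text \<open>
  Since \<open>C\<close> and \<open>A\<^sub>(\<^sub>a\<^sub>)\<close> are the same coalgebra, only their products have to be compared, and by
  bilinearity only on the \<open>p \<cdot> b\<close>.
\<close>

lemma iso_Aa_K:
  assumes "a \<in> ZP A" and "\<And>p q b c. p \<in> car A \<Longrightarrow> q \<in> car A \<Longrightarrow> mult C (put p b) (put q c) = mult (Aa A a) (put p b) (put q c)"
  shows "is_hopf_iso (Aa A a) K \<Phi>"
proof -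
  interpret Z: hopf_ZP A a by unfold_locales (rule assms(1))
  have e: "car (Aa A a) = car C" "smul (Aa A a) = smul C" "unity (Aa A a) = unity C" "comult (Aa A a) = comult C" "counit (Aa A a) = counit C"
    by (simp_all add: X Z.X)
  have b: "bilin C C C (mult (Aa A a))"
    using Z.bilin_mult_X unfolding bilin_vec_cong[OF e(1,2,1,2,1,2)] .
  have m: "mult (Aa A a) u v = mult C u v" if "u \<in> car C" "v \<in> car C" for u v
    by (rule bilin_eq_putI[where F = "mult (Aa A a)" and G = "mult C", OF b bilin_mult_C _ that]) (simp only: assms(2))
  have "is_hopf_iso (Aa A a) K \<Phi> = is_hopf_iso C K \<Phi>"
    unfolding is_hopf_iso_def e lin_vec_cong[OF e(1,2) refl refl] ext_vec_cong[OF e(1,2,1,2)]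
    by (simp only: m cong: ball_cong)
  then show ?thesis using iso_C_K by simp
qed

end

section \<open>From central primitive elements to crossed products\<close>

definition trivial_act where
  "trivial_act A h q = smul A (counit H4 h) q"

text \<open>
  For the trivial action, applying \<open>id \<otimes> \<epsilon>\<close> to \<open>(1 # h)(1 # k) = f(h\<^sub>(\<^sub>1\<^sub>), k\<^sub>(\<^sub>1\<^sub>)) # h\<^sub>(\<^sub>2\<^sub>) k\<^sub>(\<^sub>2\<^sub>)\<close> yields \<open>f(h, k)\<close>, so
  the cocycle is read off from the products in \<open>A\<^sub>(\<^sub>a\<^sub>)\<close>: \<open>xx = a\<close>, \<open>x(gx) = -ag\<close>, \<open>(gx)x = ag\<close>,
  \<open>(gx)(gx) = -a\<close> with \<open>\<epsilon>(g) = 1\<close>.  A product with exactly one factor \<open>x\<close> or \<open>gx\<close> is killed by \<open>\<epsilon>\<close>, and the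
  products of \<open>1\<close> and \<open>g\<close> account for the term with the counits.
\<close>

definition ZP_cocycle where
  "ZP_cocycle A a h k = smul A (counit H4 h * counit H4 k) (unity A) +
     smul A (h Bx * k Bx - h Bx * k Bgx + h Bgx * k Bx - h Bgx * k Bgx) a"

lemma lin_eq_H4I:
  assumes "lin H4 W F" "lin H4 W G" "\<And>b. F (put 1 b) = G (put 1 b)"
  shows "F h = G h"
proof -
  let ?h = "\<lambda>b. smul H4 (h b) (put 1 b)"
  have h: "?h B1 + ?h Bg + ?h Bx + ?h Bgx = h"
    by (rule eq_coordsI) (simp_all add: smul_H4 put_apply)
  have "L (?h B1 + ?h Bg + ?h Bx + ?h Bgx) =
      smul W (h B1) (L (put 1 B1)) + smul W (h Bg) (L (put 1 Bg)) + smul W (h Bx) (L (put 1 Bx)) + smul W (h Bgx) (L (put 1 Bgx))"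
    if "lin H4 W L" for L
    by (simp only: linD(2,3)[OF that] car_H4)
  from this[OF assms(1)] this[OF assms(2)] show ?thesis unfolding h assms(3) by simp
qed

lemma (in hopf) is_weak_action_trivial: "is_weak_action H4 A (trivial_act A)"
proof -
  have b: "bilin H4 A A (trivial_act A)"
    by (rule bilinI) (simp_all add: trivial_act_def counit_H4 smul_H4 algebra_simps)
  have c: "ext H4 H4 (\<lambda>h1 h2. mult A (trivial_act A h1 a) (trivial_act A h2 b)) (comult H4 h) = trivial_act A h (mult A a b)"
    if ab: "a \<in> car A" "b \<in> car A" for h a b
  proof (rule lin_eq_H4I[where F = "\<lambda>h. ext H4 H4 (\<lambda>h1 h2. mult A (trivial_act A h1 a) (trivial_act A h2 b)) (comult H4 h)"
      and G = "\<lambda>h. trivial_act A h (mult A a b)"])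
    have b2: "bilin H4 H4 A (\<lambda>h1 h2. mult A (trivial_act A h1 a) (trivial_act A h2 b))"
      by (rule bilinI) (use ab in \<open>simp_all add: bilinD[OF b]\<close>)
    show "lin H4 A (\<lambda>h. ext H4 H4 (\<lambda>h1 h2. mult A (trivial_act A h1 a) (trivial_act A h2 b)) (comult H4 h))"
      by (rule lin_compose[OF lin_comult_H4 lin_ext[OF is_vec_H4 is_vec_H4 is_vec b2]])
    show "lin H4 A (\<lambda>h. trivial_act A h (mult A a b))"
      using ab by (intro bilin_lin(2)[OF b]) simp
    show "ext H4 H4 (\<lambda>h1 h2. mult A (trivial_act A h1 a) (trivial_act A h2 b)) (comult H4 (put 1 c)) = trivial_act A (put 1 c) (mult A a b)" for c
      unfolding ext_comult_H4[OF is_vec b2]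
      using ab by (cases c) (simp_all add: trivial_act_def counit_H4 put_apply)
  qed
  show ?thesis
    unfolding is_weak_action_def using b c by (auto simp: trivial_act_def unity_H4 counit_H4 put_apply)
qed

lemma (in hopf_ZP) crossed_H4_ZP: "crossed_H4 A (trivial_act A) (ZP_cocycle A a)"
proof
  show "is_weak_action H4 A (trivial_act A)" by (rule is_weak_action_trivial)
  show "bilin H4 H4 A (ZP_cocycle A a)"
    by (rule bilinI) (simp_all add: ZP_cocycle_def counit_H4 smul_H4 algebra_simps)
qed

lemma (in hopf_ZP) iso_crossed_ZP:
  "\<exists>\<phi>. is_hopf_iso (Aa A a) (crossed A H4 (trivial_act A) (ZP_cocycle A a)) \<phi>"
proof -
  interpret K: crossed_H4 A "trivial_act A" "ZP_cocycle A a" by (rule crossed_H4_ZP)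
  have "is_hopf_iso (Aa A a) K.K K.\<Phi>"
  proof (rule K.iso_Aa_K[OF ZP])
    fix p q b c assume pq: "p \<in> car A" "q \<in> car A"
    show "mult K.C (put p b) (put q c) = mult X (put p b) (put q c)"
      unfolding K.mult_C_put[OF pq] mult_put[OF pq]
      using pq by (cases b; cases c; simp add: trivial_act_def ZP_cocycle_def counit_H4 put_apply h4_coef_def coef_def del: put_smul K.put_smul)
  qed
  then show ?thesis by blast
qed

section \<open>From crossed products to central primitive elements\<close>

text \<open>
  A crossed product of Hopf algebras with \<open>H\<^sub>4\<close>.  In coordinates \<open>g\<close> and \<open>x\<close> become \<open>g1\<close> and \<open>x1\<close>.
\<close>

locale crossed_hopf_H4 = crossed_H4 A act f for A :: "('k::field, 'a::ab_group_add) bialg" and act f +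
  assumes hopf_K: "is_hopf (crossed A H4 act f)"
begin

lemma is_hopf_C: "is_hopf C"
proof (rule hopf_transport[OF hopf_K is_vec_X])
  show "is_hopf_iso K C (inv_into (car C) \<Phi>)"
    by (rule hopf_iso_sym[OF is_vec_X X.lin_comult is_vec_K _ _ iso_C_K])
      (simp_all add: bilinD(1)[OF bilin_mult_C] unity_X)
qed

sublocale HC: hopf C
  by unfold_locales (rule is_hopf_C)

lemma act_unity [simp]:
  "q \<in> car A \<Longrightarrow> act (put 1 B1) q = q"
  "act (put 1 Bg) (unity A) = unity A" "act (put 1 Bx) (unity A) = 0" "act (put 1 Bgx) (unity A) = 0"
  using weak by (simp_all add: is_weak_action_def unity_H4 counit_H4 put_apply)

text \<open>
  That \<open>1 # 1\<close> is a unit normalises the cocycle.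
\<close>

lemma f_unity [simp]:
  "f (put 1 B1) (put 1 B1) = unity A" "f (put 1 B1) (put 1 Bg) = unity A"
  "f (put 1 B1) (put 1 Bx) = 0" "f (put 1 B1) (put 1 Bgx) = 0"
  "f (put 1 Bg) (put 1 B1) = unity A" "f (put 1 Bx) (put 1 B1) = 0" "f (put 1 Bgx) (put 1 B1) = 0"
proof -
  have 1: "mult C (put (unity A) B1) (put (unity A) c) d = put (unity A) c d" for c d
    using HC.unity_simps(2)[of "put (unity A) c"] by (simp add: unity_X)
  have 2: "mult C (put (unity A) c) (put (unity A) B1) d = put (unity A) c d" for c d
    using HC.unity_simps(3)[of "put (unity A) c"] by (simp add: unity_X)
  note [simp] = mult_C_put put_apply h4_coef_def
  \<comment> \<open>The coordinate at \<open>d\<close> isolates \<open>f(1, c)\<close> or \<open>f(c, 1)\<close> if \<open>c \<otimes> d\<close> occurs in \<open>\<Delta>(c)\<close>.\<close>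
  show "f (put 1 B1) (put 1 B1) = unity A" using 1[of B1 B1] by (simp del: put_smul)
  show "f (put 1 B1) (put 1 Bg) = unity A" using 1[of Bg Bg] by (simp del: put_smul)
  show "f (put 1 B1) (put 1 Bx) = 0" using 1[of Bx B1] by (simp del: put_smul)
  show "f (put 1 B1) (put 1 Bgx) = 0" using 1[of Bgx Bg] by (simp del: put_smul)
  show "f (put 1 Bg) (put 1 B1) = unity A" using 2[of Bg Bg] by (simp del: put_smul)
  show "f (put 1 Bx) (put 1 B1) = 0" using 2[of Bx B1] by (simp del: put_smul)
  show "f (put 1 Bgx) (put 1 B1) = 0" using 2[of Bgx Bg] by (simp del: put_smul)
qed

abbreviation g1 where "g1 \<equiv> put (unity A) Bg"
abbreviation x1 where "x1 \<equiv> put (unity A) Bx"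
abbreviation act_g where "act_g \<equiv> act (put 1 Bg)"
abbreviation act_x where "act_x \<equiv> act (put 1 Bx)"
abbreviation f_gg where "f_gg \<equiv> f (put 1 Bg) (put 1 Bg)"
abbreviation f_xg where "f_xg \<equiv> f (put 1 Bx) (put 1 Bg)"
abbreviation f_gx where "f_gx \<equiv> f (put 1 Bg) (put 1 Bx)"
abbreviation f_xx where "f_xx \<equiv> f (put 1 Bx) (put 1 Bx)"

lemma mult_1: "p \<in> car A \<Longrightarrow> q \<in> car A \<Longrightarrow> mult C (put p B1) (put q c) = put (mult A p q) c"
  by (cases c) (simp_all add: mult_C_put h4_coef_def del: put_smul)

lemma products:
  "q \<in> car A \<Longrightarrow> mult C g1 (put q B1) = put (act_g q) Bg"
  "q \<in> car A \<Longrightarrow> mult C x1 (put q B1) = put (act_x q) B1 + put (act_g q) Bx"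
  "mult C g1 g1 = put f_gg B1"
  "mult C x1 x1 = put f_xx B1 + put (f_xg + f_gx) Bx"
  "mult C x1 g1 = put f_xg Bg - put f_gg Bgx"
  "mult C g1 x1 = put f_gx Bg + put f_gg Bgx"
  by (simp_all add: mult_C_put h4_coef_def del: put_smul)

lemma counit_f_gg: "counit A f_gg = 1"
  using HC.counit_mult(1)[of g1 g1] by (simp add: products(3) counit_X put_apply)

lemma counit_act_g: "q \<in> car A \<Longrightarrow> counit A (act_g q) = counit A q"
  using HC.counit_mult(1)[of g1 "put q B1"] by (simp add: products(1) counit_X put_apply)

text \<open>
  The coefficient of \<open>d \<otimes> e\<close> in \<open>\<Delta>(z)\<close> is an element of \<open>A \<otimes> A\<close>; \<open>coeff d e z\<close> is its image under \<open>\<epsilon> \<otimes> id\<close>.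
  The action and the cocycle are found by computing it in two ways for a product \<open>z\<close>: from the coordinates of \<open>z\<close> with \<open>coeff_put\<close>, and from the coproducts of
  the factors with \<open>coeff_mult\<close> and \<open>coeff_mult_embed\<close>.
\<close>

definition coeff where
  "coeff d e z = ext C C (\<lambda>s t. smul A (counit A (s d)) (t e)) (comult C z)"

lemma bilin_coeff: "bilin C C A (\<lambda>s t. smul A (counit A (s d)) (t e))"
  by (rule bilinI) (simp_all add: smul_X mult.commute)

lemma lin_coeff: "lin C A (coeff d e)"
  unfolding coeff_def[abs_def] by (rule lin_compose[OF X.lin_comult lin_ext[OF is_vec_X is_vec_X is_vec bilin_coeff]])

lemma coeff_put:
  assumes p: "p \<in> car A" shows "coeff d e (put p b) = (if (d, e) \<in> set (h4_comult b) then p else 0)"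
proof -
  show ?thesis
    unfolding coeff_def ext_comult_put[OF p is_vec bilin_coeff]
    using sweedler_counit(1)[OF p] by (cases b; cases d; cases e; simp add: put_apply sum_list_zero)
qed

lemma comult_basis:
  "set (map (\<lambda>(c, d). (put (unity A) c, put (unity A) d)) (h4_comult b)) \<subseteq> car C \<times> car C"
  "comult C (put (unity A) b) = (\<Sum>(s, t)\<leftarrow>map (\<lambda>(c, d). (put (unity A) c, put (unity A) d)) (h4_comult b). pure C C s t)"
  unfolding comult_put_ext[OF unity_simps(1)] comult_unity
    ext_pure[OF is_vec_tensor bilin_comult_put unity_simps(1) unity_simps(1)]
  by (auto simp: case_prod_unfold comp_def)

lemma comult_embed:
  assumes q: "q \<in> car A"
  shows "set (map (\<lambda>(c, d). (put c B1, put d B1)) (sweedler A q)) \<subseteq> car C \<times> car C"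
  "comult C (put q B1) = (\<Sum>(s, t)\<leftarrow>map (\<lambda>(c, d). (put c B1, put d B1)) (sweedler A q). pure C C s t)"
  using sweedler_in[OF _ q] by (auto simp: comult_put[OF q] case_prod_unfold comp_def)

lemma coeff_mult:
  "coeff d e (mult C (put (unity A) b) (put (unity A) c)) =
    (\<Sum>(b1, b2)\<leftarrow>h4_comult b. \<Sum>(c1, c2)\<leftarrow>h4_comult c.
       smul A (counit A (mult C (put (unity A) b1) (put (unity A) c1) d)) (mult C (put (unity A) b2) (put (unity A) c2) e))"
  unfolding coeff_def
  by (subst HC.ext_comult_mult[OF is_vec bilin_coeff _ _ comult_basis comult_basis])
    (simp_all add: case_prod_unfold comp_def)

lemma coeff_mult_embed:
  assumes q: "q \<in> car A"
  shows "coeff d e (mult C (put (unity A) b) (put q B1)) =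
    (\<Sum>(b1, b2)\<leftarrow>h4_comult b. \<Sum>(q1, q2)\<leftarrow>sweedler A q.
       smul A (counit A (mult C (put (unity A) b1) (put q1 B1) d)) (mult C (put (unity A) b2) (put q2 B1) e))"
  unfolding coeff_def
  by (subst HC.ext_comult_mult[OF is_vec bilin_coeff _ _ comult_basis comult_embed[OF q]])
    (simp_all add: case_prod_unfold comp_def q)

text \<open>
  The coefficient of \<open>x \<otimes> 1\<close> in \<open>\<Delta>(x q) = (x \<otimes> 1 + g \<otimes> x) \<Delta>(q)\<close> comes from \<open>x \<otimes> 1\<close> alone.
\<close>

lemma act_g_eq: assumes q: "q \<in> car A" shows "act_g q = q"
proof -
  have "act_g q = coeff Bx B1 (mult C x1 (put q B1))"
    using q by (simp add: products linD(2)[OF lin_coeff] coeff_put)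
  also have "\<dots> = (\<Sum>(q1, q2)\<leftarrow>sweedler A q. smul A (counit A q1) q2)"
    unfolding coeff_mult_embed[OF q]
    by (simp add: products mult_1 put_apply sum_list_zero counit_act_g cong: sweedler_cong[OF q])
  finally show ?thesis by (simp add: sweedler_counit q)
qed

text \<open>
  The coefficient of \<open>g \<otimes> 1\<close> in \<open>\<Delta>(x q)\<close> vanishes, as \<open>xq\<close> involves only \<open>1\<close> and \<open>x\<close>; in \<open>\<Delta>(x) \<Delta>(q)\<close> it comes
  from \<open>g \<otimes> x\<close>.
\<close>

lemma act_x_eq: assumes q: "q \<in> car A" shows "act_x q = 0"
proof -
  have "0 = coeff Bg B1 (mult C x1 (put q B1))"
    using q by (simp add: products linD(2)[OF lin_coeff] coeff_put)
  also have "\<dots> = (\<Sum>(q1, q2)\<leftarrow>sweedler A q. smul A (counit A q1) (act_x q2))"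
    unfolding coeff_mult_embed[OF q]
    by (simp add: products mult_1 put_apply sum_list_zero counit_act_g cong: sweedler_cong[OF q])
  also have "\<dots> = (\<Sum>(q1, q2)\<leftarrow>sweedler A q. act_x (smul A (counit A q1) q2))"
    by (rule sweedler_cong[OF q]) simp
  also have "\<dots> = act_x (\<Sum>(q1, q2)\<leftarrow>sweedler A q. smul A (counit A q1) q2)"
    by (rule sweedler_lin[symmetric, OF q is_vec bilin_lin(1)[OF bilin_act]]) simp_all
  finally show ?thesis by (simp add: sweedler_counit q)
qed

lemma mult_unit_basis: "mult C (put (unity A) B1) (put q c) = put q c" "mult C (put q c) (put (unity A) B1) = put q c"
  if "q \<in> car A" for q c
  using HC.unity_simps(2,3)[of "put q c"] that by (simp_all add: unity_X)

text \<open>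
  The coefficient of \<open>1 \<otimes> x\<close> in \<open>\<Delta>(x\<^sup>2)\<close> vanishes, as \<open>x\<^sup>2\<close> involves only \<open>1\<close> and \<open>x\<close>; in \<open>\<Delta>(x)\<^sup>2\<close> it comes from
  \<open>g\<^sup>2 \<otimes> x\<^sup>2\<close>, since \<open>xg\<close> and \<open>gx\<close> have no component at \<open>1\<close>.
\<close>

lemma anticommute: "f_xg + f_gx = 0"
proof -
  have "0 = coeff B1 Bx (mult C x1 x1)"
    by (simp add: products linD(2)[OF lin_coeff] coeff_put del: put_simps(2))
  also have "\<dots> = f_xg + f_gx"
    unfolding coeff_mult by (simp add: products mult_unit_basis put_apply counit_f_gg)
  finally show ?thesis by simp
qed

text \<open>
  In \<open>\<Delta>(g) \<Delta>(x) = gx \<otimes> g + g\<^sup>2 \<otimes> gx\<close> the coefficient of \<open>gx \<otimes> g\<close> comes from the first term.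
\<close>

lemma f_gg_eq: "f_gg = unity A"
proof -
  have "f_gg = coeff Bgx Bg (mult C g1 x1)"
    by (simp add: products linD(2)[OF lin_coeff] coeff_put)
  also have "\<dots> = unity A"
    unfolding coeff_mult by (simp add: products mult_unit_basis put_apply counit_f_gg)
  finally show ?thesis .
qed

text \<open>
  The same product, at \<open>1 \<otimes> g\<close>: only \<open>g\<^sup>2 \<otimes> gx\<close> contributes.
\<close>

lemma f_gx_eq: "f_gx = 0"
proof -
  have "0 = coeff B1 Bg (mult C g1 x1)"
    by (simp add: products linD(2)[OF lin_coeff] coeff_put)
  also have "\<dots> = f_gx"
    unfolding coeff_mult by (simp add: products mult_unit_basis put_apply counit_f_gg)
  finally show ?thesis by simp
qed

lemma f_xg_eq: "f_xg = 0"
  using anticommute by (simp add: f_gx_eq)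

abbreviation gx1 where "gx1 \<equiv> put (unity A) Bgx"

lemma relations:
  "q \<in> car A \<Longrightarrow> mult C g1 (put q B1) = put q Bg" "q \<in> car A \<Longrightarrow> mult C x1 (put q B1) = put q Bx"
  "mult C g1 g1 = put (unity A) B1" "mult C x1 x1 = put f_xx B1" "mult C x1 g1 = - gx1" "mult C g1 x1 = gx1"
  unfolding products f_gg_eq f_xg_eq f_gx_eq by (simp_all add: products act_g_eq act_x_eq f_gg_eq f_xg_eq f_gx_eq)

lemma mult_coset: "q \<in> car A \<Longrightarrow> mult C (put q B1) (put (unity A) c) = put q c"
  by (simp add: mult_1)

text \<open>
  \<open>x\<close> commutes with \<open>A\<close>, and hence so does \<open>x\<^sup>2\<close>.
\<close>

lemma f_xx_central: assumes q: "q \<in> car A" shows "mult A f_xx q = mult A q f_xx"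
proof -
  have xq: "mult C x1 (put q B1) = mult C (put q B1) x1" using q by (simp add: relations mult_coset)
  have "put (mult A f_xx q) B1 = mult C (mult C x1 x1) (put q B1)"
    using q by (simp add: relations mult_1)
  also have "\<dots> = mult C x1 (mult C (put q B1) x1)"
    unfolding xq[symmetric] using q by (intro HC.mult_assoc) simp_all
  also have "\<dots> = mult C (mult C x1 (put q B1)) x1"
    using q by (intro HC.mult_assoc[symmetric]) simp_all
  also have "\<dots> = mult C (mult C (put q B1) x1) x1"
    unfolding xq ..
  also have "\<dots> = mult C (put q B1) (mult C x1 x1)"
    using q by (intro HC.mult_assoc) simp_all
  also have "\<dots> = put (mult A q f_xx) B1" using q by (simp add: relations mult_1)
  finally have "put (mult A f_xx q) B1 B1 = put (mult A q f_xx) B1 B1" by (rule fun_cong)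
  then show ?thesis by (simp add: put_apply)
qed

text \<open>
  In \<open>\<Delta>(x)\<^sup>2 = x\<^sup>2 \<otimes> 1 + (xg + gx) \<otimes> x + g\<^sup>2 \<otimes> x\<^sup>2\<close> the middle term vanishes; take the component at \<open>1 \<otimes> 1\<close>.
\<close>

lemma f_xx_primitive: "comult A f_xx = pure A A f_xx (unity A) + pure A A (unity A) f_xx"
proof -
  have b: "bilin C C (tensor A A) (\<lambda>s t. pure A A (s B1) (t B1))"
    by (rule bilinI) (simp_all add: smul_X bilinD[OF bilin_pure'])
  have "ext C C (\<lambda>s t. pure A A (s B1) (t B1)) (comult C (put f_xx B1)) = comult A f_xx"
    unfolding ext_comult_put[OF f_simps(1)[OF car_H4 car_H4] is_vec_tensor b]
    by (simp add: put_apply sweedler(2)[symmetric])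
  moreover have "ext C C (\<lambda>s t. pure A A (s B1) (t B1)) (comult C (mult C x1 x1)) =
    pure A A f_xx (unity A) + pure A A (unity A) f_xx"
    by (subst HC.ext_comult_mult[OF is_vec_tensor b _ _ comult_basis comult_basis])
      (simp_all add: relations mult_unit_basis put_apply bilin_0[OF is_vec is_vec bilin_pure'])
  ultimately show ?thesis by (simp add: relations)
qed

lemma f_xx_ZP: "f_xx \<in> ZP A"
  using f_xx_central f_xx_primitive by (simp add: ZP_def primitives_def center_def)

sublocale Z: hopf_ZP A f_xx
  by unfold_locales (rule f_xx_ZP)

lemma mult_basis:
  "mult C (put (unity A) b) (put (unity A) c) = put (coef A f_xx b c) (h4_mult b c)"
proof -
  note m = HC.mult_assoc
  have g1: "g1 \<in> car C" and x1: "x1 \<in> car C" and gx1: "gx1 \<in> car C" and R: "put f_xx B1 \<in> car C" by simp_all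
  have g_gx: "mult C g1 gx1 = x1"
    using m[OF g1 g1 x1] by (simp add: relations mult_unit_basis)
  have gx_g: "mult C gx1 g1 = - x1"
    using m[OF g1 x1 g1] by (simp add: relations g_gx)
  have gx_x: "mult C gx1 x1 = put f_xx Bg"
    using m[OF g1 x1 x1] by (simp add: relations)
  have x_gx: "mult C x1 gx1 = - put f_xx Bg"
    using m[OF x1 g1 x1] by (simp add: relations gx_x)
  have g_rg: "mult C g1 (put f_xx Bg) = put f_xx B1"
    using m[OF g1 R g1] m[OF R g1 g1] by (simp add: relations mult_coset)
  have gx_gx: "mult C gx1 gx1 = - put f_xx B1"
    using m[OF g1 x1 gx1] by (simp add: relations x_gx g_rg)
  show ?thesis
    by (cases b; cases c; simp add: mult_unit_basis relations g_gx gx_g gx_x x_gx gx_gx coef_def)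
qed

text \<open>
  Since basis vectors commute with \<open>A\<close>, \<open>(p b)(q c) = p q (b c)\<close>, and \<open>mult_basis\<close> gives \<open>b c\<close>.
\<close>

lemma mult_C_eq:
  assumes p: "p \<in> car A" and q: "q \<in> car A"
  shows "mult C (put p b) (put q c) = mult (Aa A f_xx) (put p b) (put q c)"
proof -
  let ?b = "put (unity A) b" and ?c = "put (unity A) c"
  have *: "mult C (put (unity A) d) (put q B1) = mult C (put q B1) (put (unity A) d)" for d
  proof (cases d)
    case Bgx
    have "mult C (mult C g1 x1) (put q B1) = mult C g1 (mult C x1 (put q B1))"
      using q by (intro HC.mult_assoc) simp_all
    also have "\<dots> = mult C (mult C g1 (put q B1)) x1"
      using q by (subst HC.mult_assoc) (simp_all add: relations mult_coset)
    also have "\<dots> = mult C (put q B1) (mult C g1 x1)"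
      using q by (subst HC.mult_assoc[symmetric]) (simp_all add: relations mult_coset)
    finally show ?thesis by (simp add: Bgx relations)
  qed (use q in \<open>simp_all add: relations mult_coset mult_unit_basis\<close>)
  have "mult C (put p b) (put q c) = mult C (mult C (put p B1) ?b) (mult C (put q B1) ?c)"
    using p q by (simp add: mult_coset)
  also have "\<dots> = mult C (put p B1) (mult C (mult C ?b (put q B1)) ?c)"
    using p q by (simp only: HC.mult_assoc HC.mult_simps(1) put_closed unity_simps(1))
  also have "\<dots> = mult C (put p B1) (mult C (put q B1) (mult C ?b ?c))"
    unfolding * using q by (subst HC.mult_assoc) simp_all
  also have "\<dots> = put (mult A (mult A p q) (coef A f_xx b c)) (h4_mult b c)"
    unfolding mult_basis using p q by (simp add: mult_1 mult_assoc)
  finally show ?thesis using p q by (simp add: Z.mult_put)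
qed

lemma iso_Aa: "is_hopf_iso (Aa A f_xx) K \<Phi>"
  by (rule iso_Aa_K[OF f_xx_ZP mult_C_eq])

end

section \<open>Classification\<close>

theorem corollary3p3:
  fixes A :: "('k::field, 'a::ab_group_add) bialg"
    and E :: "('k, 'e::ab_group_add) bialg"
    and I :: "'i set" and e :: "'i \<Rightarrow> 'a"
  assumes char: "CHAR('k) \<noteq> 2"
    and A: "is_hopf A"
    and basis: "is_basis A I e"
    and E: "is_hopf E"
  shows "(\<forall>a\<in>ZP A. is_presented A I e a (Aa A a)
            (\<lambda>p. put p B1) (put (unity A) Bg) (put (unity A) Bx)) \<and>
         ((\<exists>act f. is_crossed_product_of_hopf_algebras A H4 act f \<and>
             hopf_isomorphic E (crossed A H4 act f)) \<longleftrightarrow>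
          (\<exists>a\<in>ZP A. hopf_isomorphic E (Aa A a)))"
proof (intro conjI iffI)
  interpret hopf A by unfold_locales (rule A)
  interpret E: hopf E by unfold_locales (rule E)
  show "\<forall>a\<in>ZP A. is_presented A I e a (Aa A a) (\<lambda>p. put p B1) (put (unity A) Bg) (put (unity A) Bx)"
  proof
    fix a assume "a \<in> ZP A"
    then interpret hopf_ZP A a by unfold_locales
    show "is_presented A I e a (Aa A a) (\<lambda>p. put p B1) (put (unity A) Bg) (put (unity A) Bx)"
      by (rule is_presented_X[OF basis])
  qed
  show "\<exists>a\<in>ZP A. hopf_isomorphic E (Aa A a)"
    if crossed: "\<exists>act f. is_crossed_product_of_hopf_algebras A H4 act f \<and> hopf_isomorphic E (crossed A H4 act f)"
  proof -
    obtain act f \<phi> where af: "is_weak_action H4 A act" "bilin H4 H4 A f" "is_hopf (crossed A H4 act f)"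
      and \<phi>: "is_hopf_iso E (crossed A H4 act f) \<phi>"
      using crossed by (auto simp: is_crossed_product_of_hopf_algebras_def hopf_isomorphic_def)
    interpret crossed_hopf_H4 A act f by unfold_locales (rule af)+
    interpret AX: hopf "Aa A f_xx" by unfold_locales (rule Z.is_hopf_X)
    have "is_hopf_iso K (Aa A f_xx) (inv_into (car (Aa A f_xx)) \<Phi>)"
      by (rule hopf_iso_sym[OF Z.is_vec_X Z.X.lin_comult is_vec_K _ _ iso_Aa]) simp_all
    then have "hopf_isomorphic E (Aa A f_xx)"
      unfolding hopf_isomorphic_def
      using hopf_iso_trans[OF E.is_vec E.lin_comult is_vec_K Z.is_vec_X \<phi>] by blast
    then show ?thesis using f_xx_ZP by blast
  qed
  show "\<exists>act f. is_crossed_product_of_hopf_algebras A H4 act f \<and> hopf_isomorphic E (crossed A H4 act f)"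
    if iso: "\<exists>a\<in>ZP A. hopf_isomorphic E (Aa A a)"
  proof -
    obtain a \<phi> where a: "a \<in> ZP A" and \<phi>: "is_hopf_iso E (Aa A a) \<phi>"
      using iso by (auto simp: hopf_isomorphic_def)
    interpret hopf_ZP A a by unfold_locales (rule a)
    interpret K: crossed_H4 A "trivial_act A" "ZP_cocycle A a" by (rule crossed_H4_ZP)
    obtain \<psi> where \<psi>: "is_hopf_iso (Aa A a) K.K \<psi>" using iso_crossed_ZP by blast
    have "is_hopf K.K" by (rule hopf_transport[OF is_hopf_X K.is_vec_K \<psi>])
    moreover have "is_hopf_iso E K.K (\<lambda>b. \<psi> (\<phi> b))"
      by (rule hopf_iso_trans[OF E.is_vec E.lin_comult is_vec_X K.is_vec_K \<phi> \<psi>])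
    ultimately show ?thesis
      unfolding is_crossed_product_of_hopf_algebras_def hopf_isomorphic_def
      using K.weak K.bilin_f by blast
  qed
qed

end
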